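(* A strict independence relation has weak canonical bases if and only if it is canonical. Moreover, if $\perp$ is a canonical independence relation and $B$ is an algebraically closed set, then the weak canonical base of a type $\operatorname{tp}(\bar a/B)$ is $\operatorname{aker}(\bar a_i)_{i<\omega}$, where $(\bar a_i)_{i<\omega}$ is an arbitrary $\perp$-Morley sequence for $\operatorname{tp}(\bar a/B)$.
   Context: $T$ is a complete consistent first-order theory (possibly many-sorted, e.g. of the form $T^{\mathrm{eq}}$); we work in a big saturated model of $T$. All sets are small subsets of the big model; $BC$ means $B\cup C$; $\operatorname{acl}$ is algebraic closure; tuples may be infinite and also denote the sets of their entries. $A\equiv_BA'$ means that some automorphism fixing $B$ pointwise maps the set $A$ onto $A'$; $(A,B,C)\equiv(A',B',C')$ means that some automorphism maps $A,B,C$ onto $A',B',C'$ respectively. An independence relation is a ternary relation $\perp$ between small sets satisfying: - (invariance) If $A\perp_CB$ and $(A',B',C')\equiv(A,B,C)$, then $A'\perp_{C'}B'$. - (monotonicity) If $A\perp_CB$, $A'\subseteq A$, $B'\subseteq B$, then $A'\perp_CB'$. - (base monotonicity) If $D\subseteq C\subseteq B$ and $A\perp_DB$, then $A\perp_CB$. - (transitivity) If $D\subseteq C\subseteq B$, $B\perp_CA$ and $C\perp_DA$, then $B\perp_DA$. - (normality) $A\perp_CB$ implies $AC\perp_CB$. - (extension) If $A\perp_CB$ and $\hat B\supseteq B$, then there is $A'\equiv_{BC}A$ with $A'\perp_C\hat B$. - (finite character) If $A_0\perp_CB$ for all finite $A_0\subseteq A$, then $A\perp_CB$. - (local character) For every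 $A$ there is a cardinal $\kappa(A)$ such that for any $B$ there is $C\subseteq B$ with $|C|<\kappa(A)$ and $A\perp_CB$. It is strict if moreover (anti-reflexivity) $a\perp_Ba$ implies $a\in\operatorname{acl}B$. It is canonical if it is strict and has the intersection property: whenever $C_1\subseteq B$ and $C_2\subseteq B$ are such that $A\perp_{C_1}B$ and $A\perp_{C_2}B$, then $A\perp_{\operatorname{acl}C_1\cap\operatorname{acl}C_2}B$. Weak canonical bases: for a tuple $\bar a$ and $B=\operatorname{acl}B$, an algebraically closed set $C\subseteq B$ is the weak canonical base (with respect to $\perp$) of $\operatorname{tp}(\bar a/B)$ if $C$ is the smallest algebraically closed subset of $B$ such that $\bar a\perp_CB$ (i.e. $\bar a\perp_CB$, and $C\subseteq D$ for every algebraically closed $D\subseteq B$ with $\bar a\perp_DB$). $\perp$ has weak canonical bases if $\operatorname{tp}(\bar a/B)$ has a weak canonical base for every tuple $\bar a$ and every algebraically closed set $B$. A $\perp$-Morley sequence for $p\in S(B)$ is a sequence of $B$-indiscernibles $(\bar a_i)_{i<\omega}$, each realising $p$, such that $(\bar a_i)_{i<n}\perp_B\bar a_n$ for every $n<\omega$. The algebraic kernel of a sequence of indiscernibles $(\bar a_i)_{i\in I}$ is $\operatorname{aker}(\bar a_i)_{i\in I}=\{d\mid d\in\operatorname{acl}(\{\bar a_i\mid i\in I\})\text{ and }(\bar a_i)_{i\in I}\text{ is indiscernible over }d\}$. *)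

theory Defs
  imports Main
begin

unbundle cardinal_syntax

section \<open>Many-sorted first-order logic\<close>

record ('s, 'f, 'r) language =
  sorts :: "'s set"
  funs :: "'f set"
  rels :: "'r set"
  fun_dom :: "'f \<Rightarrow> 's list"
  fun_cod :: "'f \<Rightarrow> 's"
  rel_dom :: "'r \<Rightarrow> 's list"

definition wf_language :: "('s, 'f, 'r) language \<Rightarrow> bool" where
  "wf_language L \<longleftrightarrow>
     (\<forall>f\<in>funs L. set (fun_dom L f) \<subseteq> sorts L \<and> fun_cod L f \<in> sorts L) \<and>
     (\<forall>r\<in>rels L. set (rel_dom L r) \<subseteq> sorts L)"

text \<open>Every sort has countably many variables; the second component is the sort.\<close>

type_synonym 's var = "nat \<times> 's"

datatype ('s, 'f) trm = Var "'s var" | Fun 'f "('s, 'f) trm list"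

datatype ('s, 'f, 'r) fm =
    Eq "('s, 'f) trm" "('s, 'f) trm"
  | Rel 'r "('s, 'f) trm list"
  | Neg "('s, 'f, 'r) fm"
  | Conj "('s, 'f, 'r) fm" "('s, 'f, 'r) fm"
  | Exi "'s var" "('s, 'f, 'r) fm"

fun trm_sort :: "('s, 'f, 'r) language \<Rightarrow> ('s, 'f) trm \<Rightarrow> 's" where
  "trm_sort L (Var v) = snd v"
| "trm_sort L (Fun f ts) = fun_cod L f"

fun wf_trm :: "('s, 'f, 'r) language \<Rightarrow> ('s, 'f) trm \<Rightarrow> bool" where
  "wf_trm L (Var v) \<longleftrightarrow> snd v \<in> sorts L"
| "wf_trm L (Fun f ts) \<longleftrightarrow>
     f \<in> funs L \<and> map (trm_sort L) ts = fun_dom L f \<and> (\<forall>t\<in>set ts. wf_trm L t)"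

fun wf_fm :: "('s, 'f, 'r) language \<Rightarrow> ('s, 'f, 'r) fm \<Rightarrow> bool" where
  "wf_fm L (Eq t u) \<longleftrightarrow> wf_trm L t \<and> wf_trm L u \<and> trm_sort L t = trm_sort L u"
| "wf_fm L (Rel r ts) \<longleftrightarrow>
     r \<in> rels L \<and> map (trm_sort L) ts = rel_dom L r \<and> (\<forall>t\<in>set ts. wf_trm L t)"
| "wf_fm L (Neg \<phi>) \<longleftrightarrow> wf_fm L \<phi>"
| "wf_fm L (Conj \<phi> \<psi>) \<longleftrightarrow> wf_fm L \<phi> \<and> wf_fm L \<psi>"
| "wf_fm L (Exi v \<phi>) \<longleftrightarrow> snd v \<in> sorts L \<and> wf_fm L \<phi>"

fun fv_trm :: "('s, 'f) trm \<Rightarrow> 's var set" where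
  "fv_trm (Var v) = {v}"
| "fv_trm (Fun f ts) = (\<Union>t\<in>set ts. fv_trm t)"

fun fv :: "('s, 'f, 'r) fm \<Rightarrow> 's var set" where
  "fv (Eq t u) = fv_trm t \<union> fv_trm u"
| "fv (Rel r ts) = (\<Union>t\<in>set ts. fv_trm t)"
| "fv (Neg \<phi>) = fv \<phi>"
| "fv (Conj \<phi> \<psi>) = fv \<phi> \<union> fv \<psi>"
| "fv (Exi v \<phi>) = fv \<phi> - {v}"

text \<open>
  The universe of a structure is the whole type \<open>'m\<close>, the disjoint union of the sorts: the sort \<open>s\<close>
  is interpreted by \<open>{m. sort_of M m = s}\<close>. The symbols are total on lists over \<open>'m\<close>; their values
  on ill-sorted lists never matter.
\<close>

record ('s, 'f, 'r, 'm) struct =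
  sort_of :: "'m \<Rightarrow> 's"
  fun_of :: "'f \<Rightarrow> 'm list \<Rightarrow> 'm"
  rel_of :: "'r \<Rightarrow> 'm list \<Rightarrow> bool"

definition is_structure :: "('s, 'f, 'r) language \<Rightarrow> ('s, 'f, 'r, 'm) struct \<Rightarrow> bool" where
  "is_structure L M \<longleftrightarrow>
     range (sort_of M) \<subseteq> sorts L \<and>
     (\<forall>f\<in>funs L. \<forall>xs. map (sort_of M) xs = fun_dom L f \<longrightarrow> sort_of M (fun_of M f xs) = fun_cod L f)"

fun eval :: "('s, 'f, 'r, 'm) struct \<Rightarrow> ('s var \<Rightarrow> 'm) \<Rightarrow> ('s, 'f) trm \<Rightarrow> 'm" where
  "eval M e (Var v) = e v"
| "eval M e (Fun f ts) = fun_of M f (map (eval M e) ts)"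

fun sat :: "('s, 'f, 'r, 'm) struct \<Rightarrow> ('s var \<Rightarrow> 'm) \<Rightarrow> ('s, 'f, 'r) fm \<Rightarrow> bool" where
  "sat M e (Eq t u) \<longleftrightarrow> eval M e t = eval M e u"
| "sat M e (Rel r ts) \<longleftrightarrow> rel_of M r (map (eval M e) ts)"
| "sat M e (Neg \<phi>) \<longleftrightarrow> \<not> sat M e \<phi>"
| "sat M e (Conj \<phi> \<psi>) \<longleftrightarrow> sat M e \<phi> \<and> sat M e \<psi>"
| "sat M e (Exi v \<phi>) \<longleftrightarrow> (\<exists>m. sort_of M m = snd v \<and> sat M (e(v := m)) \<phi>)"

definition sentences :: "('s, 'f, 'r) language \<Rightarrow> ('s, 'f, 'r) fm set" where
  "sentences L = {\<phi>. wf_fm L \<phi> \<and> fv \<phi> = {}}"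

definition models :: "('s, 'f, 'r, 'm) struct \<Rightarrow> ('s, 'f, 'r) fm set \<Rightarrow> bool" where
  "models M T \<longleftrightarrow> (\<forall>\<phi>\<in>T. \<forall>e. sat M e \<phi>)"

text \<open>Theories are taken to be deductively closed, so completeness is maximality.\<close>

definition complete_theory :: "('s, 'f, 'r) language \<Rightarrow> ('s, 'f, 'r) fm set \<Rightarrow> bool" where
  "complete_theory L T \<longleftrightarrow> T \<subseteq> sentences L \<and> (\<forall>\<phi>\<in>sentences L. \<phi> \<in> T \<or> Neg \<phi> \<in> T)"

section \<open>Algebraic closure, types, automorphisms\<close>

text \<open>
  A formula in the free variable \<open>x\<close> with parameters from \<open>A\<close> is a pair of a formula and an
  assignment \<open>e\<close> that sends its free variables other than \<open>x\<close> to elements of \<open>A\<close> of the right sort.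
\<close>

definition formula_over ::
  "('s, 'f, 'r) language \<Rightarrow> ('s, 'f, 'r, 'm) struct \<Rightarrow> 'm set \<Rightarrow> 's var \<Rightarrow>
   ('s, 'f, 'r) fm \<times> ('s var \<Rightarrow> 'm) \<Rightarrow> bool" where
  "formula_over L M A x = (\<lambda>(\<phi>, e). snd x \<in> sorts L \<and> wf_fm L \<phi> \<and>
     (\<forall>v\<in>fv \<phi> - {x}. e v \<in> A \<and> sort_of M (e v) = snd v))"

definition solutions ::
  "('s, 'f, 'r, 'm) struct \<Rightarrow> 's var \<Rightarrow> ('s, 'f, 'r) fm \<times> ('s var \<Rightarrow> 'm) \<Rightarrow> 'm set" where
  "solutions M x = (\<lambda>(\<phi>, e). {m. sort_of M m = snd x \<and> sat M (e(x := m)) \<phi>})"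

definition acl :: "('s, 'f, 'r) language \<Rightarrow> ('s, 'f, 'r, 'm) struct \<Rightarrow> 'm set \<Rightarrow> 'm set" where
  "acl L M A = {d. \<exists>x \<phi>. formula_over L M A x \<phi> \<and> d \<in> solutions M x \<phi> \<and> finite (solutions M x \<phi>)}"

text \<open>
  The type over \<open>B\<close> of the tuple \<open>(a i)\<^sub>i\<^sub>\<in>\<^sub>I\<close>. Its members are the true formulas whose free variables
  have been replaced, via \<open>h\<close>, by the type variables \<open>Inl i\<close> with \<open>i \<in> I\<close> and the parameters \<open>Inr b\<close>
  with \<open>b \<in> B\<close>.
\<close>

definition tp ::
  "('s, 'f, 'r) language \<Rightarrow> ('s, 'f, 'r, 'm) struct \<Rightarrow> ('i \<Rightarrow> 'm) \<Rightarrow> 'i set \<Rightarrow> 'm set \<Rightarrow>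
   (('s, 'f, 'r) fm \<times> ('s var \<Rightarrow> 'i + 'm)) set" where
  "tp L M a I B = {(\<phi>, h). wf_fm L \<phi> \<and>
     (\<forall>v\<in>fv \<phi>. h v \<in> I <+> B \<and> sort_of M (case_sum a id (h v)) = snd v) \<and>
     sat M (case_sum a id \<circ> h) \<phi>}"

definition automorphisms ::
  "('s, 'f, 'r) language \<Rightarrow> ('s, 'f, 'r, 'm) struct \<Rightarrow> ('m \<Rightarrow> 'm) set" where
  "automorphisms L M = {g. bij g \<and> (\<forall>m. sort_of M (g m) = sort_of M m) \<and>
     (\<forall>f\<in>funs L. \<forall>xs. map (sort_of M) xs = fun_dom L f \<longrightarrow>
        g (fun_of M f xs) = fun_of M f (map g xs)) \<and>
     (\<forall>r\<in>rels L. \<forall>xs. map (sort_of M) xs = rel_dom L r \<longrightarrow>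
        rel_of M r (map g xs) = rel_of M r xs)}"

definition conjugate_over ::
  "('s, 'f, 'r) language \<Rightarrow> ('s, 'f, 'r, 'm) struct \<Rightarrow> 'm set \<Rightarrow> 'm set \<Rightarrow> 'm set \<Rightarrow> bool" where
  "conjugate_over L M B A A' \<longleftrightarrow> (\<exists>g\<in>automorphisms L M. (\<forall>b\<in>B. g b = b) \<and> g ` A = A')"

section \<open>The big saturated model\<close>

definition inaccessible :: "'k rel \<Rightarrow> bool" where
  "inaccessible \<kappa> \<longleftrightarrow> Card_order \<kappa> \<and> natLeq <o \<kappa> \<and> regularCard \<kappa> \<and>
     (\<forall>X :: 'k set. |X| <o \<kappa> \<longrightarrow> |Pow X| <o \<kappa>)"

definition small :: "'k rel \<Rightarrow> 'a set \<Rightarrow> bool" where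
  "small \<kappa> A \<longleftrightarrow> |A| <o \<kappa>"

definition saturated ::
  "('s, 'f, 'r) language \<Rightarrow> ('s, 'f, 'r, 'm) struct \<Rightarrow> 'k rel \<Rightarrow> bool" where
  "saturated L M \<kappa> \<longleftrightarrow>
     (\<forall>A x p. small \<kappa> A \<and> snd x \<in> sorts L \<and> (\<forall>\<phi>\<in>p. formula_over L M A x \<phi>) \<and>
        (\<forall>q\<subseteq>p. finite q \<longrightarrow> (\<exists>m. sort_of M m = snd x \<and> (\<forall>\<phi>\<in>q. m \<in> solutions M x \<phi>)))
      \<longrightarrow> (\<exists>m. sort_of M m = snd x \<and> (\<forall>\<phi>\<in>p. m \<in> solutions M x \<phi>)))"

text \<open>
  \<open>M\<close> is a \<open>\<kappa>\<close>-saturated model of size at most \<open>\<kappa>\<close>. If some sort of \<open>M\<close> is infinite, then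
  saturation forces the size to be exactly \<open>\<kappa>\<close>, and \<open>M\<close> is a saturated model in the usual sense;
  the inequality only serves to admit structures all of whose sorts are finite.
  Consistency of \<open>T\<close> is implied by the existence of the model \<open>M\<close>.
\<close>

locale big_saturated_model =
  fixes L :: "('s, 'f, 'r) language"
    and T :: "('s, 'f, 'r) fm set"
    and M :: "('s, 'f, 'r, 'm) struct"
    and \<kappa> :: "'k rel"
  assumes language: "wf_language L"
    and complete: "complete_theory L T"
    and "structure": "is_structure L M"
    and model: "models M T"
    and inaccessible: "inaccessible \<kappa>"
    and small_language: "small \<kappa> (sorts L)" "small \<kappa> (funs L)" "small \<kappa> (rels L)"
    and size: "|UNIV :: 'm set| \<le>o \<kappa>"
    and saturated: "saturated L M \<kappa>"

section \<open>Independence relations\<close>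

text \<open>
  \<open>indep A C B\<close> stands for the independence of \<open>A\<close> from \<open>B\<close> over the base \<open>C\<close> (the middle argument).
  The relation lives on small sets; its values on other sets are unconstrained and irrelevant.
  Cardinals below \<open>\<kappa>\<close> are represented by small subsets of \<open>'k\<close>. In particular the bound in the
  local character axiom is itself small, as a bound \<open>\<kappa>\<close> would say nothing.
\<close>

locale independence_relation =
  fixes L :: "('s, 'f, 'r) language"
    and M :: "('s, 'f, 'r, 'm) struct"
    and \<kappa> :: "'k rel"
    and indep :: "'m set \<Rightarrow> 'm set \<Rightarrow> 'm set \<Rightarrow> bool"
  assumes invariance: "\<lbrakk>small \<kappa> A; small \<kappa> B; small \<kappa> C; indep A C B; g \<in> automorphisms L M;
      g ` A = A'; g ` B = B'; g ` C = C'\<rbrakk> \<Longrightarrow> indep A' C' B'"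
    and monotonicity: "\<lbrakk>small \<kappa> A; small \<kappa> B; small \<kappa> C; indep A C B; A' \<subseteq> A; B' \<subseteq> B\<rbrakk>
      \<Longrightarrow> indep A' C B'"
    and base_monotonicity: "\<lbrakk>small \<kappa> A; small \<kappa> B; D \<subseteq> C; C \<subseteq> B; indep A D B\<rbrakk> \<Longrightarrow> indep A C B"
    and transitivity: "\<lbrakk>small \<kappa> A; small \<kappa> B; D \<subseteq> C; C \<subseteq> B; indep B C A; indep C D A\<rbrakk>
      \<Longrightarrow> indep B D A"
    and normality: "\<lbrakk>small \<kappa> A; small \<kappa> B; small \<kappa> C; indep A C B\<rbrakk> \<Longrightarrow> indep (A \<union> C) C B"
    and extension: "\<lbrakk>small \<kappa> A; small \<kappa> B'; small \<kappa> C; indep A C B; B \<subseteq> B'\<rbrakk>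
      \<Longrightarrow> \<exists>A'. conjugate_over L M (B \<union> C) A A' \<and> indep A' C B'"
    and finite_character: "\<lbrakk>small \<kappa> A; small \<kappa> B; small \<kappa> C;
      \<And>A0. \<lbrakk>A0 \<subseteq> A; finite A0\<rbrakk> \<Longrightarrow> indep A0 C B\<rbrakk> \<Longrightarrow> indep A C B"
    and local_character: "small \<kappa> A \<Longrightarrow>
      \<exists>K :: 'k set. small \<kappa> K \<and> (\<forall>B. small \<kappa> B \<longrightarrow> (\<exists>C\<subseteq>B. |C| <o |K| \<and> indep A C B))"

locale strict_independence_relation = independence_relation +
  assumes anti_reflexivity: "\<lbrakk>small \<kappa> B; indep {a} B {a}\<rbrakk> \<Longrightarrow> a \<in> acl L M B"

locale canonical_independence_relation = strict_independence_relation +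
  assumes intersection: "\<lbrakk>small \<kappa> A; small \<kappa> B; C\<^sub>1 \<subseteq> B; C\<^sub>2 \<subseteq> B; indep A C\<^sub>1 B; indep A C\<^sub>2 B\<rbrakk>
      \<Longrightarrow> indep A (acl L M C\<^sub>1 \<inter> acl L M C\<^sub>2) B"

section \<open>Weak canonical bases, Morley sequences, algebraic kernels\<close>

text \<open>\<open>C\<close> is the weak canonical base of the type over \<open>B\<close> of the tuple \<open>(a i)\<^sub>i\<^sub>\<in>\<^sub>I\<close>.\<close>

definition weak_canonical_base ::
  "('s, 'f, 'r) language \<Rightarrow> ('s, 'f, 'r, 'm) struct \<Rightarrow> ('m set \<Rightarrow> 'm set \<Rightarrow> 'm set \<Rightarrow> bool) \<Rightarrow>
   ('i \<Rightarrow> 'm) \<Rightarrow> 'i set \<Rightarrow> 'm set \<Rightarrow> 'm set \<Rightarrow> bool" where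
  "weak_canonical_base L M indep a I B C \<longleftrightarrow>
     C \<subseteq> B \<and> acl L M C = C \<and> indep (a ` I) C B \<and>
     (\<forall>D\<subseteq>B. acl L M D = D \<longrightarrow> indep (a ` I) D B \<longrightarrow> C \<subseteq> D)"

text \<open>
  Tuples are indexed by small subsets of \<open>'k\<close>, which provide every length below \<open>\<kappa>\<close>.
\<close>

definition has_weak_canonical_bases ::
  "('s, 'f, 'r) language \<Rightarrow> ('s, 'f, 'r, 'm) struct \<Rightarrow> 'k rel \<Rightarrow>
   ('m set \<Rightarrow> 'm set \<Rightarrow> 'm set \<Rightarrow> bool) \<Rightarrow> bool" where
  "has_weak_canonical_bases L M \<kappa> indep \<longleftrightarrow>
     (\<forall>(I :: 'k set) a B. small \<kappa> I \<and> small \<kappa> B \<and> acl L M B = B \<longrightarrow>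
        (\<exists>C. weak_canonical_base L M indep a I B C))"

text \<open>
  A sequence of \<open>I\<close>-tuples indexed by a linearly ordered type. Increasing \<open>n\<close>-tuples of indices are
  functions strictly increasing on \<open>{..<n}\<close>; the concatenation of the corresponding \<open>I\<close>-tuples is
  indexed by \<open>{..<n} \<times> I\<close>.
\<close>

definition indiscernible ::
  "('s, 'f, 'r) language \<Rightarrow> ('s, 'f, 'r, 'm) struct \<Rightarrow> ('o::linorder \<Rightarrow> 'i \<Rightarrow> 'm) \<Rightarrow> 'i set \<Rightarrow>
   'm set \<Rightarrow> bool" where
  "indiscernible L M s I B \<longleftrightarrow>
     (\<forall>(n::nat) f g. strict_mono_on {..<n} f \<and> strict_mono_on {..<n} g \<longrightarrow>
        tp L M (\<lambda>(k, i). s (f k) i) ({..<n} \<times> I) B = tp L M (\<lambda>(k, i). s (g k) i) ({..<n} \<times> I) B)"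

definition morley_sequence ::
  "('s, 'f, 'r) language \<Rightarrow> ('s, 'f, 'r, 'm) struct \<Rightarrow> ('m set \<Rightarrow> 'm set \<Rightarrow> 'm set \<Rightarrow> bool) \<Rightarrow>
   (('s, 'f, 'r) fm \<times> ('s var \<Rightarrow> 'i + 'm)) set \<Rightarrow> 'i set \<Rightarrow> 'm set \<Rightarrow> (nat \<Rightarrow> 'i \<Rightarrow> 'm) \<Rightarrow> bool" where
  "morley_sequence L M indep p I B s \<longleftrightarrow>
     indiscernible L M s I B \<and> (\<forall>n. tp L M (s n) I B = p) \<and>
     (\<forall>n. indep (\<Union>i<n. s i ` I) B (s n ` I))"

definition aker ::
  "('s, 'f, 'r) language \<Rightarrow> ('s, 'f, 'r, 'm) struct \<Rightarrow> ('o::linorder \<Rightarrow> 'i \<Rightarrow> 'm) \<Rightarrow> 'i set \<Rightarrow> 'm set" where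
  "aker L M s I = {d \<in> acl L M (\<Union>n. s n ` I). indiscernible L M s I {d}}"

end

theory Submission
  imports Defs "HOL-Library.FuncSet"
begin

text \<open>
  Extension, applied to the union of the terms chosen so far, yields long sequences of conjugates of
  \<open>A\<close> over \<open>BC\<close> all of whose initial segments are independent over \<open>C\<close> from the next term; local
  character along such a sequence gives symmetry, without any indiscernibility. For a canonical
  relation, local character and the intersection property show that \<open>a\<close> is independent from \<open>B\<close> over
  \<open>acl E \<inter> B\<close>, where \<open>E\<close> is an initial segment of a long \<open>B\<close>-independent sequence of conjugates of
  \<open>a\<close>. This set is the same for every conjugate \<open>E'\<close> of \<open>E\<close> over \<open>B\<close>; choosing \<open>E'\<close> independent from
  \<open>E\<close>, anti-reflexivity puts it inside every candidate base, so it is the weak canonical base.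

  For a Morley sequence \<open>s\<close> the kernel lies in every candidate base, again by anti-reflexivity, as
  its elements are algebraic over two disjoint blocks of \<open>s\<close>. Conversely \<open>s\<close> is stretched to a long
  sequence by inserting terms in front of it, one automorphism at a time. By indiscernibility
  elements of \<open>B\<close> that are algebraic over the long sequence are algebraic over \<open>s\<close>, and hence the
  base is contained in the kernel.
\<close>

section \<open>Small sets and long well-orders\<close>

text \<open>The axioms are one-sided: extension, and with it closure under \<open>acl\<close>, works
  on the right of the relation, while normality, transitivity and finite character work on the left.
  Symmetry therefore has to be available before anything else. Its sequence needs no partition
  argument because each term is an exact conjugate of \<open>A\<close> over all relevant parameters,
  so a fact about one late term can be pulled back to \<open>A\<close>.

  Local character is applied to \<open>B\<close>, not to the tuple: it finds a term
  \<open>X \<alpha>\<close> with \<open>B\<close> independent from it over the initial segment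
  \<open>E\<close>. Together with independence of \<open>E\<close> and \<open>X \<alpha>\<close>
  over \<open>B\<close>, this makes \<open>E\<close> and \<open>B\<close> two bases for
  \<open>X \<alpha>\<close> inside \<open>BE\<close>, which is the situation of the intersection
  property. The bound for \<open>B\<close> can be any cardinal below \<kappa>, so a Morley sequence
  of length \<omega> may be too short for this; hence the stretching.

  All moves are made by automorphisms, whereas indiscernibility and Morley sequences are defined by
  types. Strong homogeneity, obtained from saturation by back and forth, translates between the
  two.\<close>

lemma inaccessible_facts:
  assumes "inaccessible \<kappa>"
  shows "Card_order \<kappa>" "natLeq <o \<kappa>" "regularCard \<kappa>" "Cinfinite \<kappa>" "\<not> finite (Field \<kappa>)"
proof -
  show 1: "Card_order \<kappa>" "natLeq <o \<kappa>" "regularCard \<kappa>"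
    using assms by (auto simp: inaccessible_def)
  show "Cinfinite \<kappa>"
    using 1 cinfinite_mono natLeq_cinfinite ordLess_imp_ordLeq by blast
  then show "\<not> finite (Field \<kappa>)"
    by (simp add: cinfinite_def)
qed

lemma small_subset: "small \<kappa> A \<Longrightarrow> B \<subseteq> A \<Longrightarrow> small \<kappa> B"
  unfolding small_def using card_of_mono1 ordLeq_ordLess_trans by blast

lemma small_image: "small \<kappa> A \<Longrightarrow> small \<kappa> (f ` A)"
  unfolding small_def using card_of_image ordLeq_ordLess_trans by blast

lemma small_UN:
  assumes "inaccessible \<kappa>" "small \<kappa> I" "\<And>i. i \<in> I \<Longrightarrow> small \<kappa> (A i)"
  shows "small \<kappa> (\<Union>i\<in>I. A i)"
  using regularCard_UNION_bound[OF inaccessible_facts(4,3)] assms unfolding small_def by blast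

lemma small_finite: "inaccessible \<kappa> \<Longrightarrow> finite A \<Longrightarrow> small \<kappa> A"
  unfolding small_def using inaccessible_facts(2) finite_iff_ordLess_natLeq ordLess_transitive
  by blast

lemma small_Un [intro]: "inaccessible \<kappa> \<Longrightarrow> small \<kappa> A \<Longrightarrow> small \<kappa> B \<Longrightarrow> small \<kappa> (A \<union> B)"
  unfolding small_def using inaccessible_facts card_of_Un_ordLess_infinite_Field by blast

lemma small_insert [intro]: "inaccessible \<kappa> \<Longrightarrow> small \<kappa> A \<Longrightarrow> small \<kappa> (insert a A)"
  using small_Un[of \<kappa> "{a}" A] small_finite[of \<kappa> "{a}"] by auto

lemma small_nat: "inaccessible \<kappa> \<Longrightarrow> small \<kappa> (S :: nat set)"
  using small_subset[of \<kappa> "UNIV :: nat set" S] inaccessible_facts(2)[of \<kappa>] card_of_nat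
  unfolding small_def by (meson ordIso_ordLess_trans subset_UNIV)

lemma small_Times:
  assumes "inaccessible \<kappa>" "small \<kappa> A" "small \<kappa> B"
  shows "small \<kappa> (A \<times> B)"
proof -
  have "A \<times> B = (\<Union>a\<in>A. Pair a ` B)" by auto
  then show ?thesis using assms by (simp add: small_UN small_image)
qed

lemma small_lists:
  assumes "inaccessible \<kappa>" "small \<kappa> A"
  shows "small \<kappa> (lists A)"
proof -
  have *: "small \<kappa> {xs \<in> lists A. length xs = n}" for n
  proof (induction n)
    case 0
    have "{xs \<in> lists A. length xs = 0} \<subseteq> {[]}" by auto
    then show ?case using assms(1) small_finite finite_subset by blast
  next
    case (Suc n)
    have "{xs \<in> lists A. length xs = Suc n} \<subseteq> (\<lambda>(x, xs). x # xs) ` (A \<times> {xs \<in> lists A. length xs = n})"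
      by (auto simp: length_Suc_conv image_iff)
    then show ?case using small_Times[OF assms Suc.IH] small_image small_subset by meson
  qed
  have "lists A = (\<Union>n. {xs \<in> lists A. length xs = n})" by auto
  then show ?thesis using small_UN[OF assms(1) small_nat[OF assms(1), of UNIV], where A = "\<lambda>n. {xs \<in> lists A. length xs = n}"] *
    by simp
qed

text \<open>Tuples are indexed by subsets of \<open>'k\<close>; a small set of elements is coded
  into that type before a hypothesis about tuples is applied to it.\<close>

lemma small_code:
  fixes \<kappa> :: "'k rel"
  assumes "Card_order \<kappa>" "small \<kappa> A"
  obtains f :: "'a \<Rightarrow> 'k" where "inj_on f A" "small \<kappa> (f ` A)"
proof -
  have "|A| \<le>o |Field \<kappa>|"
    using assms unfolding small_def
    by (meson card_of_Field_ordIso ordIso_symmetric ordLeq_ordIso_trans ordLess_imp_ordLeq)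
  then obtain f :: "'a \<Rightarrow> 'k" where "inj_on f A" using card_of_ordLeq by metis
  then show ?thesis using that assms(2) small_image by blast
qed

text \<open>The order is an infinite successor cardinal above |K|: regularity keeps fewer than |K|
  indices from being cofinal. It stays small because \<kappa> is a strong limit.\<close>

lemma long_well_order:
  assumes \<kappa>: "inaccessible (\<kappa> :: 'k rel)" and K: "small \<kappa> (K :: 'k set)"
  obtains r :: "'k set rel" where "Well_order r" "small \<kappa> (Field r)"
    "\<And>J. J \<subseteq> Field r \<Longrightarrow> |J| <o |K| \<Longrightarrow> \<exists>\<alpha>\<in>Field r. J \<subseteq> underS r \<alpha>"
proof -
  note [simp] = inaccessible_facts[OF \<kappa>]
  have "|UNIV :: nat set| \<le>o |Field \<kappa>|" by (simp add: infinite_iff_card_of_nat[symmetric])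
  then obtain N :: "'k set" where N: "|UNIV :: nat set| =o |N|" 
    by (meson internalize_card_of_ordLeq2)
  have "small \<kappa> N" using N small_nat[OF \<kappa>, of UNIV] ordIso_ordLess_trans ordIso_symmetric
    unfolding small_def by blast
  \<comment> \<open>\<open>K\<close> may be finite; the countable part makes the successor infinite,
    hence regular and without a last element.\<close>
  define K' where "K' = K \<union> N"
  have K': "small \<kappa> K'" unfolding K'_def using \<kappa> K \<open>small \<kappa> N\<close> by blast
  have inf: "\<not> finite K'" unfolding K'_def using N
    by (metis card_of_ordIso_finite finite_Un infinite_UNIV_nat)
  define r where "r = cardSuc |K'|"
  have co: "Card_order |K'|" by (rule card_of_Card_order)
  have infF: "\<not> finite (Field |K'| )" using inf by (simp add: Field_card_of)
  have r: "Card_order r" "regularCard r" "\<not> finite (Field r)" "|K'| <o r"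
    unfolding r_def using infF co infinite_cardSuc_regularCard[OF infF co]
      cardSuc_Card_order[OF co] cardSuc_finite[OF co] cardSuc_greater[OF co] by blast+
  have "r \<le>o |Pow K'|"
    unfolding r_def by (rule cardSuc_least[OF card_of_Card_order card_of_Card_order card_of_Pow])
  moreover have "|Pow K'| <o \<kappa>" using K' \<kappa> unfolding small_def inaccessible_def by blast
  ultimately have "r <o \<kappa>" using ordLeq_ordLess_trans by blast
  then have fld: "small \<kappa> (Field r)" unfolding small_def
    using card_of_Field_ordIso[OF r(1)] ordIso_ordLess_trans by blast
  have wo: "Well_order r" using r(1) by (simp add: card_order_on_def)
  have "\<exists>\<alpha>\<in>Field r. J \<subseteq> underS r \<alpha>" if J: "J \<subseteq> Field r" "|J| <o |K|" for J
  proof -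
    have "|K| \<le>o |K'|" unfolding K'_def by (simp add: card_of_mono1)
    then have "|J| <o r" using J r(4) by (meson ordLess_ordLeq_trans ordLess_transitive)
    then have "\<not> cofinal J r" using r(2) J(1) unfolding regularCard_def
      using not_ordLess_ordIso by blast
    then obtain a where a: "a \<in> Field r" "\<And>b. b \<in> J \<Longrightarrow> a = b \<or> (a, b) \<notin> r"
      unfolding cofinal_def by blast
    \<comment> \<open>Failure of cofinality bounds \<open>J\<close> by \<open>a\<close> only weakly,
      so a strictly larger \<open>c\<close> is taken.\<close>
    obtain c where c: "c \<in> Field r" "a \<noteq> c" "(a, c) \<in> r"
      using infinite_Card_order_limit[OF r(1,3) a(1)] by blast
    have wr: "wo_rel r" using wo by (simp add: wo_rel_def)
    have "b \<in> underS r c" if "b \<in> J" for b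
    proof -
      have "(b, a) \<in> r" using a(1) a(2)[OF that] that J(1) wo_rel.TOTALS[OF wr] by blast
      then show ?thesis using c wo_rel.TRANS[OF wr] wo_rel.ANTISYM[OF wr] unfolding underS_def trans_def antisym_def by blast
    qed
    then show ?thesis using c(1) by blast
  qed
  then show ?thesis using that wo fld by blast
qed

section \<open>Renaming variables\<close>

lemma sat_cong: "(\<And>v. v \<in> fv \<phi> \<Longrightarrow> e v = e' v) \<Longrightarrow> sat M e \<phi> \<longleftrightarrow> sat M e' \<phi>"
proof -
  have eval_cong: "(\<And>v. v \<in> fv_trm t \<Longrightarrow> e v = e' v) \<Longrightarrow> eval M e t = eval M e' t" for t e e'
    by (induction t) (auto cong: map_cong, (metis (mono_tags, lifting) map_eq_conv))
  have map_eval_cong: "(\<And>v. v \<in> (\<Union>t\<in>set ts. fv_trm t) \<Longrightarrow> e v = e' v) \<Longrightarrow>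
      map (eval M e) ts = map (eval M e') ts" for ts e e'
    by (intro map_cong eval_cong refl) auto
  show "(\<And>v. v \<in> fv \<phi> \<Longrightarrow> e v = e' v) \<Longrightarrow> sat M e \<phi> \<longleftrightarrow> sat M e' \<phi>"
  proof (induction \<phi> arbitrary: e e')
    case (Eq t u)
    then show ?case using eval_cong[of t e e'] eval_cong[of u e e'] by auto
  next
    case (Rel r ts)
    then show ?case using map_eval_cong[of ts e e'] by (metis fv.simps(2) sat.simps(2))
  next
    case (Exi v \<phi>)
    have "(e(v := m)) w = (e'(v := m)) w" if "w \<in> fv \<phi>" for m w
      using Exi.prems[of w] that by (cases "w = v") simp_all
    then have "sat M (e(v := m)) \<phi> \<longleftrightarrow> sat M (e'(v := m)) \<phi>" for m
      by (rule Exi.IH)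
    then show ?case unfolding sat.simps by blast
  next
    case (Neg \<phi>)
    show ?case using Neg.IH[of e e'] Neg.prems by simp
  next
    case (Conj \<phi> \<psi>)
    show ?case using Conj.IH(1)[of e e'] Conj.IH(2)[of e e'] Conj.prems by simp
  qed
qed

lemma finite_fv [simp]: "finite (fv \<phi>)"
proof -
  have "finite (fv_trm t)" for t by (induction t) auto
  then show ?thesis by (induction \<phi>) auto
qed

lemma wf_fv_sorts: "wf_language L \<Longrightarrow> wf_fm L \<phi> \<Longrightarrow> v \<in> fv \<phi> \<Longrightarrow> snd v \<in> sorts L"
proof -
  have t: "wf_trm L t \<Longrightarrow> v \<in> fv_trm t \<Longrightarrow> snd v \<in> sorts L" for t v
    by (induction t) auto
  show "wf_fm L \<phi> \<Longrightarrow> v \<in> fv \<phi> \<Longrightarrow> snd v \<in> sorts L"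
    by (induction \<phi>) (auto dest: t)
qed

fun rename_trm :: "('s var \<Rightarrow> 's var) \<Rightarrow> ('s, 'f) trm \<Rightarrow> ('s, 'f) trm" where
  "rename_trm \<rho> (Var v) = Var (\<rho> v)"
| "rename_trm \<rho> (Fun f ts) = Fun f (map (rename_trm \<rho>) ts)"

lemma fv_rename_trm: "fv_trm (rename_trm \<rho> t) = \<rho> ` fv_trm t"
  by (induction t) auto

lemma eval_rename_trm: "eval M e (rename_trm \<rho> t) = eval M (e \<circ> \<rho>) t"
  by (induction t) (auto cong: map_cong simp: comp_def)

lemma wf_rename_trm:
  assumes "\<And>v. snd (\<rho> v) = snd v"
  shows "trm_sort L (rename_trm \<rho> t) = trm_sort L t" "wf_trm L (rename_trm \<rho> t) \<longleftrightarrow> wf_trm L t"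
proof -
  show s: "trm_sort L (rename_trm \<rho> t) = trm_sort L t" for t
    by (cases t) (auto simp: assms)
  show "wf_trm L (rename_trm \<rho> t) \<longleftrightarrow> wf_trm L t"
    by (induction t) (auto simp: assms s comp_def)
qed

text \<open>Injectivity of \<open>\<rho>\<close> is not assumed: all variables that denote one
  element will later be identified with a single variable \<open>x\<close>. Each quantifier receives
  a freshly chosen bound variable, so that nothing is captured.\<close>

lemma rename_fm:
  assumes "wf_fm L \<phi>" "\<And>v. snd (\<rho> v) = snd v"
  shows "\<exists>\<phi>'. wf_fm L \<phi>' \<and> fv \<phi>' = \<rho> ` fv \<phi> \<and>
    (\<forall>e. sat M e \<phi>' \<longleftrightarrow> sat M (e \<circ> \<rho>) \<phi>)"
  using assms
proof (induction \<phi> arbitrary: \<rho>)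
  case (Eq t u)
  then show ?case
    by (intro exI[of _ "Eq (rename_trm \<rho> t) (rename_trm \<rho> u)"])
      (auto simp: wf_rename_trm fv_rename_trm eval_rename_trm o_def)
next
  case (Rel r ts)
  have "map (eval M e \<circ> rename_trm \<rho>) ts = map (eval M (e \<circ> \<rho>)) ts" for e
    by (simp add: eval_rename_trm)
  moreover have "map (trm_sort L \<circ> rename_trm \<rho>) ts = map (trm_sort L) ts"
    using Rel.prems(2) by (simp add: wf_rename_trm)
  ultimately show ?case using Rel.prems
    by (intro exI[of _ "Rel r (map (rename_trm \<rho>) ts)"])
      (auto simp: wf_rename_trm(2) fv_rename_trm o_def simp del: map_eq_conv)
next
  case (Neg \<phi>)
  then obtain \<phi>' where "wf_fm L \<phi>'" "fv \<phi>' = \<rho> ` fv \<phi>"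
    "\<forall>e. sat M e \<phi>' \<longleftrightarrow> sat M (e \<circ> \<rho>) \<phi>"
    unfolding wf_fm.simps by blast
  then show ?case by (intro exI[of _ "Neg \<phi>'"]) (simp add: o_def)
next
  case (Conj \<phi> \<psi>)
  obtain \<phi>' where "wf_fm L \<phi>'" "fv \<phi>' = \<rho> ` fv \<phi>"
    "\<forall>e. sat M e \<phi>' \<longleftrightarrow> sat M (e \<circ> \<rho>) \<phi>"
    using Conj.IH(1)[of \<rho>] Conj.prems unfolding wf_fm.simps by blast
  moreover obtain \<psi>' where "wf_fm L \<psi>'" "fv \<psi>' = \<rho> ` fv \<psi>"
    "\<forall>e. sat M e \<psi>' \<longleftrightarrow> sat M (e \<circ> \<rho>) \<psi>"
    using Conj.IH(2)[of \<rho>] Conj.prems unfolding wf_fm.simps by blast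
  ultimately show ?case by (intro exI[of _ "Conj \<phi>' \<psi>'"]) (auto simp: o_def)
next
  case (Exi v \<phi>)
  \<comment> \<open>The new bound variable must keep the sort of \<open>v\<close>; each sort has
    infinitely many variables and the image is finite.\<close>
  have "\<exists>n. (n, snd v) \<notin> \<rho> ` fv \<phi>"
  proof -
    obtain n where "n \<notin> fst ` \<rho> ` fv \<phi>"
      using ex_new_if_finite[OF infinite_UNIV_nat, of "fst ` \<rho> ` fv \<phi>"] by auto
    then show ?thesis by force
  qed
  then obtain n where n: "(n, snd v) \<notin> \<rho> ` fv \<phi>" by blast
  define w where "w = (n, snd v)"
  have w: "w \<notin> \<rho> ` fv \<phi>" "snd w = snd v" using n by (auto simp: w_def)
  obtain \<phi>' where \<phi>': "wf_fm L \<phi>'" "fv \<phi>' = \<rho>(v := w) ` fv \<phi>"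
    "\<forall>e. sat M e \<phi>' \<longleftrightarrow> sat M (e \<circ> \<rho>(v := w)) \<phi>"
  proof -
    have "wf_fm L \<phi>" "snd ((\<rho>(v := w)) u) = snd u" for u
      using Exi.prems w(2) by auto
    from Exi.IH[OF this] show ?thesis using that by blast
  qed
  have "sat M (e(w := m)) \<phi>' \<longleftrightarrow> sat M ((e \<circ> \<rho>)(v := m)) \<phi>" for e m
  proof -
    have "sat M (e(w := m) \<circ> \<rho>(v := w)) \<phi> \<longleftrightarrow> sat M ((e \<circ> \<rho>)(v := m)) \<phi>"
      by (rule sat_cong) (use w(1) in auto)
    then show ?thesis using \<phi>'(3) by blast
  qed
  moreover have "fv (Exi w \<phi>') = \<rho> ` fv (Exi v \<phi>)"
    using \<phi>'(2) w(1) by auto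
  ultimately show ?case using \<phi>'(1) Exi.prems w(2) by (intro exI[of _ "Exi w \<phi>'"]) (auto simp: o_def)
qed

section \<open>Automorphisms\<close>

text \<open>Automorphisms respect the symbols only on well-sorted lists, so preservation of truth is
  claimed only for assignments that are well-sorted on the free variables.\<close>

definition sorted_on :: "('s, 'f, 'r, 'm) struct \<Rightarrow> ('s var \<Rightarrow> 'm) \<Rightarrow> 's var set \<Rightarrow> bool" where
  "sorted_on M e V \<longleftrightarrow> (\<forall>v\<in>V. sort_of M (e v) = snd v)"

lemma automorphisms_sort: "g \<in> automorphisms L M \<Longrightarrow> sort_of M (g m) = sort_of M m"
  and automorphisms_bij: "g \<in> automorphisms L M \<Longrightarrow> bij g"
  by (auto simp: automorphisms_def)

lemma automorphisms_fun:
  "g \<in> automorphisms L M \<Longrightarrow> f \<in> funs L \<Longrightarrow> map (sort_of M) xs = fun_dom L f \<Longrightarrow>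
    g (fun_of M f xs) = fun_of M f (map g xs)"
  unfolding automorphisms_def by blast

lemma automorphisms_rel:
  "g \<in> automorphisms L M \<Longrightarrow> r \<in> rels L \<Longrightarrow> map (sort_of M) xs = rel_dom L r \<Longrightarrow>
    rel_of M r (map g xs) = rel_of M r xs"
  unfolding automorphisms_def by blast

lemma automorphisms_map_sort:
  "g \<in> automorphisms L M \<Longrightarrow> map (sort_of M) (map g xs) = map (sort_of M) xs"
  by (simp add: automorphisms_def)

lemma automorphismsI:
  assumes "bij g" "\<And>m. sort_of M (g m) = sort_of M m"
    "\<And>f xs. f \<in> funs L \<Longrightarrow> map (sort_of M) xs = fun_dom L f \<Longrightarrow> g (fun_of M f xs) = fun_of M f (map g xs)"
    "\<And>r xs. r \<in> rels L \<Longrightarrow> map (sort_of M) xs = rel_dom L r \<Longrightarrow> rel_of M r (map g xs) = rel_of M r xs"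
  shows "g \<in> automorphisms L M"
  using assms unfolding automorphisms_def by blast

lemma automorphisms_id: "id \<in> automorphisms L M"
  by (auto simp: automorphisms_def)

lemma automorphisms_comp:
  assumes g: "g \<in> automorphisms L M" and h: "h \<in> automorphisms L M"
  shows "g \<circ> h \<in> automorphisms L M"
proof (rule automorphismsI)
  show "bij (g \<circ> h)" using g h by (blast intro: bij_comp automorphisms_bij)
  show "sort_of M ((g \<circ> h) m) = sort_of M m" for m
    by (simp add: automorphisms_sort[OF g] automorphisms_sort[OF h])
  fix xs
  show "(g \<circ> h) (fun_of M f xs) = fun_of M f (map (g \<circ> h) xs)"
    if "f \<in> funs L" "map (sort_of M) xs = fun_dom L f" for f
    using automorphisms_fun[OF h that] automorphisms_fun[OF g that(1), of "map h xs"]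
      automorphisms_map_sort[OF h, of xs] that(2) by simp
  show "rel_of M r (map (g \<circ> h) xs) = rel_of M r xs"
    if "r \<in> rels L" "map (sort_of M) xs = rel_dom L r" for r
    using automorphisms_rel[OF h that] automorphisms_rel[OF g that(1), of "map h xs"]
      automorphisms_map_sort[OF h, of xs] that(2) by simp
qed

lemma automorphisms_inv_apply [simp]:
  assumes "g \<in> automorphisms L M"
  shows "g (inv g m) = m" "inv g (g m) = m"
  using automorphisms_bij[OF assms] by (simp_all add: bij_is_surj surj_f_inv_f bij_is_inj)

lemma automorphisms_inv:
  assumes g: "g \<in> automorphisms L M"
  shows "inv g \<in> automorphisms L M"
proof (rule automorphismsI)
  note [simp] = automorphisms_inv_apply[OF g]
  show b: "bij (inv g)" using automorphisms_bij[OF g] by (rule bij_imp_bij_inv)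
  show s [simp]: "sort_of M (inv g m) = sort_of M m" for m
    using automorphisms_sort[OF g, of "inv g m"] by simp
  fix xs
  have gi: "map g (map (inv g) xs) = xs"
    by (induction xs) auto
  have m: "map (sort_of M) (map (inv g) xs) = map (sort_of M) xs"
    by (induction xs) auto
  show "inv g (fun_of M f xs) = fun_of M f (map (inv g) xs)"
    if "f \<in> funs L" "map (sort_of M) xs = fun_dom L f" for f
    using automorphisms_fun[OF g that(1), of "map (inv g) xs"] that(2)
    by (metis automorphisms_inv_apply(2)[OF g] gi m)
  show "rel_of M r (map (inv g) xs) = rel_of M r xs"
    if "r \<in> rels L" "map (sort_of M) xs = rel_dom L r" for r
    using automorphisms_rel[OF g that(1), of "map (inv g) xs"] that(2) by (metis gi m)
qed

lemma eval_sort: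
  assumes "is_structure L M" "wf_trm L t" "sorted_on M e (fv_trm t)"
  shows "sort_of M (eval M e t) = trm_sort L t"
  using assms(2,3)
proof (induction t)
  case (Fun f ts)
  have "sort_of M (eval M e t) = trm_sort L t" if "t \<in> set ts" for t
    using Fun.IH[OF that] Fun.prems that by (auto simp: sorted_on_def)
  then have "map (sort_of M) (map (eval M e) ts) = fun_dom L f"
    using Fun.prems(1) by (metis (mono_tags, lifting) list.map_comp map_eq_conv o_apply wf_trm.simps(2))
  then show ?case using assms(1) Fun.prems(1) by (simp add: is_structure_def)
qed (auto simp: sorted_on_def)

lemma eval_sorts:
  assumes "is_structure L M" "\<forall>t\<in>set ts. wf_trm L t" "sorted_on M e (\<Union>t\<in>set ts. fv_trm t)"
  shows "map (sort_of M) (map (eval M e) ts) = map (trm_sort L) ts"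
  using assms eval_sort[OF assms(1)] by (auto simp: sorted_on_def)

lemma automorphism_eval:
  assumes "is_structure L M" "g \<in> automorphisms L M" "wf_trm L t" "sorted_on M e (fv_trm t)"
  shows "g (eval M e t) = eval M (g \<circ> e) t"
  using assms(3,4)
proof (induction t)
  case (Fun f ts)
  have s: "map (sort_of M) (map (eval M e) ts) = fun_dom L f"
    using eval_sorts[OF assms(1), of ts e] Fun.prems by (simp del: map_map)
  have "g (eval M e t) = eval M (g \<circ> e) t" if "t \<in> set ts" for t
    by (rule Fun.IH[OF that]) (use Fun.prems that in \<open>auto simp: sorted_on_def\<close>)
  then have "map g (map (eval M e) ts) = map (eval M (g \<circ> e)) ts" by simp
  then show ?case using automorphisms_fun[OF assms(2) _ s] Fun.prems(1) by (metis eval.simps(2) wf_trm.simps(2))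
qed simp

lemma automorphism_sat:
  assumes "is_structure L M" "g \<in> automorphisms L M" "wf_fm L \<phi>" "sorted_on M e (fv \<phi>)"
  shows "sat M (g \<circ> e) \<phi> \<longleftrightarrow> sat M e \<phi>"
  using assms(3,4)
proof (induction \<phi> arbitrary: e)
  case (Eq t u)
  have "eval M (g \<circ> e) t = g (eval M e t)" "eval M (g \<circ> e) u = g (eval M e u)"
    using automorphism_eval[OF assms(1,2)] Eq by (auto simp: sorted_on_def)
  then show ?case by (metis automorphisms_inv_apply(2)[OF assms(2)] sat.simps(1))
next
  case (Rel r ts)
  have s: "map (sort_of M) (map (eval M e) ts) = rel_dom L r"
    using eval_sorts[OF assms(1), of ts e] Rel.prems by (simp del: map_map)
  have "map g (map (eval M e) ts) = map (eval M (g \<circ> e)) ts"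
    using automorphism_eval[OF assms(1,2)] Rel.prems by (auto simp: sorted_on_def)
  then show ?case using automorphisms_rel[OF assms(2) _ s] Rel.prems(1) by (metis sat.simps(2) wf_fm.simps(2))
next
  case (Exi v \<phi>)
  have *: "sat M ((g \<circ> e)(v := g m)) \<phi> \<longleftrightarrow> sat M (e(v := m)) \<phi>" if "sort_of M m = snd v" for m
  proof -
    have "sorted_on M (e(v := m)) (fv \<phi>)" using Exi.prems(2) that by (auto simp: sorted_on_def)
    moreover have "g \<circ> e(v := m) = (g \<circ> e)(v := g m)" by auto
    ultimately show ?thesis using Exi.IH[of "e(v := m)"] Exi.prems(1) by (metis wf_fm.simps(5))
  qed
  \<comment> \<open>As \<open>g\<close> is onto and keeps sorts, a witness may be sought in the form
    \<open>g m\<close>.\<close>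
  have "(\<exists>m. sort_of M m = snd v \<and> sat M ((g \<circ> e)(v := m)) \<phi>) \<longleftrightarrow>
        (\<exists>m. sort_of M m = snd v \<and> sat M ((g \<circ> e)(v := g m)) \<phi>)"
    using automorphisms_sort[OF assms(2)] automorphisms_inv_apply(1)[OF assms(2)] by metis
  also have "\<dots> \<longleftrightarrow> (\<exists>m. sort_of M m = snd v \<and> sat M (e(v := m)) \<phi>)"
    using * by blast
  finally show ?case by (simp only: sat.simps)
qed (auto simp: sorted_on_def)

section \<open>Elementary partial maps\<close>

text \<open>A partial map is represented by its graph, so that the back and the forth step of the
  extension argument are exchanged by taking converses.\<close>

definition elementary :: "('s, 'f, 'r) language \<Rightarrow> ('s, 'f, 'r, 'm) struct \<Rightarrow> ('m \<times> 'm) set \<Rightarrow> bool" where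
  "elementary L M G \<longleftrightarrow> (\<forall>(a, b)\<in>G. sort_of M a = sort_of M b) \<and>
     (\<forall>\<phi> e e'. wf_fm L \<phi> \<and> sorted_on M e (fv \<phi>) \<and> (\<forall>v\<in>fv \<phi>. (e v, e' v) \<in> G) \<longrightarrow>
        (sat M e \<phi> \<longleftrightarrow> sat M e' \<phi>))"

lemma elementary_sort: "elementary L M G \<Longrightarrow> (a, b) \<in> G \<Longrightarrow> sort_of M a = sort_of M b"
  by (auto simp: elementary_def)

lemma elementary_sat:
  "elementary L M G \<Longrightarrow> wf_fm L \<phi> \<Longrightarrow> sorted_on M e (fv \<phi>) \<Longrightarrow>
   (\<And>v. v \<in> fv \<phi> \<Longrightarrow> (e v, e' v) \<in> G) \<Longrightarrow> sat M e \<phi> \<longleftrightarrow> sat M e' \<phi>"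
  unfolding elementary_def by blast

text \<open>One direction suffices, since applying it to \<open>Neg \<phi>\<close> gives the
  other.\<close>

lemma elementaryI:
  assumes "\<And>a b. (a, b) \<in> G \<Longrightarrow> sort_of M a = sort_of M b"
    and "\<And>\<phi> e e'. wf_fm L \<phi> \<Longrightarrow> sorted_on M e (fv \<phi>) \<Longrightarrow> (\<And>v. v \<in> fv \<phi> \<Longrightarrow> (e v, e' v) \<in> G) \<Longrightarrow>
      sat M e \<phi> \<Longrightarrow> sat M e' \<phi>"
  shows "elementary L M G"
proof -
  have "sat M e \<phi> \<longleftrightarrow> sat M e' \<phi>"
    if "wf_fm L \<phi>" "sorted_on M e (fv \<phi>)" "\<forall>v\<in>fv \<phi>. (e v, e' v) \<in> G" for \<phi> e e'
    using assms(2)[of \<phi> e e'] assms(2)[of "Neg \<phi>" e e'] that by auto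
  then show ?thesis using assms(1) unfolding elementary_def by blast
qed

lemma elementary_subset:
  assumes "elementary L M G" "G' \<subseteq> G"
  shows "elementary L M G'"
proof (rule elementaryI)
  show "sort_of M a = sort_of M b" if "(a, b) \<in> G'" for a b
    using elementary_sort[OF assms(1)] assms(2) that by blast
  show "sat M e' \<phi>" if "wf_fm L \<phi>" "sorted_on M e (fv \<phi>)" "\<And>v. v \<in> fv \<phi> \<Longrightarrow> (e v, e' v) \<in> G'" "sat M e \<phi>"
    for \<phi> e e'
    using elementary_sat[OF assms(1) that(1,2), of e'] assms(2) that(3,4) by blast
qed

lemma elementary_converse:
  assumes "elementary L M G"
  shows "elementary L M (G\<inverse>)"
proof (rule elementaryI)
  show "sort_of M a = sort_of M b" if "(a, b) \<in> G\<inverse>" for a b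
    using elementary_sort[OF assms, of b a] that by simp
  show "sat M e' \<phi>" if "wf_fm L \<phi>" "sorted_on M e (fv \<phi>)" "\<And>v. v \<in> fv \<phi> \<Longrightarrow> (e v, e' v) \<in> G\<inverse>" "sat M e \<phi>"
    for \<phi> e e'
  proof -
    have "sorted_on M e' (fv \<phi>)"
      unfolding sorted_on_def
    proof
      fix v assume v: "v \<in> fv \<phi>"
      then show "sort_of M (e' v) = snd v"
        using that(2) that(3)[OF v] elementary_sort[OF assms, of "e' v" "e v"] by (simp add: sorted_on_def)
    qed
    then show ?thesis using elementary_sat[OF assms that(1), of e' e] that(3,4) by auto
  qed
qed

text \<open>A formula has finitely many free variables, so it sees only a finite part of
  \<open>G\<close>.\<close>

lemma elementary_finite:
  assumes "\<And>F. F \<subseteq> G \<Longrightarrow> finite F \<Longrightarrow> elementary L M F"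
  shows "elementary L M G"
proof -
  have "sort_of M a = sort_of M b" if "(a, b) \<in> G" for a b
    using assms[of "{(a, b)}"] that by (auto simp: elementary_def)
  moreover have "sat M e \<phi> \<longleftrightarrow> sat M e' \<phi>"
    if "wf_fm L \<phi>" "sorted_on M e (fv \<phi>)" "\<forall>v\<in>fv \<phi>. (e v, e' v) \<in> G" for \<phi> e e'
    by (rule elementary_sat[OF assms[of "(\<lambda>v. (e v, e' v)) ` fv \<phi>"] that(1,2)]) (use that in auto)
  ultimately show ?thesis by (auto simp: elementary_def)
qed

lemma elementary_automorphism:
  assumes "is_structure L M" "g \<in> automorphisms L M"
  shows "elementary L M {(m, g m) |m. True}"
proof -
  have "sat M e \<phi> \<longleftrightarrow> sat M e' \<phi>"
    if "wf_fm L \<phi>" "sorted_on M e (fv \<phi>)" "\<forall>v\<in>fv \<phi>. e' v = g (e v)" for \<phi> e e'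
    using automorphism_sat[OF assms that(1,2)] sat_cong[of \<phi> e' "g \<circ> e" M] that(3) by simp
  then show ?thesis using automorphisms_sort[OF assms(2)] by (auto simp: elementary_def)
qed

lemma elementary_tp:
  fixes M :: "('s, 'f, 'r, 'm) struct"
  assumes "tp L M a I B = tp L M b I B" "wf_language L" "is_structure L M"
  shows "elementary L M ({(a i, b i) |i. i \<in> I} \<union> Id_on B)" (is "elementary L M ?G")
proof -
  have s: "sort_of M (a i) = sort_of M (b i)" if "i \<in> I" for i
  proof -
    \<comment> \<open>The formula \<open>x = x\<close>, with \<open>x\<close> of the sort of
      \<open>a i\<close>, lies in the type of \<open>a\<close> and hence in that of
      \<open>b\<close>; this forces the sorts to agree.\<close>
    define x :: "'s var" where "x = (0, sort_of M (a i))"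
    have "snd x \<in> sorts L" using assms(3) by (auto simp: is_structure_def x_def)
    then have "(Eq (Var x) (Var x), \<lambda>_. Inl i) \<in> tp L M a I B"
      using that by (simp add: tp_def x_def InlI)
    then have "(Eq (Var x) (Var x), \<lambda>_. Inl i) \<in> tp L M b I B"
      using assms(1) by simp
    then show ?thesis by (simp add: tp_def x_def)
  qed
  have "sat M e \<phi> \<longleftrightarrow> sat M e' \<phi>"
    if *: "wf_fm L \<phi>" "sorted_on M e (fv \<phi>)" "\<forall>v\<in>fv \<phi>. (e v, e' v) \<in> ?G" for \<phi> e e'
  proof -
    \<comment> \<open>A pair in \<open>?G\<close> may come from the tuple or from a parameter.
      \<open>z\<close> records one origin, and these choices form the substitution \<open>h\<close>
      of a member of the type.\<close>
    have "\<exists>z. z \<in> I <+> B \<and> e v = case_sum a id z \<and> e' v = case_sum b id z" if "v \<in> fv \<phi>" for v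
    proof -
      have "(e v, e' v) \<in> ?G" using *(3) that by blast
      then consider i where "i \<in> I" "e v = a i" "e' v = b i" | "e v \<in> B" "e' v = e v"
        by (auto simp: Id_on_def)
      then show ?thesis
      proof cases
        case 1
        then show ?thesis by (intro exI[of _ "Inl i"]) auto
      next
        case 2
        then show ?thesis by (intro exI[of _ "Inr (e v)"]) auto
      qed
    qed
    then have "\<forall>v. \<exists>z. v \<in> fv \<phi> \<longrightarrow> z \<in> I <+> B \<and> e v = case_sum a id z \<and> e' v = case_sum b id z"
      by blast
    from choice[OF this] obtain h where
      h: "\<And>v. v \<in> fv \<phi> \<Longrightarrow> h v \<in> I <+> B \<and> e v = case_sum a id (h v) \<and> e' v = case_sum b id (h v)"
      by blast
    have "sat M e \<phi> \<longleftrightarrow> sat M (case_sum a id \<circ> h) \<phi>" "sat M e' \<phi> \<longleftrightarrow> sat M (case_sum b id \<circ> h) \<phi>"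
      by (rule sat_cong, simp add: h)+
    moreover have sa: "\<forall>v\<in>fv \<phi>. h v \<in> I <+> B \<and> sort_of M (case_sum a id (h v)) = snd v"
      using h *(2) unfolding sorted_on_def by simp
    moreover have "\<forall>v\<in>fv \<phi>. h v \<in> I <+> B \<and> sort_of M (case_sum b id (h v)) = snd v"
    proof
      fix v assume v: "v \<in> fv \<phi>"
      show "h v \<in> I <+> B \<and> sort_of M (case_sum b id (h v)) = snd v"
        using bspec[OF sa v] s by (cases "h v") auto
    qed
    ultimately have "sat M e \<phi> \<longleftrightarrow> (\<phi>, h) \<in> tp L M a I B" "sat M e' \<phi> \<longleftrightarrow> (\<phi>, h) \<in> tp L M b I B"
      using *(1) by (auto simp: tp_def)
    then show ?thesis using assms(1) by simp
  qed
  then show ?thesis using s by (auto simp: elementary_def)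
qed

text \<open>Equality is itself a formula, so it must be preserved. Through the converse the same
  argument gives injectivity.\<close>

lemma elementary_functional:
  assumes "elementary L M G" "is_structure L M" "(a, b) \<in> G" "(a, b') \<in> G"
  shows "b = b'"
proof -
  define x where "x = (0::nat, sort_of M a)"
  define y where "y = (1::nat, sort_of M a)"
  have "snd x \<in> sorts L" using assms(2) by (auto simp: is_structure_def x_def)
  then have "sat M (\<lambda>_. a) (Eq (Var x) (Var y)) \<longleftrightarrow> sat M ((\<lambda>_. b)(y := b')) (Eq (Var x) (Var y))"
    by (intro elementary_sat[OF assms(1)]) (use assms(3,4) in \<open>auto simp: x_def y_def sorted_on_def\<close>)
  then show ?thesis by (simp add: x_def y_def)
qed

text \<open>In \<open>ext\<close> the new pair enters through the one variable \<open>x\<close>. For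
  an arbitrary assignment, all variables that carry this pair are renamed to \<open>x\<close> and
  all others are moved away from it.\<close>

lemma elementary_insert:
  fixes M :: "('s, 'f, 'r, 'm) struct"
  assumes G: "elementary L M G" and s: "sort_of M m = sort_of M m'" "snd x = sort_of M m"
    and ext: "\<And>\<phi> e e'. wf_fm L \<phi> \<Longrightarrow> sorted_on M e (fv \<phi> - {x}) \<Longrightarrow>
      (\<And>v. v \<in> fv \<phi> - {x} \<Longrightarrow> (e v, e' v) \<in> G) \<Longrightarrow> sat M (e(x := m)) \<phi> \<Longrightarrow> sat M (e'(x := m')) \<phi>"
  shows "elementary L M (insert (m, m') G)"
proof (rule elementaryI)
  show "sort_of M a = sort_of M b" if "(a, b) \<in> insert (m, m') G" for a b
    using that s(1) elementary_sort[OF G] by auto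
next
  fix \<phi> e e'
  assume wf: "wf_fm L \<phi>" and so: "sorted_on M e (fv \<phi>)" and sat: "sat M e \<phi>"
    and e: "\<And>v. v \<in> fv \<phi> \<Longrightarrow> (e v, e' v) \<in> insert (m, m') G"
  \<comment> \<open>The shift by \<open>fst x + 1\<close> misses \<open>x\<close> and stays
    injective, so assignments can be transported along \<open>inv \<pi>\<close>.\<close>
  define \<pi> :: "'s var \<Rightarrow> 's var" where "\<pi> v = (fst v + fst x + 1, snd v)" for v
  have [simp]: "\<pi> v \<noteq> x" for v
    by (auto simp: \<pi>_def prod_eq_iff)
  have snd_\<pi>: "snd (\<pi> v) = snd v" for v by (simp add: \<pi>_def)
  have "inj \<pi>" by (auto simp: \<pi>_def prod_eq_iff inj_on_def)
  then have [simp]: "inv \<pi> (\<pi> v) = v" for v by simp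
  \<comment> \<open>The test on sorts makes \<open>\<rho>\<close> sort-preserving on all variables;
    outside the free ones, \<open>e\<close> may take values of the wrong sort.\<close>
  define \<rho> where "\<rho> v = (if snd v = snd x \<and> e v = m \<and> e' v = m' then x else \<pi> v)" for v
  have "snd (\<rho> v) = snd v" for v by (simp add: \<rho>_def \<pi>_def)
  from rename_fm[OF wf this] obtain \<phi>' where
    \<phi>': "wf_fm L \<phi>'" "fv \<phi>' = \<rho> ` fv \<phi>" "\<And>E. sat M E \<phi>' \<longleftrightarrow> sat M (E \<circ> \<rho>) \<phi>"
    by blast
  have \<rho>_x: "e v = m \<and> e' v = m'" if "\<rho> v = x" for v
    using that by (simp add: \<rho>_def split: if_splits)
  have eq: "sat M ((f \<circ> inv \<pi>)(x := n)) \<phi>' \<longleftrightarrow> sat M f \<phi>"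
    if "\<And>v. \<rho> v = x \<Longrightarrow> f v = n" for f n
  proof -
    have "(f \<circ> inv \<pi>)(x := n) \<circ> \<rho> = f"
    proof
      fix v show "((f \<circ> inv \<pi>)(x := n) \<circ> \<rho>) v = f v"
        using that[of v] by (cases "\<rho> v = x") (auto simp: \<rho>_def split: if_splits)
    qed
    then show ?thesis unfolding \<phi>'(3) by (rule arg_cong)
  qed
  have old: "v \<in> fv \<phi> \<and> \<rho> v = \<pi> v \<and> \<not> (snd v = snd x \<and> e v = m \<and> e' v = m')"
    if "\<rho> v \<in> fv \<phi>' - {x}" "v \<in> fv \<phi>" for v
    using that by (auto simp: \<rho>_def split: if_splits)
  have "sat M ((e' \<circ> inv \<pi>)(x := m')) \<phi>'"
  proof (rule ext[OF \<phi>'(1), where e = "e \<circ> inv \<pi>"])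
    show "sorted_on M (e \<circ> inv \<pi>) (fv \<phi>' - {x})"
      unfolding sorted_on_def
    proof
      fix u assume "u \<in> fv \<phi>' - {x}"
      then obtain v where v: "v \<in> fv \<phi>" "u = \<rho> v" "\<rho> v \<in> fv \<phi>' - {x}" using \<phi>'(2) by auto
      then have "u = \<pi> v" using old[OF v(3,1)] by simp
      then show "sort_of M ((e \<circ> inv \<pi>) u) = snd u"
        using so v(1) by (simp add: sorted_on_def snd_\<pi>)
    qed
    show "((e \<circ> inv \<pi>) u, (e' \<circ> inv \<pi>) u) \<in> G" if u: "u \<in> fv \<phi>' - {x}" for u
    proof -
      obtain v where v: "v \<in> fv \<phi>" "u = \<rho> v" "\<rho> v \<in> fv \<phi>' - {x}" using u \<phi>'(2) by auto
      have "snd v = sort_of M (e v)" using so v(1) by (simp add: sorted_on_def)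
      then have "(e v, e' v) \<noteq> (m, m')" using old[OF v(3,1)] s(2) by auto
      then have "(e v, e' v) \<in> G" using e[OF v(1)] by blast
      then show ?thesis using old[OF v(3,1)] v(2) by simp
    qed
    show "sat M ((e \<circ> inv \<pi>)(x := m)) \<phi>'"
      using eq[of e m] \<rho>_x sat by blast
  qed
  then show "sat M e' \<phi>" using eq[of e' m'] \<rho>_x by blast
qed

text \<open>The renamings have disjoint ranges apart from \<open>x\<close>, so that the two parameter
  assignments can be merged.\<close>

lemma conjoin_formulas:
  fixes M :: "('s, 'f, 'r, 'm) struct" and x :: "'s var"
  assumes x: "snd x \<in> sorts L" and Q: "finite Q"
    and *: "\<And>\<phi> e e'. (\<phi>, e, e') \<in> Q \<Longrightarrow> wf_fm L \<phi> \<and> sorted_on M e (fv \<phi> - {x}) \<and>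
      (\<forall>v\<in>fv \<phi> - {x}. (e v, e' v) \<in> G)"
  shows "\<exists>\<psi> e e'. wf_fm L \<psi> \<and> sorted_on M e (fv \<psi> - {x}) \<and> (\<forall>v\<in>fv \<psi> - {x}. (e v, e' v) \<in> G) \<and>
    (\<forall>m. sat M (e(x := m)) \<psi> \<longleftrightarrow> (\<forall>(\<phi>, d, d')\<in>Q. sat M (d(x := m)) \<phi>)) \<and>
    (\<forall>m. sat M (e'(x := m)) \<psi> \<longleftrightarrow> (\<forall>(\<phi>, d, d')\<in>Q. sat M (d'(x := m)) \<phi>))"
  using Q *
proof (induction Q rule: finite_induct)
  case empty
  show ?case using x by (intro exI[of _ "Eq (Var x) (Var x)"]) (auto simp: sorted_on_def)
next
  case (insert q Q)
  obtain \<phi> d d' where q: "q = (\<phi>, d, d')" by (cases q)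
  have "\<And>\<phi> e e'. (\<phi>, e, e') \<in> Q \<Longrightarrow> wf_fm L \<phi> \<and> sorted_on M e (fv \<phi> - {x}) \<and>
      (\<forall>v\<in>fv \<phi> - {x}. (e v, e' v) \<in> G)"
    using insert.prems by blast
  from insert.IH[OF this] obtain \<psi> e e' where \<psi>: "wf_fm L \<psi>" "sorted_on M e (fv \<psi> - {x})"
    "\<And>v. v \<in> fv \<psi> - {x} \<Longrightarrow> (e v, e' v) \<in> G"
    "\<And>m. sat M (e(x := m)) \<psi> \<longleftrightarrow> (\<forall>(\<phi>, d, d')\<in>Q. sat M (d(x := m)) \<phi>)"
    "\<And>m. sat M (e'(x := m)) \<psi> \<longleftrightarrow> (\<forall>(\<phi>, d, d')\<in>Q. sat M (d'(x := m)) \<phi>)"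
    by blast
  have \<phi>: "wf_fm L \<phi>" "sorted_on M d (fv \<phi> - {x})" "\<And>v. v \<in> fv \<phi> - {x} \<Longrightarrow> (d v, d' v) \<in> G"
    using insert.prems[of \<phi> d d'] q by auto
  \<comment> \<open>The parity of the index separates the two copies, and the summand
    \<open>2 * fst x + 2\<close> moves every index past that of the shared variable
    \<open>x\<close>.\<close>
  define \<pi> :: "nat \<Rightarrow> 's var \<Rightarrow> 's var" where
    "\<pi> i v = (if v = x then x else (2 * (fst v + fst x) + 2 + i, snd v))" for i v
  have snd_\<pi>: "snd (\<pi> i v) = snd v" for i v by (simp add: \<pi>_def)
  have x_\<pi> [simp]: "\<pi> i v = x \<longleftrightarrow> v = x" for i v by (auto simp: \<pi>_def prod_eq_iff)
  have inj: "inj (\<pi> i)" for i by (auto simp: \<pi>_def inj_on_def prod_eq_iff split: if_splits)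
  then have inv_\<pi> [simp]: "inv (\<pi> i) (\<pi> i v) = v" for i v by simp
  have disj: "v = x \<and> w = x" if "\<pi> 0 v = \<pi> 1 w" for v w
  proof -
    from that have fst_eq: "fst (\<pi> 0 v) = fst (\<pi> 1 w)" by simp
    have "2 * i + 2 \<noteq> 2 * j + (3 :: nat)" for i j by presburger
    moreover have "2 * i + 2 + k \<noteq> fst x" if "i \<ge> fst x" for i k using that by simp
    ultimately show ?thesis using fst_eq that x_\<pi>[of 0 v] x_\<pi>[of 1 w]
      by (cases "v = x"; cases "w = x") (auto simp: \<pi>_def)
  qed
  define merge :: "('s var \<Rightarrow> 'm) \<Rightarrow> ('s var \<Rightarrow> 'm) \<Rightarrow> 's var \<Rightarrow> 'm"
    where "merge f g v = (if v \<in> range (\<pi> 0) then f (inv (\<pi> 0) v) else g (inv (\<pi> 1) v))" for f g v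
  have m0: "merge f g (\<pi> 0 v) = f v" for f g v by (simp add: merge_def)
  have m1: "merge f g (\<pi> 1 v) = g v" if "v \<noteq> x" for f g v
    using disj[of _ v] that inv_\<pi>[of 1 v] unfolding merge_def by (metis rangeE)
  have e0: "(merge f g)(x := m) \<circ> \<pi> 0 = f(x := m)" for f g m using m0 by auto
  have e1: "(merge f g)(x := m) \<circ> \<pi> 1 = g(x := m)" for f g m using m1 by auto
  obtain \<phi>' where \<phi>': "wf_fm L \<phi>'" "fv \<phi>' = \<pi> 0 ` fv \<phi>" "\<And>E. sat M E \<phi>' \<longleftrightarrow> sat M (E \<circ> \<pi> 0) \<phi>"
    using rename_fm[of L \<phi> "\<pi> 0" M, OF \<phi>(1) snd_\<pi>] by blast
  obtain \<psi>' where \<psi>': "wf_fm L \<psi>'" "fv \<psi>' = \<pi> 1 ` fv \<psi>" "\<And>E. sat M E \<psi>' \<longleftrightarrow> sat M (E \<circ> \<pi> 1) \<psi>"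
    using rename_fm[of L \<psi> "\<pi> 1" M, OF \<psi>(1) snd_\<pi>] by blast
  have fvs: "(\<exists>v\<in>fv \<phi> - {x}. u = \<pi> 0 v) \<or> (\<exists>v\<in>fv \<psi> - {x}. u = \<pi> 1 v)"
    if "u \<in> fv (Conj \<phi>' \<psi>') - {x}" for u
    using that \<phi>'(2) \<psi>'(2) x_\<pi> by auto
  have "sorted_on M (merge d e) (fv (Conj \<phi>' \<psi>') - {x})"
    unfolding sorted_on_def
  proof
    fix u assume "u \<in> fv (Conj \<phi>' \<psi>') - {x}"
    then show "sort_of M (merge d e u) = snd u"
      using fvs[of u] m0[of d e] m1[of _ d e] \<phi>(2) \<psi>(2) snd_\<pi> unfolding sorted_on_def by fastforce
  qed
  moreover have "(merge d e u, merge d' e' u) \<in> G" if "u \<in> fv (Conj \<phi>' \<psi>') - {x}" for u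
    using fvs[OF that] m0[of d e] m1[of _ d e] m0[of d' e'] m1[of _ d' e'] \<phi>(3) \<psi>(3) by fastforce
  moreover have mg: "sat M ((merge f g)(x := m)) (Conj \<phi>' \<psi>') \<longleftrightarrow> sat M (f(x := m)) \<phi> \<and> sat M (g(x := m)) \<psi>"
    for f g m
    unfolding sat.simps \<phi>'(3) \<psi>'(3) e0 e1 ..
  have "sat M ((merge d e)(x := m)) (Conj \<phi>' \<psi>') \<longleftrightarrow> (\<forall>(\<phi>, d, d')\<in>insert q Q. sat M (d(x := m)) \<phi>)" for m
    unfolding mg \<psi>(4) q ball_simps(7) by (simp only: prod.case)
  moreover have "sat M ((merge d' e')(x := m)) (Conj \<phi>' \<psi>') \<longleftrightarrow> (\<forall>(\<phi>, d, d')\<in>insert q Q. sat M (d'(x := m)) \<phi>)" for m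
    unfolding mg \<psi>(5) q ball_simps(7) by (simp only: prod.case)
  moreover have "wf_fm L (Conj \<phi>' \<psi>')" using \<phi>'(1) \<psi>'(1) by simp
  ultimately show ?case by blast
qed

lemma finite_max_in_Well_order:
  assumes r: "Well_order r" and F: "finite F" "F \<noteq> {}" "F \<subseteq> Field r"
  shows "\<exists>\<mu>\<in>F. F \<subseteq> insert \<mu> (underS r \<mu>)"
  using F
proof (induction F rule: finite_ne_induct)
  case (singleton x)
  then show ?case by simp
next
  case (insert x F)
  have wr: "wo_rel r" using r by (simp add: wo_rel_def)
  obtain \<mu> where \<mu>: "\<mu> \<in> F" "F \<subseteq> insert \<mu> (underS r \<mu>)" using insert by auto
  have "\<mu> \<noteq> x" using \<mu>(1) insert.hyps by blast
  have "(x, \<mu>) \<in> r \<or> (\<mu>, x) \<in> r"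
    using wo_rel.TOTALS[OF wr] \<mu>(1) insert.prems by blast
  then show ?case
  proof
    assume "(x, \<mu>) \<in> r"
    then show ?thesis using \<mu> \<open>\<mu> \<noteq> x\<close> by (auto simp: underS_def)
  next
    assume *: "(\<mu>, x) \<in> r"
    have "\<beta> \<in> underS r x" if "\<beta> \<in> insert \<mu> (underS r \<mu>)" for \<beta>
      using * that \<open>\<mu> \<noteq> x\<close> wo_rel.TRANS[OF wr] wo_rel.ANTISYM[OF wr]
      unfolding underS_def trans_def antisym_def by blast
    then show ?thesis using \<mu> by blast
  qed
qed

text \<open>A finite part of the union uses finitely many indices, and the stage of the largest one
  already contains it. Limit stages of a transfinite construction thus need no argument of their
  own.\<close>

lemma elementary_chain:
  assumes r: "Well_order r" and G: "elementary L M G" and S: "S \<subseteq> Field r"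
    and X: "\<And>\<mu>. \<mu> \<in> S \<Longrightarrow> elementary L M (G \<union> (\<Union>\<beta>\<in>underS r \<mu>. X \<beta>) \<union> X \<mu>)"
  shows "elementary L M (G \<union> (\<Union>\<beta>\<in>S. X \<beta>))"
proof (rule elementary_finite)
  fix F assume F: "F \<subseteq> G \<union> (\<Union>\<beta>\<in>S. X \<beta>)" "finite F"
  have "\<exists>\<beta>. p \<notin> G \<longrightarrow> \<beta> \<in> S \<and> p \<in> X \<beta>" if "p \<in> F" for p using F(1) that by blast
  then obtain i where i: "\<And>p. p \<in> F \<Longrightarrow> p \<notin> G \<Longrightarrow> i p \<in> S \<and> p \<in> X (i p)" by metis
  show "elementary L M F"
  proof (cases "F \<subseteq> G")
    case True
    then show ?thesis using G elementary_subset by blast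
  next
    case False
    have "i ` (F - G) \<subseteq> S" "finite (i ` (F - G))" "i ` (F - G) \<noteq> {}" using i F False by auto
    then obtain \<mu> where \<mu>: "\<mu> \<in> i ` (F - G)" "i ` (F - G) \<subseteq> insert \<mu> (underS r \<mu>)"
      using finite_max_in_Well_order[OF r, of "i ` (F - G)"] S by blast
    have "\<mu> \<in> S" using \<mu>(1) i by blast
    moreover have "F \<subseteq> G \<union> (\<Union>\<beta>\<in>underS r \<mu>. X \<beta>) \<union> X \<mu>"
      using i \<mu>(2) by blast
    ultimately show ?thesis using X elementary_subset by blast
  qed
qed

section \<open>Homogeneity of the big model\<close>

context big_saturated_model
begin

lemmas small_Un' = small_Un[OF inaccessible] and small_insert' = small_insert[OF inaccessible]
  and small_finite' = small_finite[OF inaccessible] and small_UN' = small_UN[OF inaccessible]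

lemma sort_in_sorts: "sort_of M m \<in> sorts L"
  using "structure" by (auto simp: is_structure_def)

text \<open>The type to realise consists of the formulas true of \<open>m\<close>, with parameters
  moved along \<open>G\<close>. Finitely many of them amount to one formula \<open>\<psi>\<close>;
  \<open>Exi x \<psi>\<close> no longer mentions \<open>m\<close>, so its truth transfers along
  \<open>G\<close>.\<close>

lemma elementary_forth:
  assumes G: "elementary L M G" and sm: "small \<kappa> G"
  shows "\<exists>m'. elementary L M (insert (m, m') G)"
proof -
  define x where "x = (0 :: nat, sort_of M m)"
  have x: "snd x = sort_of M m" "snd x \<in> sorts L" by (simp_all add: x_def sort_in_sorts)
  define Q where "Q = {(\<phi>, e, e'). wf_fm L \<phi> \<and> sorted_on M e (fv \<phi> - {x}) \<and>
    (\<forall>v\<in>fv \<phi> - {x}. (e v, e' v) \<in> G) \<and> sat M (e(x := m)) \<phi>}"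
  define p where "p = (\<lambda>(\<phi>, e, e'). (\<phi>, e')) ` Q"
  have "\<exists>m'. sort_of M m' = snd x \<and> (\<forall>\<phi>\<in>p. m' \<in> solutions M x \<phi>)"
  proof (rule saturated[unfolded saturated_def, rule_format], intro conjI ballI allI impI)
    show "small \<kappa> (snd ` G)" using sm by (rule small_image)
    show "snd x \<in> sorts L" by (rule x)
    show "formula_over L M (snd ` G) x \<phi>" if \<phi>: "\<phi> \<in> p" for \<phi>
    proof -
      obtain q where q: "q \<in> Q" "\<phi> = (\<lambda>(\<phi>, e, e'). (\<phi>, e')) q" using \<phi> unfolding p_def by blast
      obtain \<psi> e e' where "q = (\<psi>, e, e')" by (cases q)
      with q have "\<phi> = (\<psi>, e')" "(\<psi>, e, e') \<in> Q" by simp_all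
      moreover have "e' v \<in> snd ` G \<and> sort_of M (e' v) = snd v" if "v \<in> fv \<psi> - {x}" for v
      proof -
        have "(e v, e' v) \<in> G" "sort_of M (e v) = snd v"
          using \<open>(\<psi>, e, e') \<in> Q\<close> that unfolding Q_def sorted_on_def by blast+
        then show ?thesis using elementary_sort[OF G] by force
      qed
      ultimately show ?thesis using x(2) unfolding Q_def formula_over_def by blast
    qed
    show "\<exists>m'. sort_of M m' = snd x \<and> (\<forall>\<phi>\<in>q. m' \<in> solutions M x \<phi>)" if q: "q \<subseteq> p" "finite q" for q
    proof -
      obtain Q' where Q': "Q' \<subseteq> Q" "finite Q'" "q = (\<lambda>(\<phi>, e, e'). (\<phi>, e')) ` Q'"
        using finite_subset_image[OF q(2) q(1)[unfolded p_def]] by blast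
      have "wf_fm L \<phi> \<and> sorted_on M e (fv \<phi> - {x}) \<and> (\<forall>v\<in>fv \<phi> - {x}. (e v, e' v) \<in> G)"
        if "(\<phi>, e, e') \<in> Q'" for \<phi> e e'
        using that Q'(1) unfolding Q_def by blast
      from conjoin_formulas[OF x(2) Q'(2) this] obtain \<psi> e e' where
        \<psi>: "wf_fm L \<psi>" "sorted_on M e (fv \<psi> - {x})" "\<forall>v\<in>fv \<psi> - {x}. (e v, e' v) \<in> G"
        "\<And>m. sat M (e(x := m)) \<psi> \<longleftrightarrow> (\<forall>(\<phi>, d, d')\<in>Q'. sat M (d(x := m)) \<phi>)"
        "\<And>m. sat M (e'(x := m)) \<psi> \<longleftrightarrow> (\<forall>(\<phi>, d, d')\<in>Q'. sat M (d'(x := m)) \<phi>)"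
        by blast
      have "\<forall>(\<phi>, d, d')\<in>Q'. sat M (d(x := m)) \<phi>"
        using Q'(1) unfolding Q_def by blast
      then have "sat M (e(x := m)) \<psi>" unfolding \<psi>(4) .
      then have "sat M e (Exi x \<psi>)" using x(1) unfolding sat.simps by metis
      moreover have "sat M e (Exi x \<psi>) \<longleftrightarrow> sat M e' (Exi x \<psi>)"
        by (rule elementary_sat[OF G]) (use \<psi>(1,2,3) x(2) in auto)
      ultimately obtain m' where m': "sort_of M m' = snd x" "sat M (e'(x := m')) \<psi>"
        unfolding sat.simps by blast
      have *: "\<forall>(\<phi>, d, d')\<in>Q'. sat M (d'(x := m')) \<phi>" using m'(2) unfolding \<psi>(5) .
      have "m' \<in> solutions M x \<phi>" if \<phi>: "\<phi> \<in> q" for \<phi>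
      proof -
        obtain z where z: "z \<in> Q'" "\<phi> = (\<lambda>(\<phi>, e, e'). (\<phi>, e')) z" using \<phi> Q'(3) by blast
        obtain \<chi> d d' where "z = (\<chi>, d, d')" by (cases z)
        then have "(\<chi>, d, d') \<in> Q'" "\<phi> = (\<chi>, d')" using z by simp_all
        then show ?thesis using bspec[OF *, of "(\<chi>, d, d')"] m'(1) by (simp add: solutions_def)
      qed
      then show ?thesis using m'(1) by blast
    qed
  qed
  then obtain m' where m': "sort_of M m' = snd x" "\<And>\<phi>. \<phi> \<in> p \<Longrightarrow> m' \<in> solutions M x \<phi>" by blast
  have "elementary L M (insert (m, m') G)"
  proof (rule elementary_insert[OF G])
    fix \<phi> e e'
    assume "wf_fm L \<phi>" "sorted_on M e (fv \<phi> - {x})" "\<And>v. v \<in> fv \<phi> - {x} \<Longrightarrow> (e v, e' v) \<in> G"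
      "sat M (e(x := m)) \<phi>"
    then have "(\<phi>, e, e') \<in> Q" unfolding Q_def by blast
    then have "(\<phi>, e') \<in> p" unfolding p_def by force
    then show "sat M (e'(x := m')) \<phi>" using m'(2) by (force simp: solutions_def)
  qed (use x(1) m'(1) in auto)
  then show ?thesis by blast
qed

lemma elementary_back:
  assumes G: "elementary L M G" and sm: "small \<kappa> G"
  shows "\<exists>m. elementary L M (insert (m, m') G)"
proof -
  have "G\<inverse> = prod.swap ` G" by auto
  then have "small \<kappa> (G\<inverse>)" using sm small_image by metis
  then obtain m where "elementary L M (insert (m', m) (G\<inverse>))"
    using elementary_forth elementary_converse[OF G] by blast
  then have "elementary L M ((insert (m', m) (G\<inverse>))\<inverse>)" by (rule elementary_converse)
  moreover have "(insert (m', m) (G\<inverse>))\<inverse> = insert (m, m') G" by auto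
  ultimately show ?thesis by auto
qed

lemma total_elementary_automorphism:
  assumes G: "elementary L M G" and tot: "Domain G = UNIV" "Range G = UNIV"
  shows "\<exists>g\<in>automorphisms L M. \<forall>(a, b)\<in>G. g a = b"
proof -
  have "\<exists>b. (a, b) \<in> G" for a using tot(1) by (metis DomainE UNIV_I)
  then obtain g where g: "\<And>a. (a, g a) \<in> G" by metis
  have fun_G: "b = g a" if "(a, b) \<in> G" for a b
    using elementary_functional[OF G "structure" that g] .
  have "inj g"
  proof (rule injI)
    fix a b assume "g a = g b"
    then show "a = b"
      using elementary_functional[OF elementary_converse[OF G] "structure", of "g a" a b] g[of a] g[of b] by simp
  qed
  moreover have "surj g" using tot(2) fun_G unfolding surj_def by blast
  ultimately have bij: "bij g" by (rule bijI)
  have s: "sort_of M (g m) = sort_of M m" for m using elementary_sort[OF G g] by simp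
  have "g \<in> automorphisms L M"
  proof (rule automorphismsI[OF bij s])
    fix xs
    \<comment> \<open>Distinct variables stand for the positions of \<open>xs\<close>, even where
      entries repeat, so that an atomic formula tests a symbol at \<open>xs\<close>.\<close>
    define vs where "vs = map (\<lambda>i. (i, sort_of M (xs ! i))) [0..<length xs]"
    define e where "e v = xs ! fst v" for v :: "'s var"
    have vs: "map e vs = xs" "map snd vs = map (sort_of M) xs"
      by (auto simp: vs_def e_def o_def map_nth intro!: nth_equalityI)
    have sorted: "sorted_on M e (set vs)" by (auto simp: vs_def e_def sorted_on_def)
    show "rel_of M r (map g xs) = rel_of M r xs" if r: "r \<in> rels L" "map (sort_of M) xs = rel_dom L r" for r
    proof -
      have wf: "wf_fm L (Rel r (map Var vs))"
        using r vs(2) sort_in_sorts by (auto simp: o_def vs_def)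
      have "sat M e (Rel r (map Var vs)) \<longleftrightarrow> sat M (g \<circ> e) (Rel r (map Var vs))"
        by (rule elementary_sat[OF G wf]) (use sorted g in auto)
      moreover have "map (eval M e) (map Var vs) = xs" using vs(1) by (simp add: o_def)
      moreover have "map (eval M (g \<circ> e)) (map Var vs) = map g xs" using vs(1) by (auto simp: o_def)
      ultimately show ?thesis by simp
    qed
    show "g (fun_of M f xs) = fun_of M f (map g xs)" if f: "f \<in> funs L" "map (sort_of M) xs = fun_dom L f" for f
    proof -
      \<comment> \<open>The positions use the indices below \<open>length xs\<close>;
        \<open>w\<close> is therefore new and can hold the value of the function.\<close>
      define w where "w = (length xs, fun_cod L f)"
      define e' where "e' = e(w := fun_of M f xs)"
      have w: "w \<notin> set vs" by (auto simp: vs_def w_def)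
      have so: "sort_of M (fun_of M f xs) = fun_cod L f"
        using f "structure" by (simp add: is_structure_def)
      have "fun_cod L f \<in> sorts L" using so sort_in_sorts[of "fun_of M f xs"] by simp
      then have wf: "wf_fm L (Eq (Fun f (map Var vs)) (Var w))"
        using f vs(2) sort_in_sorts by (auto simp: o_def vs_def w_def)
      have "sat M e' (Eq (Fun f (map Var vs)) (Var w)) \<longleftrightarrow> sat M (g \<circ> e') (Eq (Fun f (map Var vs)) (Var w))"
        by (rule elementary_sat[OF G wf]) (use sorted so g in \<open>auto simp: sorted_on_def e'_def w_def\<close>)
      moreover have "map e' vs = map e vs" using w by (auto simp: e'_def)
      then have "map (eval M e') (map Var vs) = xs" "map (eval M (g \<circ> e')) (map Var vs) = map g xs"
        using vs(1) by (auto simp: o_def)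
      ultimately show ?thesis by (simp add: e'_def o_def)
    qed
  qed
  then show ?thesis using fun_G by auto
qed

text \<open>Back and forth along \<kappa>: stage \<alpha> puts \<open>h \<alpha>\<close> into the
  domain and into the range. Proper initial segments of a cardinal are smaller than it, so each
  stage is small and saturation applies; the bound on the size of the model lets \<open>h\<close>
  enumerate all of it.\<close>

theorem homogeneity:
  assumes G: "elementary L M G" and sm: "small \<kappa> G"
  shows "\<exists>g\<in>automorphisms L M. \<forall>(a, b)\<in>G. g a = b"
proof -
  have co: "Card_order \<kappa>" and inf: "\<not> finite (Field \<kappa>)" using inaccessible_facts[OF inaccessible] by auto
  then have wo: "Well_order \<kappa>" by (simp add: card_order_on_def)
  have "|UNIV :: 'm set| \<le>o |Field \<kappa>|"
    using size card_of_Field_ordIso[OF co] ordIso_symmetric ordLeq_ordIso_trans by blast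
  then obtain c :: "'m \<Rightarrow> 'k" where c: "inj c" "range c \<subseteq> Field \<kappa>" by (meson card_of_ordLeq)
  define h where "h = inv c"
  have wf: "wf (\<kappa> - Id)" using wo by (simp add: well_order_on_def)
  have below: "{\<beta>. (\<beta>, \<alpha>) \<in> \<kappa> - Id} = underS \<kappa> \<alpha>" for \<alpha> by (auto simp: underS_def)
  \<comment> \<open>The recursion runs over the whole type \<open>'k\<close>; an index outside the
    field has no predecessors.\<close>
  have small_below: "small \<kappa> (underS \<kappa> \<alpha>)" for \<alpha>
  proof (cases "\<alpha> \<in> Field \<kappa>")
    case True
    then show ?thesis unfolding small_def using card_of_underS[OF co] by blast
  next
    case False
    then have "underS \<kappa> \<alpha> = {}" by (auto simp: underS_def Field_def)
    then show ?thesis by (simp add: small_finite')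
  qed
  define stage where "stage f \<alpha> = G \<union> (\<Union>\<beta>\<in>underS \<kappa> \<alpha>. {(h \<beta>, fst (f \<beta>)), (snd (f \<beta>), h \<beta>)})"
    for f :: "'k \<Rightarrow> 'm \<times> 'm" and \<alpha>
  define P where "P f \<alpha> p \<longleftrightarrow> elementary L M (stage f \<alpha> \<union> {(h \<alpha>, fst p), (snd p, h \<alpha>)})" for f \<alpha> p
  have ch: "elementary L M (G \<union> (\<Union>\<beta>\<in>S. {(h \<beta>, fst (f \<beta>)), (snd (f \<beta>), h \<beta>)}))"
    if "S \<subseteq> Field \<kappa>" "\<And>\<beta>. \<beta> \<in> S \<Longrightarrow> P f \<beta> (f \<beta>)" for S f
    by (rule elementary_chain[OF wo G that(1)]) (use that(2) in \<open>simp add: P_def stage_def\<close>)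
  have "\<exists>f. \<forall>\<alpha>. P f \<alpha> (f \<alpha>)"
  proof (rule dependent_wf_choice[OF wf])
    fix f g :: "'k \<Rightarrow> 'm \<times> 'm" and \<alpha> p
    assume "\<And>\<beta>. (\<beta>, \<alpha>) \<in> \<kappa> - Id \<Longrightarrow> f \<beta> = g \<beta>"
    then have "f \<beta> = g \<beta>" if "\<beta> \<in> underS \<kappa> \<alpha>" for \<beta> using that below[of \<alpha>] by blast
    then have "stage f \<alpha> = stage g \<alpha>" unfolding stage_def by simp
    then show "P f \<alpha> p = P g \<alpha> p" by (simp add: P_def)
  next
    fix \<alpha> f
    assume IH: "\<And>\<beta>. (\<beta>, \<alpha>) \<in> \<kappa> - Id \<Longrightarrow> P f \<beta> (f \<beta>)"
    have "elementary L M (stage f \<alpha>)" unfolding stage_def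
      by (rule ch) (use IH below[of \<alpha>] in \<open>auto simp: underS_def Field_def\<close>)
    moreover have sm\<alpha>: "small \<kappa> (stage f \<alpha>)" unfolding stage_def
      by (intro small_Un' sm small_UN' small_below small_finite') auto
    ultimately obtain y where y: "elementary L M (insert (h \<alpha>, y) (stage f \<alpha>))"
      using elementary_forth by blast
    then obtain z where "elementary L M (insert (z, h \<alpha>) (insert (h \<alpha>, y) (stage f \<alpha>)))"
      using elementary_back[OF y small_insert'[OF sm\<alpha>]] by blast
    then have "P f \<alpha> (y, z)" by (simp add: P_def insert_commute)
    then show "\<exists>p. P f \<alpha> p" ..
  qed
  then obtain f where f: "\<And>\<alpha>. P f \<alpha> (f \<alpha>)" by blast
  define H where "H = G \<union> (\<Union>\<beta>\<in>Field \<kappa>. {(h \<beta>, fst (f \<beta>)), (snd (f \<beta>), h \<beta>)})"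
  have H: "elementary L M H" unfolding H_def by (rule ch) (auto simp: f)
  have "m \<in> Domain H \<and> m \<in> Range H" for m
  proof -
    have "c m \<in> Field \<kappa>" "h (c m) = m" using c by (auto simp: h_def)
    then have "(m, fst (f (c m))) \<in> H" "(snd (f (c m)), m) \<in> H"
      unfolding H_def by (auto intro!: bexI[of _ "c m"])
    then show ?thesis by blast
  qed
  then have "Domain H = UNIV" "Range H = UNIV" by auto
  from total_elementary_automorphism[OF H this] obtain g where
    g: "g \<in> automorphisms L M" "\<forall>(a, b)\<in>H. g a = b"
    by blast
  have "G \<subseteq> H" unfolding H_def by (rule Un_upper1)
  then have "\<forall>p\<in>G. case p of (a, b) \<Rightarrow> g a = b" using g(2) by (meson subsetD)
  then show ?thesis using g(1) by (rule bexI)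
qed

end

section \<open>Algebraic closure and finite orbits\<close>

lemma finite_restrict_image:
  assumes "finite V" "\<And>v. v \<in> V \<Longrightarrow> finite {f v |f. f \<in> F}"
  shows "finite ((\<lambda>f. restrict f V) ` F)"
proof (rule finite_subset)
  show "(\<lambda>f. restrict f V) ` F \<subseteq> (\<Pi>\<^sub>E v\<in>V. {f v |f. f \<in> F})" by auto
  show "finite (\<Pi>\<^sub>E v\<in>V. {f v |f. f \<in> F})" using assms by (intro finite_PiE) auto
qed

definition pointwise_stabilizer ::
  "('s, 'f, 'r) language \<Rightarrow> ('s, 'f, 'r, 'm) struct \<Rightarrow> 'm set \<Rightarrow> ('m \<Rightarrow> 'm) set" where
  "pointwise_stabilizer L M A = {g \<in> automorphisms L M. \<forall>a\<in>A. g a = a}"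

lemma pointwise_stabilizer_inv:
  assumes "g \<in> pointwise_stabilizer L M A"
  shows "inv g \<in> pointwise_stabilizer L M A"
proof -
  have g: "g \<in> automorphisms L M" "\<And>a. a \<in> A \<Longrightarrow> g a = a"
    using assms by (simp_all add: pointwise_stabilizer_def)
  have "inv g a = a" if "a \<in> A" for a
    using automorphisms_inv_apply(2)[OF g(1), of a] g(2)[OF that] by simp
  then show ?thesis using automorphisms_inv[OF g(1)] by (simp add: pointwise_stabilizer_def)
qed

lemma pointwise_stabilizer_comp:
  assumes "g \<in> pointwise_stabilizer L M A" "h \<in> pointwise_stabilizer L M A"
  shows "g \<circ> h \<in> pointwise_stabilizer L M A"
  using assms automorphisms_comp[of g L M h] by (simp add: pointwise_stabilizer_def)

lemma pointwise_stabilizer_mono: "A \<subseteq> B \<Longrightarrow> pointwise_stabilizer L M B \<subseteq> pointwise_stabilizer L M A"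
  unfolding pointwise_stabilizer_def by blast

lemma solutions_cong:
  assumes "\<And>v. v \<in> fv \<phi> - {x} \<Longrightarrow> e v = e' v"
  shows "solutions M x (\<phi>, e) = solutions M x (\<phi>, e')"
proof -
  have "sat M (e(x := m)) \<phi> \<longleftrightarrow> sat M (e'(x := m)) \<phi>" for m
    by (rule sat_cong) (use assms in auto)
  then show ?thesis by (simp add: solutions_def)
qed

lemma solutions_automorphism:
  assumes M: "is_structure L M" and g: "g \<in> automorphisms L M" and "formula_over L M A x (\<phi>, e)"
    and d: "d \<in> solutions M x (\<phi>, e)"
  shows "g d \<in> solutions M x (\<phi>, g \<circ> e)"
proof -
  have "wf_fm L \<phi>" "sorted_on M (e(x := d)) (fv \<phi>)"
    using assms(3) d by (auto simp: formula_over_def sorted_on_def solutions_def)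
  then have "sat M (g \<circ> e(x := d)) \<phi>"
    using automorphism_sat[OF M g] d by (auto simp: solutions_def simp del: fun_upd_apply)
  moreover have "g \<circ> e(x := d) = (g \<circ> e)(x := g d)" by auto
  ultimately show ?thesis using d automorphisms_sort[OF g] by (simp add: solutions_def)
qed

lemma formula_over_automorphism:
  assumes "g \<in> automorphisms L M" "formula_over L M A x (\<phi>, e)"
  shows "formula_over L M (g ` A) x (\<phi>, g \<circ> e)"
  using assms(2) automorphisms_sort[OF assms(1)] by (auto simp: formula_over_def)

lemma aclI:
  "formula_over L M A x (\<phi>, e) \<Longrightarrow> d \<in> solutions M x (\<phi>, e) \<Longrightarrow> finite (solutions M x (\<phi>, e)) \<Longrightarrow>
    d \<in> acl L M A"
  unfolding acl_def by blast

lemma aclE: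
  assumes "d \<in> acl L M A"
  obtains x \<phi> e where "formula_over L M A x (\<phi>, e)" "d \<in> solutions M x (\<phi>, e)"
    "finite (solutions M x (\<phi>, e))"
  using assms unfolding acl_def by auto

lemma acl_mono: "A \<subseteq> B \<Longrightarrow> acl L M A \<subseteq> acl L M B"
  unfolding acl_def formula_over_def by fast

lemma acl_finite_character:
  assumes "d \<in> acl L M A"
  shows "\<exists>F\<subseteq>A. finite F \<and> d \<in> acl L M F"
proof -
  obtain x \<phi> e where *: "formula_over L M A x (\<phi>, e)" "d \<in> solutions M x (\<phi>, e)" "finite (solutions M x (\<phi>, e))"
    using assms by (rule aclE)
  let ?F = "e ` (fv \<phi> - {x})"
  have "formula_over L M ?F x (\<phi>, e)" "?F \<subseteq> A" using *(1) by (auto simp: formula_over_def)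
  then show ?thesis using aclI[OF _ *(2,3)] by (intro exI[of _ ?F]) auto
qed

lemma acl_automorphism_subset:
  assumes M: "is_structure L M" and g: "g \<in> automorphisms L M"
  shows "g ` acl L M A \<subseteq> acl L M (g ` A)"
proof
  fix c assume "c \<in> g ` acl L M A"
  then obtain d where c: "c = g d" and "d \<in> acl L M A" by blast
  then obtain x \<phi> e where *: "formula_over L M A x (\<phi>, e)" "d \<in> solutions M x (\<phi>, e)"
    "finite (solutions M x (\<phi>, e))"
    by (elim aclE)
  have "solutions M x (\<phi>, g \<circ> e) \<subseteq> g ` solutions M x (\<phi>, e)"
  proof
    fix m assume "m \<in> solutions M x (\<phi>, g \<circ> e)"
    then have "inv g m \<in> solutions M x (\<phi>, inv g \<circ> (g \<circ> e))"
      using solutions_automorphism[OF M automorphisms_inv[OF g] formula_over_automorphism[OF g *(1)]] by blast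
    moreover have "inv g \<circ> (g \<circ> e) = e" using automorphisms_inv_apply(2)[OF g] by auto
    ultimately show "m \<in> g ` solutions M x (\<phi>, e)" using automorphisms_inv_apply(1)[OF g, of m] by force
  qed
  then have "finite (solutions M x (\<phi>, g \<circ> e))" using *(3) finite_surj by blast
  then show "c \<in> acl L M (g ` A)" unfolding c
    by (rule aclI[OF formula_over_automorphism[OF g *(1)] solutions_automorphism[OF M g *(1,2)]])
qed

lemma acl_automorphism:
  assumes M: "is_structure L M" and g: "g \<in> automorphisms L M"
  shows "g ` acl L M A = acl L M (g ` A)"
proof
  have "inv g ` acl L M (g ` A) \<subseteq> acl L M (inv g ` (g ` A))"
    by (rule acl_automorphism_subset[OF M automorphisms_inv[OF g]])
  also have "inv g ` (g ` A) = A"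
    using automorphisms_inv_apply(2)[OF g] by (force simp: image_image)
  finally show "acl L M (g ` A) \<subseteq> g ` acl L M A"
    using automorphisms_inv_apply(1)[OF g] by (metis image_subset_iff rev_image_eqI subsetI)
qed (rule acl_automorphism_subset[OF M g])

context big_saturated_model
begin

lemma acl_extensive: "A \<subseteq> acl L M A"
proof
  fix a assume a: "a \<in> A"
  define x where "x = (0 :: nat, sort_of M a)"
  define y where "y = (1 :: nat, sort_of M a)"
  have "formula_over L M A x (Eq (Var x) (Var y), \<lambda>_. a)"
    using a sort_in_sorts by (auto simp: formula_over_def x_def y_def)
  moreover have "solutions M x (Eq (Var x) (Var y), \<lambda>_. a) = {a}"
    by (auto simp: solutions_def x_def y_def)
  ultimately show "a \<in> acl L M A" by (intro aclI) auto
qed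

lemma acl_orbit_finite:
  assumes "d \<in> acl L M A"
  shows "finite {g d |g. g \<in> pointwise_stabilizer L M A}"
proof -
  obtain x \<phi> e where *: "formula_over L M A x (\<phi>, e)" "d \<in> solutions M x (\<phi>, e)" "finite (solutions M x (\<phi>, e))"
    using assms by (rule aclE)
  have "g d \<in> solutions M x (\<phi>, e)" if g: "g \<in> pointwise_stabilizer L M A" for g
  proof -
    have "g d \<in> solutions M x (\<phi>, g \<circ> e)"
      using g solutions_automorphism[OF "structure" _ *(1,2)] by (auto simp: pointwise_stabilizer_def)
    also have "solutions M x (\<phi>, g \<circ> e) = solutions M x (\<phi>, e)"
      by (rule solutions_cong) (use *(1) g in \<open>auto simp: formula_over_def pointwise_stabilizer_def\<close>)
    finally show ?thesis .
  qed
  then have "{g d |g. g \<in> pointwise_stabilizer L M A} \<subseteq> solutions M x (\<phi>, e)" by blast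
  then show ?thesis using *(3) by (rule finite_subset)
qed

text \<open>Were \<open>d\<close> not algebraic, its type over \<open>A\<close> would by saturation have a realisation outside
  the finite orbit, contradicting homogeneity.\<close>

lemma finite_orbit_acl:
  assumes A: "small \<kappa> A" and "finite {g d |g. g \<in> pointwise_stabilizer L M A}"
  shows "d \<in> acl L M A"
proof (rule ccontr)
  define Orb where "Orb = {g d |g. g \<in> pointwise_stabilizer L M A}"
  have fin: "finite Orb" using assms(2) unfolding Orb_def .
  assume nd: "d \<notin> acl L M A"
  define x where "x = (0 :: nat, sort_of M d)"
  define y where "y = (1 :: nat, sort_of M d)"
  have x: "snd x = sort_of M d" "snd x \<in> sorts L" "snd y = snd x" "y \<noteq> x"
    by (simp_all add: x_def y_def sort_in_sorts)
  define p where "p = {\<phi>. formula_over L M A x \<phi> \<and> d \<in> solutions M x \<phi>}"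
  define q where "q = (\<lambda>m. (Neg (Eq (Var x) (Var y)) :: ('s, 'f, 'r) fm, (\<lambda>_ :: 's var. m))) ` Orb"
  have sO: "sort_of M m = snd x" if "m \<in> Orb" for m
    using that x(1) by (auto simp: Orb_def pointwise_stabilizer_def automorphisms_sort)
  have sol_q: "m \<in> solutions M x (Neg (Eq (Var x) (Var y)), \<lambda>_. m') \<longleftrightarrow> sort_of M m = snd x \<and> m \<noteq> m'" for m m'
    using x(4) by (auto simp: solutions_def)
  have "\<exists>m. sort_of M m = snd x \<and> (\<forall>\<phi>\<in>p \<union> q. m \<in> solutions M x \<phi>)"
  proof (rule saturated[unfolded saturated_def, rule_format], intro conjI ballI allI impI)
    show "small \<kappa> (A \<union> Orb)" using A fin by (intro small_Un') (simp_all add: small_finite')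
    show "snd x \<in> sorts L" by (rule x)
    show "formula_over L M (A \<union> Orb) x \<phi>" if \<phi>: "\<phi> \<in> p \<union> q" for \<phi>
    proof (cases "\<phi> \<in> p")
      case True
      then show ?thesis unfolding p_def formula_over_def by auto
    next
      case False
      then obtain m where "m \<in> Orb" "\<phi> = (Neg (Eq (Var x) (Var y)), \<lambda>_. m)" using \<phi> unfolding q_def by blast
      then show ?thesis using x sO[of m] by (auto simp: formula_over_def)
    qed
    show "\<exists>m. sort_of M m = snd x \<and> (\<forall>\<phi>\<in>r. m \<in> solutions M x \<phi>)" if r: "r \<subseteq> p \<union> q" "finite r" for r
    proof -
      \<comment> \<open>\<open>conjoin_formulas\<close> handles pairs of assignments; on the
        diagonal it is plain conjunction.\<close>
      define Q where "Q = (\<lambda>(\<phi>, e). (\<phi>, e, e)) ` (r \<inter> p)"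
      have Q: "wf_fm L \<phi> \<and> sorted_on M e (fv \<phi> - {x}) \<and> (\<forall>v\<in>fv \<phi> - {x}. (e v, e' v) \<in> Id_on A)"
        if "(\<phi>, e, e') \<in> Q" for \<phi> e e'
        using that unfolding Q_def p_def formula_over_def sorted_on_def by auto
      have "finite Q" unfolding Q_def using r(2) by simp
      from conjoin_formulas[OF x(2) this Q] obtain \<psi> e e' where
        \<psi>: "wf_fm L \<psi>" "sorted_on M e (fv \<psi> - {x})" "\<forall>v\<in>fv \<psi> - {x}. (e v, e' v) \<in> Id_on A"
        "\<And>m. sat M (e(x := m)) \<psi> \<longleftrightarrow> (\<forall>(\<phi>, d, d')\<in>Q. sat M (d(x := m)) \<phi>)"
        by blast
      have sol: "m \<in> solutions M x (\<psi>, e) \<longleftrightarrow> sort_of M m = snd x \<and> (\<forall>\<phi>\<in>r \<inter> p. m \<in> solutions M x \<phi>)" for m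
      proof -
        have "(\<forall>(\<phi>, d, d')\<in>Q. sat M (d(x := m)) \<phi>) \<longleftrightarrow> (\<forall>(\<phi>, e)\<in>r \<inter> p. sat M (e(x := m)) \<phi>)"
          unfolding Q_def by (simp add: case_prod_unfold del: fun_upd_apply)
        then show ?thesis using \<psi>(4) unfolding solutions_def by fastforce
      qed
      have "d \<in> solutions M x (\<psi>, e)" unfolding sol using x(1) by (simp add: p_def)
      moreover have "formula_over L M A x (\<psi>, e)"
        using \<psi>(1,2,3) x(2) unfolding formula_over_def sorted_on_def by auto
      \<comment> \<open>Finitely many members of the type of \<open>d\<close> amount to one formula
        over \<open>A\<close> true of \<open>d\<close>. As \<open>d\<close> is not algebraic, this
        formula has infinitely many solutions, too many for the finite orbit.\<close>
      ultimately have "infinite (solutions M x (\<psi>, e))" using nd aclI[of L M A x \<psi> e d] by metis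
      then have "\<not> solutions M x (\<psi>, e) \<subseteq> Orb" using finite_subset[OF _ fin] by metis
      then obtain m where m: "m \<in> solutions M x (\<psi>, e)" "m \<notin> Orb"
        by blast
      have "m \<in> solutions M x \<phi>" if \<phi>: "\<phi> \<in> r" for \<phi>
      proof (cases "\<phi> \<in> p")
        case True
        then show ?thesis using m(1) \<phi> sol by blast
      next
        case False
        then obtain m' where "m' \<in> Orb" "\<phi> = (Neg (Eq (Var x) (Var y)), \<lambda>_. m')" using \<phi> r(1) unfolding q_def by blast
        then show ?thesis using m sol[of m] sol_q[of m m'] by metis
      qed
      then show ?thesis using m(1) sol by blast
    qed
  qed
  then obtain m where m: "sort_of M m = snd x" "\<And>\<phi>. \<phi> \<in> p \<union> q \<Longrightarrow> m \<in> solutions M x \<phi>" by blast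
  have "m \<notin> Orb"
  proof
    assume "m \<in> Orb"
    then have "(Neg (Eq (Var x) (Var y)), \<lambda>_. m) \<in> p \<union> q" unfolding q_def by blast
    from m(2)[OF this] show False unfolding sol_q by simp
  qed
  have "elementary L M (Id_on A)"
    by (rule elementary_subset[OF elementary_automorphism[OF "structure" automorphisms_id]]) auto
  then have "elementary L M (insert (d, m) (Id_on A))"
  proof (rule elementary_insert)
    fix \<phi> e e'
    assume *: "wf_fm L \<phi>" "sorted_on M e (fv \<phi> - {x})" "\<And>v. v \<in> fv \<phi> - {x} \<Longrightarrow> (e v, e' v) \<in> Id_on A"
      "sat M (e(x := d)) \<phi>"
    then have "(\<phi>, e) \<in> p" using x unfolding p_def formula_over_def sorted_on_def solutions_def by auto
    then have "m \<in> solutions M x (\<phi>, e)" by (intro m(2) UnI1)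
    also have "solutions M x (\<phi>, e) = solutions M x (\<phi>, e')"
      by (rule solutions_cong, erule Id_onE[OF *(3)]) simp
    finally show "sat M (e'(x := m)) \<phi>" by (simp add: solutions_def)
  qed (use x(1) m(1) in auto)
  moreover have "small \<kappa> (insert (d, m) (Id_on A))"
  proof -
    have "Id_on A = (\<lambda>a. (a, a)) ` A" by (auto simp: Id_on_def)
    then show ?thesis using A by (simp add: small_insert' small_image)
  qed
  ultimately obtain g where "g \<in> automorphisms L M" "\<forall>(a, b)\<in>insert (d, m) (Id_on A). g a = b"
    using homogeneity by blast
  then have "g \<in> pointwise_stabilizer L M A" "g d = m"
    by (auto simp: pointwise_stabilizer_def Id_on_def)
  then show False using \<open>m \<notin> Orb\<close> unfolding Orb_def by blast
qed

text \<open>Over \<open>A\<close> every parameter of the formula has a finite orbit, so the formula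
  has only finitely many conjugates, each with finitely many solutions. Their union contains the
  orbit of \<open>d\<close>, and a finite orbit means algebraic.\<close>

lemma acl_idempotent:
  assumes A: "small \<kappa> A"
  shows "acl L M (acl L M A) = acl L M A"
proof
  show "acl L M (acl L M A) \<subseteq> acl L M A"
  proof
    fix d assume "d \<in> acl L M (acl L M A)"
    then obtain x \<phi> e where *: "formula_over L M (acl L M A) x (\<phi>, e)" "d \<in> solutions M x (\<phi>, e)"
      "finite (solutions M x (\<phi>, e))"
      by (rule aclE)
    let ?V = "fv \<phi> - {x}" and ?S = "pointwise_stabilizer L M A"
    \<comment> \<open>Only the values at parameter variables lie in finite orbits; restricting to
      these variables makes the set of moved assignments finite.\<close>
    define E where "E = (\<lambda>f. restrict f ?V) ` {g \<circ> e |g. g \<in> ?S}"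
    have finE: "finite E" unfolding E_def
    proof (rule finite_restrict_image)
      fix v assume "v \<in> ?V"
      then have "e v \<in> acl L M A" using *(1) by (auto simp: formula_over_def)
      then have "finite {g (e v) |g. g \<in> ?S}" by (rule acl_orbit_finite)
      moreover have "{f v |f. f \<in> {g \<circ> e |g. g \<in> ?S}} = {g (e v) |g. g \<in> ?S}"
        by (auto, metis comp_apply)
      ultimately show "finite {f v |f. f \<in> {g \<circ> e |g. g \<in> ?S}}" by simp
    qed simp
    have sol: "solutions M x (\<phi>, restrict (g \<circ> e) ?V) = solutions M x (\<phi>, g \<circ> e)" for g :: "'m \<Rightarrow> 'm"
      by (rule solutions_cong) simp
    have "finite (solutions M x (\<phi>, g \<circ> e))" if "g \<in> ?S" for g
    proof -
      have g: "g \<in> automorphisms L M" using that by (simp add: pointwise_stabilizer_def)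
      have "inv g ` solutions M x (\<phi>, g \<circ> e) \<subseteq> solutions M x (\<phi>, inv g \<circ> (g \<circ> e))"
        using solutions_automorphism[OF "structure" automorphisms_inv[OF g] formula_over_automorphism[OF g *(1)]] by blast
      also have "inv g \<circ> (g \<circ> e) = e" using automorphisms_inv_apply(2)[OF g] by auto
      finally show ?thesis
        using *(3) finite_subset finite_imageD automorphisms_bij[OF automorphisms_inv[OF g]]
        by (metis bij_is_inj inj_on_subset subset_UNIV)
    qed
    then have "finite (solutions M x (\<phi>, e'))" if "e' \<in> E" for e'
      using that sol unfolding E_def by auto
    with finE have "finite (\<Union>e'\<in>E. solutions M x (\<phi>, e'))" by (rule finite_UN_I)
    moreover have "{g d |g. g \<in> ?S} \<subseteq> (\<Union>e'\<in>E. solutions M x (\<phi>, e'))"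
    proof
      fix c assume "c \<in> {g d |g. g \<in> ?S}"
      then obtain g where g: "g \<in> ?S" "c = g d" by blast
      then have "c \<in> solutions M x (\<phi>, g \<circ> e)"
        using solutions_automorphism[OF "structure" _ *(1,2)] by (simp add: pointwise_stabilizer_def)
      then have "c \<in> solutions M x (\<phi>, restrict (g \<circ> e) ?V)" using sol by simp
      moreover have "restrict (g \<circ> e) ?V \<in> E" unfolding E_def using g(1) by blast
      ultimately show "c \<in> (\<Union>e'\<in>E. solutions M x (\<phi>, e'))" by blast
    qed
    ultimately have "finite {g d |g. g \<in> ?S}" by (rule finite_subset[rotated])
    then show "d \<in> acl L M A" by (rule finite_orbit_acl[OF A])
  qed
qed (rule acl_extensive)

end

section \<open>The algebraic closure of a small set is small\<close>

text \<open>The stages serve for counting: each is assembled from small sets by products, lists and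
  images. Ill-formed terms may occur in them, as an upper bound is all that is wanted.\<close>

fun trm_stage :: "('s, 'f, 'r) language \<Rightarrow> nat \<Rightarrow> ('s, 'f) trm set" where
  "trm_stage L 0 = {}"
| "trm_stage L (Suc n) = Var ` (UNIV \<times> sorts L) \<union>
     (\<lambda>(f, ts). Fun f ts) ` (funs L \<times> lists (trm_stage L n))"

fun fm_stage :: "('s, 'f, 'r) language \<Rightarrow> nat \<Rightarrow> ('s, 'f, 'r) fm set" where
  "fm_stage L 0 = (\<lambda>(t, u). Eq t u) ` ((\<Union>n. trm_stage L n) \<times> (\<Union>n. trm_stage L n)) \<union>
     (\<lambda>(r, ts). Rel r ts) ` (rels L \<times> lists (\<Union>n. trm_stage L n))"
| "fm_stage L (Suc n) = fm_stage L n \<union> Neg ` fm_stage L n \<union>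
     (\<lambda>(\<phi>, \<psi>). Conj \<phi> \<psi>) ` (fm_stage L n \<times> fm_stage L n) \<union>
     (\<lambda>(v, \<phi>). Exi v \<phi>) ` ((UNIV \<times> sorts L) \<times> fm_stage L n)"

lemma trm_stage_mono: "m \<le> n \<Longrightarrow> trm_stage L m \<subseteq> trm_stage L n"
proof -
  have "trm_stage L n \<subseteq> trm_stage L (Suc n)" for n
  proof (induction n)
    case (Suc n)
    then have "lists (trm_stage L n) \<subseteq> lists (trm_stage L (Suc n))" by (rule lists_mono)
    then show ?case by (simp only: trm_stage.simps(2)) blast
  qed simp
  then show "m \<le> n \<Longrightarrow> trm_stage L m \<subseteq> trm_stage L n" by (rule lift_Suc_mono_le)
qed

lemma fm_stage_mono: "m \<le> n \<Longrightarrow> fm_stage L m \<subseteq> fm_stage L n"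
  by (rule lift_Suc_mono_le) auto

lemma wf_trm_in_stage: "wf_trm L t \<Longrightarrow> t \<in> (\<Union>n. trm_stage L n)"
proof (induction t)
  case (Var v)
  then have "Var v \<in> trm_stage L 1" by (cases v) (auto simp: One_nat_def)
  then show ?case by blast
next
  case (Fun f ts)
  then have "\<forall>t\<in>set ts. \<exists>n. t \<in> trm_stage L n" by auto
  then obtain n where n: "\<And>t. t \<in> set ts \<Longrightarrow> t \<in> trm_stage L (n t)" by metis
  have "t \<in> trm_stage L (Max (n ` set ts))" if "t \<in> set ts" for t
    using trm_stage_mono[of "n t" "Max (n ` set ts)" L] n[OF that] that by auto
  then have "Fun f ts \<in> trm_stage L (Suc (Max (n ` set ts)))"
    using Fun.prems by (auto simp: in_lists_conv_set)
  then show ?case by blast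
qed

lemma wf_fm_in_stage: "wf_fm L \<phi> \<Longrightarrow> \<phi> \<in> (\<Union>n. fm_stage L n)"
proof (induction \<phi>)
  case (Eq t u)
  then have "Eq t u \<in> fm_stage L 0" using wf_trm_in_stage[of L t] wf_trm_in_stage[of L u] by auto
  then show ?case by blast
next
  case (Rel r ts)
  then have "ts \<in> lists (\<Union>n. trm_stage L n)" using wf_trm_in_stage[of L] by (auto simp: in_lists_conv_set)
  then have "Rel r ts \<in> fm_stage L 0" using Rel by auto
  then show ?case by blast
next
  case (Neg \<phi>)
  then obtain n where "\<phi> \<in> fm_stage L n" by auto
  then have "Neg \<phi> \<in> fm_stage L (Suc n)" by auto
  then show ?case by blast
next
  case (Conj \<phi> \<psi>)
  then obtain m n where "\<phi> \<in> fm_stage L m" "\<psi> \<in> fm_stage L n" by auto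
  then have "\<phi> \<in> fm_stage L (max m n)" "\<psi> \<in> fm_stage L (max m n)"
    using fm_stage_mono[of m "max m n" L] fm_stage_mono[of n "max m n" L] by auto
  then have "Conj \<phi> \<psi> \<in> fm_stage L (Suc (max m n))" by auto
  then show ?case by blast
next
  case (Exi v \<phi>)
  then obtain n where "\<phi> \<in> fm_stage L n" by auto
  then have "Exi v \<phi> \<in> fm_stage L (Suc n)" using Exi.prems by (cases v) auto
  then show ?case by blast
qed

context big_saturated_model
begin

lemmas small_Times' = small_Times[OF inaccessible] and small_lists' = small_lists[OF inaccessible]
  and small_nat' = small_nat[OF inaccessible]

lemma small_trms: "small \<kappa> (\<Union>n. trm_stage L n)"
proof (rule small_UN'[OF small_nat'])
  show "small \<kappa> (trm_stage L n)" for n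
  proof (induction n)
    case (Suc n)
    then show ?case unfolding trm_stage.simps
      by (intro small_Un' small_image small_nat' small_Times' small_lists'
          small_language)
  qed (simp add: small_finite')
qed

lemma small_fms: "small \<kappa> {\<phi>. wf_fm L \<phi>}"
proof -
  have "small \<kappa> (\<Union>n. fm_stage L n)"
  proof (rule small_UN'[OF small_nat'])
    show "small \<kappa> (fm_stage L n)" for n
    proof (induction n)
      case 0
      show ?case unfolding fm_stage.simps
        by (intro small_Un' small_image small_nat' small_Times' small_lists'
            small_language small_trms)
    next
      case (Suc n)
      then show ?case unfolding fm_stage.simps
        by (intro small_Un' small_image small_nat' small_Times' small_language)
    qed
  qed
  then show ?thesis by (rule small_subset) (use wf_fm_in_stage in blast)
qed

lemma small_acl:
  assumes A: "small \<kappa> A"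
  shows "small \<kappa> (acl L M A)"
proof -
  \<comment> \<open>A formula has finitely many parameters, so a finite association list codes its
    assignment, and \<open>map_of\<close> decodes the list.\<close>
  define P where "P = ((UNIV :: nat set) \<times> sorts L) \<times> {\<phi>. wf_fm L \<phi>} \<times> lists (((UNIV :: nat set) \<times> sorts L) \<times> A)"
  define sol where "sol = (\<lambda>(x, \<phi>, ps). solutions M x (\<phi>, the \<circ> map_of ps))"
  have P: "small \<kappa> P" unfolding P_def
    by (intro small_Times' small_nat' small_language small_fms small_lists' A)
  \<comment> \<open>Codes with infinitely many solutions contribute the empty set, which keeps every
    member of the union finite and hence small.\<close>
  have "acl L M A \<subseteq> (\<Union>p\<in>P. if finite (sol p) then sol p else {})"
  proof
    fix d assume "d \<in> acl L M A"
    then obtain x \<phi> e where *: "formula_over L M A x (\<phi>, e)" "d \<in> solutions M x (\<phi>, e)"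
      "finite (solutions M x (\<phi>, e))"
      by (rule aclE)
    have "finite (fv \<phi> - {x})" by simp
    then obtain vs where vs: "set vs = fv \<phi> - {x}" using finite_list by blast
    define ps where "ps = map (\<lambda>v. (v, e v)) vs"
    have sol: "sol (x, \<phi>, ps) = solutions M x (\<phi>, e)"
      unfolding sol_def prod.case
      by (rule solutions_cong) (use vs in \<open>simp add: ps_def map_of_map_restrict\<close>)
    have wf: "snd x \<in> sorts L" "wf_fm L \<phi>" "\<And>v. v \<in> fv \<phi> - {x} \<Longrightarrow> e v \<in> A"
      using *(1) by (auto simp: formula_over_def)
    have "v \<in> UNIV \<times> sorts L" if "v \<in> fv \<phi>" for v
      using wf_fv_sorts[OF language wf(2) that] by (simp add: mem_Times_iff)
    then have "ps \<in> lists (((UNIV :: nat set) \<times> sorts L) \<times> A)"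
      using vs wf(3) by (auto simp: ps_def in_lists_conv_set)
    then have "(x, \<phi>, ps) \<in> P" using wf(1,2) by (simp add: P_def mem_Times_iff)
    moreover have "d \<in> (if finite (sol (x, \<phi>, ps)) then sol (x, \<phi>, ps) else {})"
      using *(2,3) by (simp add: sol)
    ultimately show "d \<in> (\<Union>p\<in>P. if finite (sol p) then sol p else {})" by (rule UN_I)
  qed
  moreover have "small \<kappa> (\<Union>p\<in>P. if finite (sol p) then sol p else {})"
    by (rule small_UN'[OF P]) (simp add: small_finite')
  ultimately show ?thesis by (rule small_subset[rotated])
qed

end

section \<open>Independence relations in the big model\<close>

locale model_with_independence =
  big_saturated_model L T M \<kappa> + independence_relation L M \<kappa> indep
  for L :: "('s, 'f, 'r) language" and T :: "('s, 'f, 'r) fm set"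
    and M :: "('s, 'f, 'r, 'm) struct" and \<kappa> :: "'k rel" and indep :: "'m set \<Rightarrow> 'm set \<Rightarrow> 'm set \<Rightarrow> bool"
begin

abbreviation "stab \<equiv> pointwise_stabilizer L M"

lemma stab_automorphism: "g \<in> stab A \<Longrightarrow> g \<in> automorphisms L M"
  and stab_fix: "g \<in> stab A \<Longrightarrow> a \<in> A \<Longrightarrow> g a = a"
  by (simp_all add: pointwise_stabilizer_def)

lemma stab_image: "g \<in> stab A \<Longrightarrow> B \<subseteq> A \<Longrightarrow> g ` B = B"
  using stab_fix[of g A] by force

lemma stab_inv_image: "g \<in> stab A \<Longrightarrow> inv g ` (g ` X) = X" "g \<in> stab A \<Longrightarrow> g ` (inv g ` X) = X"
  using automorphisms_inv_apply[OF stab_automorphism[of g A]] by (simp_all add: image_image)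

lemma stab_acl: "g \<in> stab A \<Longrightarrow> g ` acl L M A = acl L M A"
  using acl_automorphism[OF "structure" stab_automorphism[of g A]] stab_image[of g A A] by simp

lemma indep_mono:
  "indep A C B \<Longrightarrow> small \<kappa> A \<Longrightarrow> small \<kappa> B \<Longrightarrow> small \<kappa> C \<Longrightarrow> A' \<subseteq> A \<Longrightarrow> B' \<subseteq> B \<Longrightarrow> indep A' C B'"
  by (rule monotonicity)

lemma indep_stab:
  assumes "indep A C B" "g \<in> stab C" "small \<kappa> A" "small \<kappa> B" "small \<kappa> C"
  shows "indep (g ` A) C (g ` B)"
  by (rule invariance[OF assms(3-5,1) stab_automorphism[OF assms(2)]]) (auto simp: stab_image[OF assms(2)])

lemma indep_extend:
  assumes "indep A C B" "B \<subseteq> B'" "small \<kappa> A" "small \<kappa> B'" "small \<kappa> C"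
  obtains g where "g \<in> stab (B \<union> C)" "indep (g ` A) C B'"
proof -
  obtain A' where A': "conjugate_over L M (B \<union> C) A A'" "indep A' C B'"
    using extension[OF assms(3,4,5,1,2)] by blast
  then obtain g where "g \<in> stab (B \<union> C)" "g ` A = A'"
    unfolding conjugate_over_def pointwise_stabilizer_def by blast
  then show ?thesis using that A'(2) by blast
qed

text \<open>Extension moves \<open>A\<close> by an automorphism over \<open>BC\<close>. Undoing that
  automorphism restores \<open>A\<close>, and by invariance it leaves \<open>B'\<close> in
  place.\<close>

lemma indep_invariant_right:
  assumes "indep A C B" "B \<subseteq> B'" "small \<kappa> A" "small \<kappa> B'" "small \<kappa> C"
    and inv: "\<And>g. g \<in> stab (B \<union> C) \<Longrightarrow> g ` B' = B'"
  shows "indep A C B'"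
proof -
  obtain g where g: "g \<in> stab (B \<union> C)" "indep (g ` A) C B'" using indep_extend[OF assms(1-5)] .
  let ?h = "inv g"
  have h: "?h \<in> stab (B \<union> C)" by (rule pointwise_stabilizer_inv[OF g(1)])
  then have "?h \<in> stab C" using pointwise_stabilizer_mono[of C "B \<union> C" L M] by blast
  then have "indep (?h ` (g ` A)) C (?h ` B')"
    by (rule indep_stab[OF g(2)]) (use assms(3-5) small_image in auto)
  then show ?thesis using inv[OF h] stab_inv_image(1)[OF g(1)] by simp
qed

lemma indep_right_base:
  assumes "indep A C B" "small \<kappa> A" "small \<kappa> B" "small \<kappa> C"
  shows "indep A C (B \<union> C)"
  by (rule indep_invariant_right[OF assms(1)]) (use assms stab_image in \<open>auto intro: small_Un'\<close>)

lemma indep_right_acl: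
  assumes "indep A C B" "small \<kappa> A" "small \<kappa> B" "small \<kappa> C"
  shows "indep A C (acl L M (B \<union> C))"
proof (rule indep_invariant_right[OF assms(1)])
  show "B \<subseteq> acl L M (B \<union> C)" using acl_extensive[of "B \<union> C"] by blast
  show "small \<kappa> (acl L M (B \<union> C))" using assms by (intro small_acl small_Un')
  show "g ` acl L M (B \<union> C) = acl L M (B \<union> C)" if "g \<in> stab (B \<union> C)" for g
    using that by (rule stab_acl)
qed (use assms in auto)

text \<open>The axiom wants the larger base inside the right-hand set, so \<open>D\<close> is added
  there beforehand.\<close>

lemma indep_base_mono:
  assumes "indep A D (E \<union> B)" "small \<kappa> A" "small \<kappa> B" "small \<kappa> D" "small \<kappa> E"
  shows "indep A (D \<union> E) B"
proof -
  have s: "small \<kappa> (E \<union> B)" "small \<kappa> (E \<union> B \<union> D)" "small \<kappa> (D \<union> E)" using assms by (auto intro: small_Un')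
  have "indep A D (E \<union> B \<union> D)" by (rule indep_right_base[OF assms(1,2) s(1) assms(4)])
  then have "indep A (D \<union> E) (E \<union> B \<union> D)"
    by (rule base_monotonicity[OF assms(2) s(2), rotated 2]) auto
  then show ?thesis by (rule indep_mono) (use assms s in auto)
qed

text \<open>The axiom speaks of nested sets; normality adjoins the bases on the left to produce the
  nesting.\<close>

lemma indep_transitive_left:
  assumes "indep X (D \<union> Y) Z" "indep Y D Z" "small \<kappa> X" "small \<kappa> Y" "small \<kappa> Z" "small \<kappa> D"
  shows "indep (X \<union> Y) D Z"
proof -
  have s: "small \<kappa> (D \<union> Y)" "small \<kappa> (Y \<union> D)" "small \<kappa> (X \<union> (D \<union> Y))"
    using assms by (auto intro: small_Un')
  have "indep (X \<union> (D \<union> Y)) (D \<union> Y) Z" by (rule normality[OF assms(3,5) s(1) assms(1)])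
  moreover have "indep (D \<union> Y) D Z" using normality[OF assms(4,5,6,2)] by (simp add: Un_commute)
  ultimately have "indep (X \<union> (D \<union> Y)) D Z"
    by (intro transitivity[OF assms(5) s(3), of D "D \<union> Y"]) auto
  then show ?thesis by (rule indep_mono) (use assms s in auto)
qed

text \<open>Local character supplies some base inside \<open>B\<close>, and base monotonicity
  enlarges it to \<open>B\<close>.\<close>

lemma indep_existence:
  assumes "small \<kappa> A" "small \<kappa> B"
  shows "indep A B B"
proof -
  obtain C where C: "C \<subseteq> B" "indep A C B" using local_character[OF assms(1)] assms(2) by blast
  then show ?thesis using base_monotonicity[OF assms C(1) order.refl C(2)] by blast
qed

section \<open>Long sequences and symmetry\<close>

lemma indep_union_below:
  assumes r: "Well_order r" and \<alpha>: "S \<subseteq> Field r" and "indep {} C B"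
    and *: "\<And>\<mu>. \<mu> \<in> S \<Longrightarrow> indep ((\<Union>\<beta>\<in>underS r \<mu>. X \<beta>) \<union> X \<mu>) C B"
    and sm: "small \<kappa> (\<Union>\<beta>\<in>S. X \<beta>)" "\<And>\<mu>. \<mu> \<in> S \<Longrightarrow> small \<kappa> ((\<Union>\<beta>\<in>underS r \<mu>. X \<beta>) \<union> X \<mu>)"
      "small \<kappa> B" "small \<kappa> C"
  shows "indep (\<Union>\<beta>\<in>S. X \<beta>) C B"
proof (rule finite_character[OF sm(1,3,4)])
  fix A0 assume A0: "A0 \<subseteq> (\<Union>\<beta>\<in>S. X \<beta>)" "finite A0"
  show "indep A0 C B"
  proof (cases "A0 = {}")
    case False
    have "\<forall>a. \<exists>\<beta>. a \<in> A0 \<longrightarrow> \<beta> \<in> S \<and> a \<in> X \<beta>" using A0(1) by blast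
    from choice[OF this] obtain i where i: "\<And>a. a \<in> A0 \<Longrightarrow> i a \<in> S \<and> a \<in> X (i a)" by blast
    have "finite (i ` A0)" "i ` A0 \<noteq> {}" "i ` A0 \<subseteq> Field r" using A0(2) False i \<alpha> by auto
    from finite_max_in_Well_order[OF r this] obtain \<mu> where
      \<mu>: "\<mu> \<in> i ` A0" "i ` A0 \<subseteq> insert \<mu> (underS r \<mu>)" by blast
    have "\<mu> \<in> S" using \<mu>(1) i by blast
    moreover have "A0 \<subseteq> (\<Union>\<beta>\<in>underS r \<mu>. X \<beta>) \<union> X \<mu>"
    proof
      fix a assume "a \<in> A0"
      then have "a \<in> X (i a)" "i a \<in> insert \<mu> (underS r \<mu>)" using i \<mu>(2) by auto
      then show "a \<in> (\<Union>\<beta>\<in>underS r \<mu>. X \<beta>) \<union> X \<mu>" by auto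
    qed
    ultimately show ?thesis using indep_mono[OF *, of \<mu> A0 B] sm by blast
  qed (use assms(3) in simp)
qed

text \<open>Local character gives a base with fewer than |K| elements inside the union of
  \<open>C\<close> and all terms; the indices of these elements lie strictly below some \<alpha>.
  The order depends on \<open>B\<close> alone, so the sequence may be built along it
  afterwards.\<close>

lemma long_sequence_local_character:
  assumes B: "small \<kappa> B"
  obtains r :: "'k set rel" where "Well_order r" "small \<kappa> (Field r)"
    "\<And>C X. small \<kappa> C \<Longrightarrow> (\<And>\<beta>. small \<kappa> (X \<beta>)) \<Longrightarrow>
      \<exists>\<alpha>\<in>Field r. indep B (C \<union> (\<Union>\<beta>\<in>underS r \<alpha>. X \<beta>)) (X \<alpha>)"
proof -
  obtain K :: "'k set" where K: "small \<kappa> K" "\<And>X. small \<kappa> X \<Longrightarrow> \<exists>D\<subseteq>X. |D| <o |K| \<and> indep B D X"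
    using local_character[OF B] by blast
  from long_well_order[OF inaccessible K(1)] obtain r :: "'k set rel" where
    r: "Well_order r" "small \<kappa> (Field r)" "\<And>J. J \<subseteq> Field r \<Longrightarrow> |J| <o |K| \<Longrightarrow> \<exists>\<alpha>\<in>Field r. J \<subseteq> underS r \<alpha>"
    by blast
  have "\<exists>\<alpha>\<in>Field r. indep B (C \<union> (\<Union>\<beta>\<in>underS r \<alpha>. X \<beta>)) (X \<alpha>)"
    if C: "small \<kappa> C" and X: "\<And>\<beta>. small \<kappa> (X \<beta>)" for C X
  proof -
    let ?X = "C \<union> (\<Union>\<beta>\<in>Field r. X \<beta>)"
    have sX: "small \<kappa> ?X" by (intro small_Un' small_UN' C X r(2))
    then obtain D where D: "D \<subseteq> ?X" "|D| <o |K|" "indep B D ?X" using K(2) by blast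
    have "\<forall>d. \<exists>\<beta>. d \<in> D - C \<longrightarrow> \<beta> \<in> Field r \<and> d \<in> X \<beta>" using D(1) by blast
    from choice[OF this] obtain i where i: "\<And>d. d \<in> D - C \<Longrightarrow> i d \<in> Field r \<and> d \<in> X (i d)" by blast
    have "|i ` (D - C)| \<le>o |D|"
      using card_of_image[of i "D - C"] card_of_mono1[of "D - C" D] ordLeq_transitive by blast
    then have "|i ` (D - C)| <o |K|" using D(2) by (rule ordLeq_ordLess_trans)
    moreover have "i ` (D - C) \<subseteq> Field r" using i by blast
    ultimately obtain \<alpha> where \<alpha>: "\<alpha> \<in> Field r" "i ` (D - C) \<subseteq> underS r \<alpha>" using r(3) by blast
    let ?E = "C \<union> (\<Union>\<beta>\<in>underS r \<alpha>. X \<beta>)"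
    have DE: "D \<subseteq> ?E"
    proof
      fix d assume d: "d \<in> D"
      show "d \<in> ?E"
      proof (cases "d \<in> C")
        case False
        then have "d \<in> X (i d)" "i d \<in> underS r \<alpha>" using d i \<alpha>(2) by auto
        then show ?thesis by blast
      qed simp
    qed
    have u: "underS r \<alpha> \<subseteq> Field r" unfolding underS_def Field_def by blast
    then have EX: "?E \<subseteq> ?X" by blast
    have "indep B ?E ?X" by (rule base_monotonicity[OF B sX DE EX D(3)])
    then have "indep B ?E (X \<alpha>)"
      by (rule indep_mono) (use B sX small_subset[OF sX EX] \<alpha>(1) in auto)
    then show ?thesis using \<alpha>(1) by blast
  qed
  with that r(1,2) show ?thesis by blast
qed

text \<open>The new term is obtained by pulling \<open>A\<close> back along the automorphism that conjugates the union
  of the terms chosen so far.\<close>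

lemma independent_sequence:
  fixes r :: "'o rel"
  assumes r: "Well_order r" "small \<kappa> (Field r)" and A: "indep A C B" "small \<kappa> A" "small \<kappa> B" "small \<kappa> C"
  obtains X where "\<And>\<alpha>. \<exists>g\<in>stab (B \<union> C). X \<alpha> = g ` A"
    "\<And>\<alpha>. indep (\<Union>\<beta>\<in>underS r \<alpha>. X \<beta>) C (B \<union> X \<alpha>)"
proof -
  have wf: "wf (r - Id)" using r(1) by (simp add: well_order_on_def)
  have below: "(\<beta>, \<alpha>) \<in> r - Id \<longleftrightarrow> \<beta> \<in> underS r \<alpha>" for \<alpha> \<beta> by (auto simp: underS_def)
  have uF: "underS r \<alpha> \<subseteq> Field r" for \<alpha> unfolding underS_def Field_def by blast
  define P where "P X \<alpha> Y \<longleftrightarrow> (\<exists>g\<in>stab (B \<union> C). Y = g ` A) \<and> indep (\<Union>\<beta>\<in>underS r \<alpha>. X \<beta>) C (B \<union> Y)"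
    for X :: "'o \<Rightarrow> 'm set" and \<alpha> Y
  have "\<exists>X. \<forall>\<alpha>. P X \<alpha> (X \<alpha>)"
  proof (rule dependent_wf_choice[OF wf])
    fix X X' :: "'o \<Rightarrow> 'm set" and \<alpha> Y
    assume "\<And>\<beta>. (\<beta>, \<alpha>) \<in> r - Id \<Longrightarrow> X \<beta> = X' \<beta>"
    then have "(\<Union>\<beta>\<in>underS r \<alpha>. X \<beta>) = (\<Union>\<beta>\<in>underS r \<alpha>. X' \<beta>)" using below by simp
    then show "P X \<alpha> Y = P X' \<alpha> Y" by (simp add: P_def)
  next
    fix \<alpha> X
    assume IH: "\<And>\<beta>. (\<beta>, \<alpha>) \<in> r - Id \<Longrightarrow> P X \<beta> (X \<beta>)"
    let ?U = "\<lambda>\<alpha>. \<Union>\<beta>\<in>underS r \<alpha>. X \<beta>"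
    have X: "\<exists>g\<in>stab (B \<union> C). X \<beta> = g ` A" "indep (?U \<beta>) C (B \<union> X \<beta>)" if "\<beta> \<in> underS r \<alpha>" for \<beta>
      using IH[of \<beta>] below that unfolding P_def by blast+
    have sX: "small \<kappa> (X \<beta>)" if "\<beta> \<in> underS r \<alpha>" for \<beta>
      using X(1)[OF that] small_image[OF A(2)] by auto
    have under: "underS r \<beta> \<subseteq> underS r \<alpha>" if "\<beta> \<in> underS r \<alpha>" for \<beta>
      using underS_incr[of r \<beta> \<alpha>] r(1) that unfolding underS_def well_order_on_def linear_order_on_def
        partial_order_on_def preorder_on_def by blast
    have sU: "small \<kappa> (?U \<beta>)" if "underS r \<beta> \<subseteq> underS r \<alpha>" for \<beta>
      by (rule small_UN'[OF small_subset[OF r(2) uF]]) (use sX that in blast)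
    \<comment> \<open>Independence of the whole segment from \<open>B\<close> is what extension will
      be applied to; finite character reduces it to the part up to a single index
      \<open>\<mu>\<close>.\<close>
    have U: "indep (?U \<alpha>) C B"
    proof (rule indep_union_below[OF r(1) uF])
      show "indep {} C B" by (rule indep_mono[OF A]) auto
      fix \<mu> assume \<mu>: "\<mu> \<in> underS r \<alpha>"
      show "small \<kappa> (?U \<mu> \<union> X \<mu>)" by (intro small_Un' sU under sX \<mu>)
      \<comment> \<open>The construction at \<open>\<mu>\<close> made the segment independent from
        \<open>B\<close> and \<open>X \<mu>\<close> jointly. Moving \<open>X \<mu>\<close> into the
        base leaves room for transitivity, since \<open>X \<mu>\<close>, as a conjugate of
        \<open>A\<close>, is itself independent from \<open>B\<close>.\<close>
      have "indep (?U \<mu>) C (X \<mu> \<union> B)" using X(2)[OF \<mu>] by (simp add: Un_commute)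
      then have "indep (?U \<mu>) (C \<union> X \<mu>) B"
        by (rule indep_base_mono) (use sU[OF under[OF \<mu>]] sX[OF \<mu>] A in auto)
      moreover obtain g where g: "g \<in> stab (B \<union> C)" "X \<mu> = g ` A" using X(1)[OF \<mu>] by blast
      have "indep (g ` A) C (g ` B)"
        by (rule indep_stab[OF A(1)]) (use g(1) pointwise_stabilizer_mono[of C "B \<union> C" L M] A in auto)
      then have "indep (X \<mu>) C B" using stab_image[OF g(1), of B] g(2) by simp
      ultimately show "indep (?U \<mu> \<union> X \<mu>) C B"
        by (rule indep_transitive_left) (use sU[OF under[OF \<mu>]] sX[OF \<mu>] A in auto)
    qed (use sU A in auto)
    have sBA: "small \<kappa> (B \<union> A)" using A by (intro small_Un')
    have sU\<alpha>: "small \<kappa> (?U \<alpha>)" by (rule sU) simp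
    obtain g where g: "g \<in> stab (B \<union> C)" "indep (g ` ?U \<alpha>) C (B \<union> A)"
      by (rule indep_extend[OF U Un_upper1 sU\<alpha> sBA A(4)])
    have h: "inv g \<in> stab (B \<union> C)" by (rule pointwise_stabilizer_inv[OF g(1)])
    then have "inv g \<in> stab C" using pointwise_stabilizer_mono[of C "B \<union> C" L M] by blast
    then have "indep (inv g ` (g ` ?U \<alpha>)) C (inv g ` (B \<union> A))"
      by (rule indep_stab[OF g(2)]) (use sU\<alpha> sBA A small_image in auto)
    moreover have "inv g ` (B \<union> A) = B \<union> inv g ` A" using stab_image[OF h, of B] by (simp add: image_Un)
    ultimately have "P X \<alpha> (inv g ` A)"
      unfolding P_def using h stab_inv_image(1)[OF g(1)] by auto
    then show "\<exists>Y. P X \<alpha> Y" ..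
  qed
  then obtain X where "\<And>\<alpha>. P X \<alpha> (X \<alpha>)" by blast
  with that show ?thesis unfolding P_def by blast
qed

text \<open>Let \<open>U\<close> be the initial segment at the index found by local character. Then
  \<open>B\<close> is independent from \<open>X \<alpha>\<close> over \<open>CU\<close>, and
  \<open>U\<close> is independent from \<open>X \<alpha>\<close> over \<open>C\<close> by
  construction. Transitivity on the left removes \<open>U\<close>, and \<open>X \<alpha>\<close> is
  conjugate to \<open>A\<close> over \<open>BC\<close>.\<close>

theorem indep_sym:
  assumes A: "indep A C B" "small \<kappa> A" "small \<kappa> B" "small \<kappa> C"
  shows "indep B C A"
proof -
  from long_sequence_local_character[OF A(3)] obtain r :: "'k set rel" where
    r: "Well_order r" "small \<kappa> (Field r)"
      "\<And>C X. small \<kappa> C \<Longrightarrow> (\<And>\<beta>. small \<kappa> (X \<beta>)) \<Longrightarrow>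
        \<exists>\<alpha>\<in>Field r. indep B (C \<union> (\<Union>\<beta>\<in>underS r \<alpha>. X \<beta>)) (X \<alpha>)"
    by metis
  from independent_sequence[OF r(1,2) A] obtain X where
    X: "\<And>\<alpha>. \<exists>g\<in>stab (B \<union> C). X \<alpha> = g ` A" "\<And>\<alpha>. indep (\<Union>\<beta>\<in>underS r \<alpha>. X \<beta>) C (B \<union> X \<alpha>)"
    by blast
  have sX: "small \<kappa> (X \<alpha>)" for \<alpha> using X(1)[of \<alpha>] small_image[OF A(2)] by auto
  obtain \<alpha> where \<alpha>: "indep B (C \<union> (\<Union>\<beta>\<in>underS r \<alpha>. X \<beta>)) (X \<alpha>)" using r(3)[OF A(4), of X, OF sX] by blast
  have uF: "underS r \<alpha> \<subseteq> Field r" unfolding underS_def Field_def by blast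
  have sU: "small \<kappa> (\<Union>\<beta>\<in>underS r \<alpha>. X \<beta>)" by (rule small_UN'[OF small_subset[OF r(2) uF] sX])
  have "indep (\<Union>\<beta>\<in>underS r \<alpha>. X \<beta>) C (X \<alpha>)"
    by (rule indep_mono[OF X(2)[of \<alpha>] sU]) (use A sX in \<open>auto intro: small_Un'\<close>)
  with \<alpha> have "indep (B \<union> (\<Union>\<beta>\<in>underS r \<alpha>. X \<beta>)) C (X \<alpha>)"
    by (rule indep_transitive_left) (use A sX sU in auto)
  then have *: "indep B C (X \<alpha>)"
    by (rule indep_mono) (use A sX sU in \<open>auto intro: small_Un'\<close>)
  obtain g where g: "g \<in> stab (B \<union> C)" "X \<alpha> = g ` A" using X(1) by blast
  have h: "inv g \<in> stab (B \<union> C)" by (rule pointwise_stabilizer_inv[OF g(1)])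
  have "indep (inv g ` B) C (inv g ` X \<alpha>)"
    by (rule indep_stab[OF *]) (use h pointwise_stabilizer_mono[of C "B \<union> C" L M] A sX in auto)
  then show ?thesis using stab_image[OF h, of B] stab_inv_image(1)[OF g(1)] g(2) by simp
qed

end

section \<open>Consequences of symmetry\<close>

context model_with_independence
begin

lemma indep_transitive_right:
  assumes "indep X D B" "indep X B Y" "D \<subseteq> B" "small \<kappa> X" "small \<kappa> B" "small \<kappa> Y"
  shows "indep X D (Y \<union> B)"
proof -
  have sD: "small \<kappa> D" using assms(3,5) small_subset by blast
  have "indep Y (D \<union> B) X" using indep_sym[OF assms(2,4,6,5)] assms(3) by (simp add: Un_absorb1)
  then have "indep (Y \<union> B) D X"
    by (rule indep_transitive_left) (use indep_sym[OF assms(1,4,5) sD] assms sD in auto)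
  then show ?thesis by (rule indep_sym) (use assms sD in \<open>auto intro: small_Un'\<close>)
qed

text \<open>A base \<open>D\<close> that works for each single term works for whole segments.
  Transitivity on the right makes \<open>X \<mu>\<close> independent from \<open>B\<close> and the
  preceding segment over \<open>D\<close>; with that segment moved into the base, the induction
  hypothesis and transitivity on the left apply.\<close>

lemma indep_sequence_smaller_base:
  fixes r :: "'o rel"
  assumes r: "Well_order r" "small \<kappa> (Field r)" and sX: "\<And>\<beta>. small \<kappa> (X \<beta>)"
    and B: "small \<kappa> B" and DB: "D \<subseteq> B"
    and seq: "\<And>\<beta>. indep (\<Union>\<gamma>\<in>underS r \<beta>. X \<gamma>) B (X \<beta>)" and D: "\<And>\<beta>. indep (X \<beta>) D B"
  shows "indep (\<Union>\<gamma>\<in>underS r \<alpha>. X \<gamma>) D B"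
proof -
  let ?U = "\<lambda>\<alpha>. \<Union>\<beta>\<in>underS r \<alpha>. X \<beta>"
  have uF: "underS r \<alpha> \<subseteq> Field r" for \<alpha> unfolding underS_def Field_def by blast
  have sU: "small \<kappa> (?U \<alpha>)" for \<alpha> by (rule small_UN'[OF small_subset[OF r(2) uF] sX])
  have sD: "small \<kappa> D" by (rule small_subset[OF B DB])
  have wf: "wf (r - Id)" using r(1) by (simp add: well_order_on_def)
  show ?thesis
  proof (induction \<alpha> rule: wf_induct_rule[OF wf])
    case (1 \<alpha>)
    show ?case
    proof (rule indep_union_below[OF r(1) uF])
      show "indep {} D B" by (rule indep_mono[OF D sX B sD]) auto
      fix \<mu> assume "\<mu> \<in> underS r \<alpha>"
      then have "(\<mu>, \<alpha>) \<in> r - Id" by (auto simp: underS_def)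
      then have IH: "indep (?U \<mu>) D B" by (rule 1)
      have "indep (X \<mu>) B (?U \<mu>)" by (rule indep_sym[OF seq sU sX B])
      with D have "indep (X \<mu>) D (?U \<mu> \<union> B)" by (rule indep_transitive_right[OF _ _ DB sX B sU])
      then have "indep (X \<mu>) (D \<union> ?U \<mu>) B" by (rule indep_base_mono[OF _ sX B sD sU])
      then have "indep (X \<mu> \<union> ?U \<mu>) D B" using IH by (rule indep_transitive_left[OF _ _ sX sU B sD])
      then show "indep (?U \<mu> \<union> X \<mu>) D B" by (simp add: Un_commute)
    qed (use sU sX B sD in \<open>auto intro: small_Un'\<close>)
  qed
qed

end

section \<open>Anti-reflexivity and the intersection property\<close>

locale model_with_strict_independence =
  model_with_independence L T M \<kappa> indep + strict_independence_relation L M \<kappa> indep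
  for L :: "('s, 'f, 'r) language" and T :: "('s, 'f, 'r) fm set"
    and M :: "('s, 'f, 'r, 'm) struct" and \<kappa> :: "'k rel" and indep :: "'m set \<Rightarrow> 'm set \<Rightarrow> 'm set \<Rightarrow> bool"
begin

text \<open>Anti-reflexivity needs \<open>d\<close> on both sides, but closure under
  \<open>acl\<close> is available only on the right. So one side is closed and cut down to
  \<open>d\<close>, symmetry swaps the sides, and the other is closed.\<close>

lemma indep_acl_Int:
  assumes "indep X D Y" "small \<kappa> X" "small \<kappa> Y" "small \<kappa> D"
  shows "acl L M X \<inter> acl L M Y \<subseteq> acl L M D"
proof
  fix d assume d: "d \<in> acl L M X \<inter> acl L M Y"
  have s: "small \<kappa> {d}" by (simp add: small_finite')
  have sa: "small \<kappa> (acl L M (Y \<union> D))" "small \<kappa> (acl L M (X \<union> D))"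
    using assms by (auto intro: small_acl small_Un')
  have dX: "d \<in> acl L M (X \<union> D)" and dY: "d \<in> acl L M (Y \<union> D)"
    using d acl_mono[of X "X \<union> D" L M] acl_mono[of Y "Y \<union> D" L M] by auto
  have "indep X D (acl L M (Y \<union> D))" by (rule indep_right_acl[OF assms])
  then have "indep X D {d}" by (rule indep_mono) (use assms sa dY in auto)
  then have "indep {d} D X" by (rule indep_sym[OF _ assms(2) s assms(4)])
  then have "indep {d} D (acl L M (X \<union> D))" by (rule indep_right_acl[OF _ s assms(2,4)])
  then have "indep {d} D {d}" by (rule indep_mono) (use assms sa s dX in auto)
  then show "d \<in> acl L M D" by (rule anti_reflexivity[OF assms(4)])
qed

text \<open>The closures of both given bases are candidates over \<open>acl L M B\<close>, so the
  least one lies in their intersection, and base monotonicity enlarges it to that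
  intersection.\<close>

lemma canonical_if_weak_canonical_bases:
  assumes wcb: "has_weak_canonical_bases L M \<kappa> indep"
  shows "canonical_independence_relation L M \<kappa> indep"
proof unfold_locales
  fix A B C\<^sub>1 C\<^sub>2
  assume s: "small \<kappa> A" "small \<kappa> B" and C: "C\<^sub>1 \<subseteq> B" "C\<^sub>2 \<subseteq> B" "indep A C\<^sub>1 B" "indep A C\<^sub>2 B"
  let ?B = "acl L M B" and ?E = "acl L M C\<^sub>1 \<inter> acl L M C\<^sub>2"
  have sB: "small \<kappa> ?B" and B: "acl L M ?B = ?B" by (rule small_acl[OF s(2)], rule acl_idempotent[OF s(2)])
  have acl_base: "acl L M C \<subseteq> ?B" "acl L M (acl L M C) = acl L M C" "indep A (acl L M C) ?B"
    if "C \<subseteq> B" "indep A C B" for C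
  proof -
    have sC: "small \<kappa> C" by (rule small_subset[OF s(2) that(1)])
    show CB: "acl L M C \<subseteq> ?B" by (rule acl_mono[OF that(1)])
    show "acl L M (acl L M C) = acl L M C" by (rule acl_idempotent[OF sC])
    have "indep A C ?B" using indep_right_acl[OF that(2) s sC] that(1) by (simp add: Un_absorb2)
    then show "indep A (acl L M C) ?B" by (rule base_monotonicity[OF s(1) sB acl_extensive CB])
  qed
  \<comment> \<open>\<open>inv_into A a\<close> then lists \<open>A\<close> as a tuple indexed by
    codes in \<open>'k\<close>.\<close>
  obtain a :: "'m \<Rightarrow> 'k" where a: "inj_on a A" "small \<kappa> (a ` A)"
    using small_code[OF inaccessible_facts(1)[OF inaccessible] s(1)] .
  have "small \<kappa> (a ` A) \<and> small \<kappa> ?B \<and> acl L M ?B = ?B \<longrightarrow>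
      (\<exists>C. weak_canonical_base L M indep (inv_into A a) (a ` A) ?B C)"
    using wcb unfolding has_weak_canonical_bases_def by (elim allE)
  from mp[OF this conjI[OF a(2) conjI[OF sB B]]] obtain C where
    C': "weak_canonical_base L M indep (inv_into A a) (a ` A) ?B C"
    by (elim exE)
  have "inv_into A a ` (a ` A) = A" by (rule inv_into_image_cancel[OF a(1) order.refl])
  with C' have base: "C \<subseteq> ?B" "indep A C ?B"
    and least: "\<And>D. D \<subseteq> ?B \<Longrightarrow> acl L M D = D \<Longrightarrow> indep A D ?B \<Longrightarrow> C \<subseteq> D"
    unfolding weak_canonical_base_def by simp_all
  have "C \<subseteq> acl L M C\<^sub>1" by (rule least; rule acl_base[OF C(1,3)])
  moreover have "C \<subseteq> acl L M C\<^sub>2" by (rule least; rule acl_base[OF C(2,4)])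
  ultimately have "C \<subseteq> ?E" by simp
  moreover have "?E \<subseteq> ?B" using acl_base(1)[OF C(1,3)] by blast
  ultimately have "indep A ?E ?B" using base(2) by (rule base_monotonicity[OF s(1) sB])
  then show "indep A ?E B"
    by (rule indep_mono) (use s sB small_subset[OF sB \<open>?E \<subseteq> ?B\<close>] acl_extensive in auto)
qed

end

section \<open>Weak canonical bases of a canonical relation\<close>

locale model_with_canonical_independence =
  model_with_strict_independence L T M \<kappa> indep + canonical_independence_relation L M \<kappa> indep
  for L :: "('s, 'f, 'r) language" and T :: "('s, 'f, 'r) fm set"
    and M :: "('s, 'f, 'r, 'm) struct" and \<kappa> :: "'k rel" and indep :: "'m set \<Rightarrow> 'm set \<Rightarrow> 'm set \<Rightarrow> bool"
begin

lemma acl_Int_closed: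
  assumes "small \<kappa> E" "acl L M B = B"
  shows "acl L M (acl L M E \<inter> B) = acl L M E \<inter> B"
proof
  show "acl L M (acl L M E \<inter> B) \<subseteq> acl L M E \<inter> B"
    using acl_mono[of "acl L M E \<inter> B" "acl L M E" L M] acl_mono[of "acl L M E \<inter> B" B L M]
      acl_idempotent[OF assms(1)] assms(2) by blast
qed (rule acl_extensive)

text \<open>After symmetry, both \<open>E\<close> and \<open>B\<close> are bases for
  \<open>Y\<close> inside the union of \<open>B\<close> and \<open>E\<close>, so the intersection
  property applies. The hypotheses have the orientation in which local character and the sequences
  deliver them.\<close>

lemma indep_over_acl_Int:
  assumes "indep B E Y" "indep E B Y" "small \<kappa> E" "small \<kappa> B" "small \<kappa> Y" "acl L M B = B"
  shows "indep Y (acl L M E \<inter> B) B"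
proof -
  have "indep Y E (B \<union> E)" "indep Y B (B \<union> E)"
    using indep_right_base[OF indep_sym[OF assms(1,4,5,3)] assms(5,4,3)]
      indep_right_base[OF indep_sym[OF assms(2,3,5,4)] assms(5,3,4)] by (simp_all add: Un_commute)
  then have "indep Y (acl L M E \<inter> acl L M B) (B \<union> E)"
    using intersection[OF assms(5), of "B \<union> E" E B] small_Un'[OF assms(4,3)] by blast
  then have "indep Y (acl L M E \<inter> B) (B \<union> E)" unfolding assms(6) .
  then show ?thesis
    by (rule indep_mono)
      (use assms small_Un'[OF assms(4,3)] small_subset[of \<kappa> B "acl L M E \<inter> B"] in auto)
qed

lemma indep_stab_pull_back:
  assumes "indep (g ` A) C B" "g \<in> stab B" "C \<subseteq> B" "small \<kappa> A" "small \<kappa> B"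
  shows "indep A C B"
proof -
  have h: "inv g \<in> stab B" by (rule pointwise_stabilizer_inv[OF assms(2)])
  then have "inv g \<in> stab C" using pointwise_stabilizer_mono[OF assms(3)] by blast
  then have "indep (inv g ` (g ` A)) C (inv g ` B)"
    by (rule indep_stab[OF assms(1)]) (use assms(3-5) small_image small_subset in auto)
  then show ?thesis using stab_image[OF h, of B] stab_inv_image(1)[OF assms(2)] by simp
qed

theorem weak_canonical_base_exists:
  assumes I: "small \<kappa> I" and B: "small \<kappa> B" "acl L M B = B"
  shows "\<exists>C. weak_canonical_base L M indep a I B C"
proof -
  let ?A = "a ` I"
  have A: "small \<kappa> ?A" using I by (rule small_image)
  from long_sequence_local_character[OF B(1)] obtain r :: "'k set rel" where
    r: "Well_order r" "small \<kappa> (Field r)"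
      "\<And>C X. small \<kappa> C \<Longrightarrow> (\<And>\<beta>. small \<kappa> (X \<beta>)) \<Longrightarrow>
        \<exists>\<alpha>\<in>Field r. indep B (C \<union> (\<Union>\<beta>\<in>underS r \<alpha>. X \<beta>)) (X \<alpha>)"
    by metis
  \<comment> \<open>The trivial independence of \<open>?A\<close> from \<open>B\<close> over
    \<open>B\<close> starts the sequence.\<close>
  from independent_sequence[OF r(1,2) indep_existence[OF A B(1)] A B(1) B(1), unfolded Un_absorb] obtain X where
    X: "\<And>\<alpha>. \<exists>g\<in>stab B. X \<alpha> = g ` ?A" "\<And>\<alpha>. indep (\<Union>\<beta>\<in>underS r \<alpha>. X \<beta>) B (B \<union> X \<alpha>)"
    by blast
  have sX: "small \<kappa> (X \<alpha>)" for \<alpha> using X(1)[of \<alpha>] small_image[OF A] by auto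
  have uF: "underS r \<alpha> \<subseteq> Field r" for \<alpha> unfolding underS_def Field_def by blast
  have sU: "small \<kappa> (\<Union>\<beta>\<in>underS r \<alpha>. X \<beta>)" for \<alpha> by (rule small_UN'[OF small_subset[OF r(2) uF] sX])
  have seq: "indep (\<Union>\<beta>\<in>underS r \<alpha>. X \<beta>) B (X \<alpha>)" for \<alpha>
    by (rule indep_mono[OF X(2)[of \<alpha>] sU]) (use B sX in \<open>auto intro: small_Un'\<close>)
  \<comment> \<open>The initial base is empty here: if \<open>E\<close> contained \<open>B\<close>,
    intersecting its closure with \<open>B\<close> would give back all of \<open>B\<close>.\<close>
  obtain \<alpha> where "indep B ({} \<union> (\<Union>\<beta>\<in>underS r \<alpha>. X \<beta>)) (X \<alpha>)"
    using r(3)[OF small_finite'[OF finite.emptyI], of X, OF sX] by (elim bexE)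
  then have \<alpha>: "indep B (\<Union>\<beta>\<in>underS r \<alpha>. X \<beta>) (X \<alpha>)" by simp
  define E where "E = (\<Union>\<beta>\<in>underS r \<alpha>. X \<beta>)"
  define C where "C = acl L M E \<inter> B"
  have sE: "small \<kappa> E" unfolding E_def by (rule sU)
  have CB: "C \<subseteq> B" by (simp add: C_def)
  obtain g where g: "g \<in> stab B" "X \<alpha> = g ` ?A" using X(1) by blast
  have "indep (X \<alpha>) C B" unfolding C_def
    by (rule indep_over_acl_Int[OF \<alpha>[folded E_def] seq[of \<alpha>, folded E_def] sE B(1) sX B(2)])
  then have AC: "indep ?A C B" unfolding g(2) by (rule indep_stab_pull_back[OF _ g(1) CB A B(1)])
  \<comment> \<open>Independence from the empty set, extended on the right to \<open>E\<close>,
    provides a copy of \<open>E\<close> over \<open>B\<close> that is independent from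
    \<open>E\<close> itself.\<close>
  have "indep E B {}" unfolding E_def
    by (rule indep_mono[OF seq sU sX B(1)]) auto
  then obtain h where h: "h \<in> stab ({} \<union> B)" "indep (h ` E) B E"
    by (rule indep_extend) (use sE B in auto)
  have sE': "small \<kappa> (h ` E)" using sE by (rule small_image)
  have EE': "indep E B (h ` E)" by (rule indep_sym[OF h(2) sE' sE B(1)])
  have "C \<subseteq> D" if D: "D \<subseteq> B" "acl L M D = D" "indep ?A D B" for D
  proof
    fix c assume c: "c \<in> C"
    have sD: "small \<kappa> D" by (rule small_subset[OF B(1) D(1)])
    have XD: "indep (X \<beta>) D B" for \<beta>
    proof -
      obtain k where k: "k \<in> stab B" "X \<beta> = k ` ?A" using X(1) by blast
      have "k \<in> stab D" using k(1) pointwise_stabilizer_mono[OF D(1), of L M] by blast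
      then have "indep (k ` ?A) D (k ` B)" by (rule indep_stab[OF D(3) _ A B(1) sD])
      then show ?thesis using k stab_image[OF k(1), of B] by simp
    qed
    \<comment> \<open>The candidate \<open>D\<close> is a base for each term, hence for the segment
      \<open>E\<close>, and transitivity then separates \<open>E\<close> from its copy over
      \<open>D\<close>. Elements of \<open>C\<close> are fixed by \<open>h\<close>, so they are
      algebraic over both copies.\<close>
    have "indep E D B" unfolding E_def
      by (rule indep_sequence_smaller_base[OF r(1,2) sX B(1) D(1) seq XD])
    then have "indep E D (h ` E \<union> B)" using EE' by (rule indep_transitive_right[OF _ _ D(1) sE B(1) sE'])
    then have "indep E D (h ` E)"
      by (rule indep_mono) (use sE sE' B sD in \<open>auto intro: small_Un'\<close>)
    then have "acl L M E \<inter> acl L M (h ` E) \<subseteq> D" using indep_acl_Int[OF _ sE sE' sD] D(2) by simp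
    moreover have "c \<in> acl L M (h ` E)"
    proof -
      have "h c \<in> h ` acl L M E" using c by (auto simp: C_def)
      moreover have "h c = c" using stab_fix[OF h(1)] c by (simp add: C_def)
      ultimately show ?thesis using acl_automorphism[OF "structure" stab_automorphism[OF h(1)]] by metis
    qed
    ultimately show "c \<in> D" using c by (auto simp: C_def)
  qed
  then have "weak_canonical_base L M indep a I B C"
    unfolding weak_canonical_base_def using CB AC acl_Int_closed[OF sE B(2)] by (auto simp: C_def)
  then show ?thesis ..
qed

end

section \<open>Morley sequences and the algebraic kernel\<close>

lemma tp_restrict_parameters:
  assumes "B' \<subseteq> B"
  shows "tp L M a J B' = {p \<in> tp L M a J B. \<forall>v\<in>fv (fst p). snd p v \<in> J <+> B'}"
proof -
  have "J <+> B' \<subseteq> J <+> B" using assms by auto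
  then show ?thesis unfolding tp_def by auto
qed

lemma indiscernible_subset:
  fixes s :: "'o::linorder \<Rightarrow> 'i \<Rightarrow> 'm"
  assumes s: "indiscernible L M s I B" and B': "B' \<subseteq> B"
  shows "indiscernible L M s I B'"
  unfolding indiscernible_def tp_restrict_parameters[OF B']
proof (intro allI impI)
  fix n :: nat and f g :: "nat \<Rightarrow> 'o"
  assume "strict_mono_on {..<n} f \<and> strict_mono_on {..<n} g"
  then have "tp L M (\<lambda>(k, i). s (f k) i) ({..<n} \<times> I) B = tp L M (\<lambda>(k, i). s (g k) i) ({..<n} \<times> I) B"
    using s unfolding indiscernible_def by blast
  then show "{p \<in> tp L M (\<lambda>(k, i). s (f k) i) ({..<n} \<times> I) B.
        \<forall>v\<in>fv (fst p). snd p v \<in> ({..<n} \<times> I) <+> B'} =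
      {p \<in> tp L M (\<lambda>(k, i). s (g k) i) ({..<n} \<times> I) B.
        \<forall>v\<in>fv (fst p). snd p v \<in> ({..<n} \<times> I) <+> B'}"
    by simp
qed

context big_saturated_model
begin

lemma tp_eq_conjugate:
  assumes tp: "tp L M a I B = tp L M b I B" and sm: "small \<kappa> I" "small \<kappa> B"
  obtains g where "g \<in> pointwise_stabilizer L M B" "\<And>i. i \<in> I \<Longrightarrow> g (a i) = b i"
proof -
  have "{(a i, b i) |i. i \<in> I} = (\<lambda>i. (a i, b i)) ` I" "Id_on B = (\<lambda>b. (b, b)) ` B"
    by (auto simp: Id_on_def)
  then have "small \<kappa> ({(a i, b i) |i. i \<in> I} \<union> Id_on B)"
    by (simp only:) (intro small_Un' small_image sm)
  with elementary_tp[OF tp language "structure"] obtain g where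
    g: "g \<in> automorphisms L M" "\<forall>(x, y)\<in>{(a i, b i) |i. i \<in> I} \<union> Id_on B. g x = y"
    by (rule homogeneity[THEN bexE])
  have "g x = y" if "(x, y) \<in> {(a i, b i) |i. i \<in> I} \<union> Id_on B" for x y
    using bspec[OF g(2) that] by simp
  then have "g (a i) = b i" if "i \<in> I" for i using that by blast
  moreover have "g x = x" if "x \<in> B" for x
    using \<open>\<And>x y. (x, y) \<in> _ \<Longrightarrow> g x = y\<close>[of x x] that by blast
  ultimately show ?thesis using g(1) by (intro that[of g]) (simp_all add: pointwise_stabilizer_def)
qed

text \<open>A finite part of the shift involves only the first \<open>k\<close> terms, for some
  \<open>k\<close>; there it compares the increasing index tuples given by the identity and by
  \<open>u\<close>. Homogeneity turns the elementary map into an automorphism.\<close>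

lemma indiscernible_shift:
  fixes s :: "nat \<Rightarrow> 'i \<Rightarrow> 'm" and u :: "nat \<Rightarrow> nat"
  assumes s: "indiscernible L M s I B" and sm: "small \<kappa> I" "small \<kappa> B" and u: "strict_mono u"
  obtains \<sigma> where "\<sigma> \<in> pointwise_stabilizer L M B" "\<And>n i. i \<in> I \<Longrightarrow> \<sigma> (s n i) = s (u n) i"
proof -
  define G where "G n = (\<lambda>i. (s n i, s (u n) i)) ` I" for n
  let ?G = "(\<Union>n. G n) \<union> Id_on B"
  have "elementary L M ?G"
  proof (rule elementary_finite)
    fix F assume F: "F \<subseteq> ?G" "finite F"
    have "\<forall>p. \<exists>n. p \<in> F \<longrightarrow> p \<in> G n \<union> Id_on B" using F(1) by blast
    from choice[OF this] obtain n where n: "\<And>p. p \<in> F \<Longrightarrow> p \<in> G (n p) \<union> Id_on B" by blast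
    have "finite (n ` F)" using F(2) by simp
    then obtain k where k: "\<And>p. p \<in> F \<Longrightarrow> n p < k" by (auto simp: finite_nat_set_iff_bounded)
    have "strict_mono_on {..<k} (\<lambda>j. j)" "strict_mono_on {..<k} u"
      using u by (auto simp: strict_mono_on_def strict_mono_def)
    then have "tp L M (\<lambda>(j, i). s j i) ({..<k} \<times> I) B = tp L M (\<lambda>(j, i). s (u j) i) ({..<k} \<times> I) B"
      using s[unfolded indiscernible_def, rule_format, of k "\<lambda>j. j" u] by simp
    from elementary_tp[OF this language "structure"]
    show "elementary L M F"
    proof (rule elementary_subset, intro subsetI)
      fix p assume p: "p \<in> F"
      then consider i where "i \<in> I" "p = (s (n p) i, s (u (n p)) i)" | "p \<in> Id_on B"
        using n[OF p] unfolding G_def by blast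
      then show "p \<in> {((\<lambda>(j, i). s j i) z, (\<lambda>(j, i). s (u j) i) z) |z. z \<in> {..<k} \<times> I} \<union> Id_on B"
      proof cases
        case 1
        then have "(n p, i) \<in> {..<k} \<times> I" using k[OF p] by simp
        then show ?thesis using 1(2) by (intro UnI1 CollectI exI[of _ "(n p, i)"]) simp
      qed blast
    qed
  qed
  moreover have "Id_on B = (\<lambda>b. (b, b)) ` B" by (auto simp: Id_on_def)
  then have "small \<kappa> ?G" unfolding G_def
    by (simp only:) (intro small_Un' small_UN' small_image sm small_nat')
  ultimately obtain g where g: "g \<in> automorphisms L M" "\<forall>(x, y)\<in>?G. g x = y"
    by (rule homogeneity[THEN bexE])
  have eq: "g x = y" if "(x, y) \<in> ?G" for x y using bspec[OF g(2) that] by simp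
  have "g (s n i) = s (u n) i" if "i \<in> I" for n i by (rule eq) (use that in \<open>auto simp: G_def\<close>)
  moreover have "g x = x" if "x \<in> B" for x by (rule eq) (use that in auto)
  ultimately show ?thesis using g(1) by (intro that[of g]) (simp_all add: pointwise_stabilizer_def)
qed

text \<open>Here \<open>x\<close> is inserted between the terms \<open>X \<beta>\<close> with \<open>\<beta> \<in> S\<close> and the terms of \<open>s\<close>: the
  automorphism takes the extended sequence to a subsequence of the old one.\<close>

definition inserts ::
  "'m set \<Rightarrow> 'i set \<Rightarrow> (nat \<Rightarrow> 'i \<Rightarrow> 'm) \<Rightarrow> ('o \<Rightarrow> 'i \<Rightarrow> 'm) \<Rightarrow> 'o set \<Rightarrow> ('i \<Rightarrow> 'm) \<Rightarrow> bool" where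
  "inserts B I s X S x \<longleftrightarrow> (\<exists>\<tau>\<in>pointwise_stabilizer L M B. \<forall>i\<in>I.
     (\<forall>\<beta>\<in>S. \<tau> (X \<beta> i) = X \<beta> i) \<and> (\<forall>n. \<tau> (s n i) = s (Suc n) i) \<and> \<tau> (x i) = s 0 i)"

text \<open>Finitely many inserted terms can be moved over \<open>B\<close> into \<open>s\<close>
  itself, provided \<open>s\<close> makes room by \<open>N\<close> places. The largest index is
  treated by its own insertion, which fixes all lower terms; the remaining ones follow by
  induction.\<close>

lemma collapse_stretched:
  fixes r :: "'o rel"
  assumes r: "Well_order r" and F: "finite F" "F \<subseteq> Field r"
    and X: "\<And>\<alpha>. \<alpha> \<in> F \<Longrightarrow> inserts B I s X (underS r \<alpha>) (X \<alpha>)"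
  shows "\<exists>\<rho>\<in>pointwise_stabilizer L M B. \<exists>N. (\<forall>\<beta>\<in>F. \<exists>j<N. \<forall>i\<in>I. \<rho> (X \<beta> i) = s j i) \<and>
    (\<forall>n. \<forall>i\<in>I. \<rho> (s n i) = s (N + n) i)"
  using F X
proof (induction F rule: finite_psubset_induct)
  case (psubset F)
  show ?case
  proof (cases "F = {}")
    case True
    have "id \<in> pointwise_stabilizer L M B" by (simp add: pointwise_stabilizer_def automorphisms_id)
    then show ?thesis using True by (intro bexI[of _ id] exI[of _ 0]) auto
  next
    case False
    then obtain \<mu> where \<mu>: "\<mu> \<in> F" "F \<subseteq> insert \<mu> (underS r \<mu>)"
      using finite_max_in_Well_order[OF r psubset.hyps(1) _ psubset.prems(1)] by blast
    have F': "F - {\<mu>} \<subset> F" "F - {\<mu>} \<subseteq> Field r" using \<mu>(1) psubset.prems(1) by auto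
    have "\<And>\<alpha>. \<alpha> \<in> F - {\<mu>} \<Longrightarrow> inserts B I s X (underS r \<alpha>) (X \<alpha>)" using psubset.prems(2) by blast
    from psubset.IH[OF F' this] obtain \<rho> N where \<rho>: "\<rho> \<in> pointwise_stabilizer L M B"
      "\<And>\<beta>. \<beta> \<in> F - {\<mu>} \<Longrightarrow> \<exists>j<N. \<forall>i\<in>I. \<rho> (X \<beta> i) = s j i" "\<And>n i. i \<in> I \<Longrightarrow> \<rho> (s n i) = s (N + n) i"
      by blast
    from psubset.prems(2)[OF \<mu>(1)] obtain \<tau> where \<tau>: "\<tau> \<in> pointwise_stabilizer L M B"
      "\<And>\<beta> i. \<beta> \<in> underS r \<mu> \<Longrightarrow> i \<in> I \<Longrightarrow> \<tau> (X \<beta> i) = X \<beta> i"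
      "\<And>n i. i \<in> I \<Longrightarrow> \<tau> (s n i) = s (Suc n) i" "\<And>i. i \<in> I \<Longrightarrow> \<tau> (X \<mu> i) = s 0 i"
      unfolding inserts_def by blast
    \<comment> \<open>\<open>\<tau>\<close> takes the last inserted term to \<open>s 0\<close>, and
      \<open>\<rho>\<close> takes \<open>s 0\<close> on to \<open>s N\<close>; this is the
      additional place.\<close>
    have "\<exists>j<Suc N. \<forall>i\<in>I. (\<rho> \<circ> \<tau>) (X \<beta> i) = s j i" if \<beta>: "\<beta> \<in> F" for \<beta>
    proof (cases "\<beta> = \<mu>")
      case True
      then show ?thesis using \<tau>(4) \<rho>(3)[of _ 0] by (intro exI[of _ N]) simp
    next
      case False
      then obtain j where "j < N" "\<forall>i\<in>I. \<rho> (X \<beta> i) = s j i" using \<rho>(2) \<beta> by blast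
      then show ?thesis using \<tau>(2)[of \<beta>] \<mu>(2) \<beta> False by (intro exI[of _ j]) auto
    qed
    moreover have "(\<rho> \<circ> \<tau>) (s n i) = s (Suc N + n) i" if "i \<in> I" for n i
      using \<tau>(3)[OF that] \<rho>(3)[OF that] by simp
    ultimately show ?thesis using pointwise_stabilizer_comp[OF \<rho>(1) \<tau>(1)] by blast
  qed
qed

text \<open>The next term is the preimage of \<open>s 0\<close> under an automorphism over
  \<open>B\<close> that fixes the earlier terms and shifts \<open>s\<close> by one. For finitely
  many earlier terms such an automorphism is found by collapsing them into \<open>s\<close>, where
  indiscernibility applies.\<close>

lemma stretched_sequence:
  fixes r :: "'o rel" and s :: "nat \<Rightarrow> 'i \<Rightarrow> 'm"
  assumes r: "Well_order r" "small \<kappa> (Field r)"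
    and s: "indiscernible L M s I B" and sm: "small \<kappa> I" "small \<kappa> B"
  shows "\<exists>X :: 'o \<Rightarrow> 'i \<Rightarrow> 'm. \<forall>\<alpha>. inserts B I s X (underS r \<alpha>) (X \<alpha>)"
proof -
  have wf: "wf (r - Id)" using r(1) by (simp add: well_order_on_def)
  have below: "(\<beta>, \<alpha>) \<in> r - Id \<longleftrightarrow> \<beta> \<in> underS r \<alpha>" for \<alpha> \<beta> by (auto simp: underS_def)
  have uF: "underS r \<alpha> \<subseteq> Field r" for \<alpha> unfolding underS_def Field_def by blast
  show ?thesis
  proof (rule dependent_wf_choice[OF wf])
    fix X X' :: "'o \<Rightarrow> 'i \<Rightarrow> 'm" and \<alpha> x
    assume "\<And>\<beta>. (\<beta>, \<alpha>) \<in> r - Id \<Longrightarrow> X \<beta> = X' \<beta>"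
    then have "X \<beta> = X' \<beta>" if "\<beta> \<in> underS r \<alpha>" for \<beta> using that below by blast
    then show "inserts B I s X (underS r \<alpha>) x = inserts B I s X' (underS r \<alpha>) x"
      by (simp add: inserts_def)
  next
    fix \<alpha> and X :: "'o \<Rightarrow> 'i \<Rightarrow> 'm"
    assume IH: "\<And>\<beta>. (\<beta>, \<alpha>) \<in> r - Id \<Longrightarrow> inserts B I s X (underS r \<beta>) (X \<beta>)"
    define E where "E \<beta> = (\<lambda>i. (X \<beta> i, X \<beta> i)) ` I" for \<beta>
    define G where "G = (\<Union>n. (\<lambda>i. (s n i, s (Suc n) i)) ` I) \<union> (\<lambda>b. (b, b)) ` B"
    let ?G = "(\<Union>\<beta>\<in>underS r \<alpha>. E \<beta>) \<union> G"
    have "elementary L M ?G"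
    proof (rule elementary_finite)
      fix H assume H: "H \<subseteq> ?G" "finite H"
      have "\<forall>p. \<exists>\<beta>. p \<in> H - G \<longrightarrow> \<beta> \<in> underS r \<alpha> \<and> p \<in> E \<beta>" using H(1) by blast
      from choice[OF this] obtain j where j: "\<And>p. p \<in> H - G \<Longrightarrow> j p \<in> underS r \<alpha> \<and> p \<in> E (j p)" by blast
      define F where "F = j ` (H - G)"
      have F: "finite F" "F \<subseteq> underS r \<alpha>" using H(2) j unfolding F_def by auto
      have "inserts B I s X (underS r \<beta>) (X \<beta>)" if "\<beta> \<in> F" for \<beta>
        using IH below F(2) that by blast
      from collapse_stretched[OF r(1) F(1) order.trans[OF F(2) uF] this] obtain \<rho> N where
        \<rho>: "\<rho> \<in> pointwise_stabilizer L M B" "\<And>\<beta>. \<beta> \<in> F \<Longrightarrow> \<exists>j<N. \<forall>i\<in>I. \<rho> (X \<beta> i) = s j i"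
          "\<And>n i. i \<in> I \<Longrightarrow> \<rho> (s n i) = s (N + n) i"
        by blast
      \<comment> \<open>The indices below \<open>N\<close> hold the collapsed terms and stay fixed;
        skipping \<open>N\<close> shifts the displaced copy of \<open>s\<close> by one.\<close>
      define u where "u n = (if n < N then n else Suc n)" for n
      have "strict_mono u" by (auto simp: strict_mono_def u_def)
      from indiscernible_shift[OF s sm this] obtain \<sigma> where
        \<sigma>: "\<sigma> \<in> pointwise_stabilizer L M B" "\<And>n i. i \<in> I \<Longrightarrow> \<sigma> (s n i) = s (u n) i"
        by blast
      \<comment> \<open>Conjugation by \<open>\<rho>\<close> carries this reindexing back to the
        uncollapsed terms.\<close>
      define \<tau> where "\<tau> = inv \<rho> \<circ> (\<sigma> \<circ> \<rho>)"
      have inv\<rho>: "inv \<rho> (\<rho> m) = m" for m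
        using \<rho>(1) automorphisms_inv_apply(2)[of \<rho> L M] by (simp add: pointwise_stabilizer_def)
      have \<tau>: "\<tau> \<in> pointwise_stabilizer L M B" unfolding \<tau>_def
        by (intro pointwise_stabilizer_comp pointwise_stabilizer_inv \<rho>(1) \<sigma>(1))
      have \<tau>X: "\<tau> (X \<beta> i) = X \<beta> i" if \<beta>: "\<beta> \<in> F" and i: "i \<in> I" for \<beta> i
      proof -
        obtain k where k: "k < N" "\<rho> (X \<beta> i) = s k i" using \<rho>(2)[OF \<beta>] i by blast
        then have "\<tau> (X \<beta> i) = inv \<rho> (\<rho> (X \<beta> i))" using \<sigma>(2)[OF i] by (simp add: \<tau>_def u_def)
        then show ?thesis by (simp add: inv\<rho>)
      qed
      have \<tau>s: "\<tau> (s n i) = s (Suc n) i" if "i \<in> I" for n i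
      proof -
        have "\<tau> (s n i) = inv \<rho> (\<rho> (s (Suc n) i))"
          using \<sigma>(2)[OF that] \<rho>(3)[OF that] by (simp add: \<tau>_def u_def)
        then show ?thesis by (simp add: inv\<rho>)
      qed
      have "H \<subseteq> {(m, \<tau> m) |m. True}"
      proof
        fix p assume p: "p \<in> H"
        show "p \<in> {(m, \<tau> m) |m. True}"
        proof (cases "p \<in> G")
          case True
          then show ?thesis using \<tau>s \<tau> by (auto simp: G_def pointwise_stabilizer_def)
        next
          case False
          then have "j p \<in> F" "p \<in> E (j p)" using p j by (auto simp: F_def)
          then obtain i where "i \<in> I" "p = (X (j p) i, X (j p) i)" by (auto simp: E_def)
          moreover have "\<tau> (X (j p) i) = X (j p) i" by (rule \<tau>X) fact+
          ultimately show ?thesis by (intro CollectI exI[of _ "X (j p) i"]) simp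
        qed
      qed
      moreover have "\<tau> \<in> automorphisms L M" using \<tau> by (simp add: pointwise_stabilizer_def)
      ultimately show "elementary L M H"
        by (intro elementary_subset[OF elementary_automorphism[OF "structure"]])
    qed
    moreover have "small \<kappa> ?G" unfolding G_def E_def
      by (intro small_Un' small_UN' small_image sm small_nat' small_subset[OF r(2) uF])
    ultimately obtain g where g: "g \<in> automorphisms L M" "\<forall>(x, y)\<in>?G. g x = y"
      by (rule homogeneity[THEN bexE])
    have eq: "g x = y" if "(x, y) \<in> ?G" for x y using bspec[OF g(2) that] by simp
    have "g b = b" if "b \<in> B" for b by (rule eq) (use that in \<open>auto simp: G_def\<close>)
    then have "g \<in> pointwise_stabilizer L M B" using g(1) by (simp add: pointwise_stabilizer_def)
    moreover have "g (X \<beta> i) = X \<beta> i" if "\<beta> \<in> underS r \<alpha>" "i \<in> I" for \<beta> i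
      by (rule eq) (use that in \<open>auto simp: E_def\<close>)
    moreover have "g (s n i) = s (Suc n) i" if "i \<in> I" for n i
      by (rule eq) (use that in \<open>auto simp: G_def\<close>)
    ultimately have "inserts B I s X (underS r \<alpha>) (\<lambda>i. inv g (s 0 i))"
      unfolding inserts_def using automorphisms_inv_apply(1)[OF g(1)] by (intro bexI[of _ g]) auto
    then show "\<exists>x. inserts B I s X (underS r \<alpha>) x" by (intro exI)
  qed
qed

end

section \<open>The algebraic kernel of a Morley sequence\<close>

context model_with_canonical_independence
begin

text \<open>The hypothesis separates a segment from one next term only. For a whole block the terms
  are added one by one after symmetry, the part of the block already treated being moved into the
  base.\<close>

lemma indep_initial_segments:
  fixes X :: "nat \<Rightarrow> 'm set"
  assumes X: "\<And>n. indep (\<Union>j<n. X j) B (X n)" and sX: "\<And>n. small \<kappa> (X n)" and B: "small \<kappa> B"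
  shows "indep (\<Union>j<n. X j) B (\<Union>j\<in>{n..<n + m}. X j)"
proof -
  let ?U = "\<lambda>n. \<Union>j<n. X j" and ?V = "\<lambda>m. \<Union>j\<in>{n..<n + m}. X j"
  have sU: "small \<kappa> (?U n)" for n by (intro small_UN' small_nat' sX)
  have sV: "small \<kappa> (?V m)" for m by (intro small_UN' small_nat' sX)
  have "indep (?V m) B (?U n)"
  proof (induction m)
    case 0
    have "indep {} B (?U n)"
      by (rule indep_mono[OF indep_sym[OF X[of n] sU sX B] sX sU B]) auto
    then show ?case by simp
  next
    case (Suc m)
    have "indep (X (n + m)) B (?U (n + m))" by (rule indep_sym[OF X sU sX B])
    then have "indep (X (n + m)) B (?V m \<union> ?U n)"
      by (rule indep_mono[OF _ sX sU B order.refl]) (auto intro: trans_less_add1)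
    then have "indep (X (n + m)) (B \<union> ?V m) (?U n)" by (rule indep_base_mono[OF _ sX sU B sV])
    then have "indep (X (n + m) \<union> ?V m) B (?U n)" using Suc
      by (rule indep_transitive_left[OF _ _ sX sV sU B])
    moreover have "?V (Suc m) = X (n + m) \<union> ?V m" by (auto simp: atLeastLessThanSuc)
    ultimately show ?case by simp
  qed
  then show ?thesis by (rule indep_sym[OF _ sV sU B])
qed

lemma acl_finite_many_terms:
  assumes "d \<in> acl L M (\<Union>\<beta>\<in>S. X \<beta>)"
  obtains F where "F \<subseteq> S" "finite F" "d \<in> acl L M (\<Union>\<beta>\<in>F. X \<beta>)"
proof -
  obtain A where A: "A \<subseteq> (\<Union>\<beta>\<in>S. X \<beta>)" "finite A" "d \<in> acl L M A"
    using acl_finite_character[OF assms] by blast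
  have "\<forall>a. \<exists>\<beta>. a \<in> A \<longrightarrow> \<beta> \<in> S \<and> a \<in> X \<beta>" using A(1) by blast
  from choice[OF this] obtain b where b: "\<And>a. a \<in> A \<Longrightarrow> b a \<in> S \<and> a \<in> X (b a)" by blast
  have "A \<subseteq> (\<Union>\<beta>\<in>b ` A. X \<beta>)" using b by blast
  then have "d \<in> acl L M (\<Union>\<beta>\<in>b ` A. X \<beta>)" using A(3) by (rule subsetD[OF acl_mono])
  moreover have "b ` A \<subseteq> S" using b by blast
  ultimately show ?thesis using that[of "b ` A"] A(2) by blast
qed

text \<open>An element \<open>d\<close> of the kernel is algebraic over the first \<open>n\<close>
  terms. Indiscernibility over \<open>d\<close> gives a shift by \<open>n\<close> that fixes
  \<open>d\<close>, so \<open>d\<close> is also algebraic over the next \<open>n\<close> terms; the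
  two blocks are independent over \<open>D\<close>.\<close>

lemma aker_subset:
  fixes s :: "nat \<Rightarrow> 'i \<Rightarrow> 'm"
  assumes B: "small \<kappa> B" and I: "small \<kappa> I"
    and s: "indiscernible L M s I B" "\<And>n. indep (\<Union>j<n. s j ` I) B (s n ` I)"
    and D: "D \<subseteq> B" "acl L M D = D" "\<And>n. indep (s n ` I) D B"
  shows "aker L M s I \<subseteq> D"
proof
  fix d assume d: "d \<in> aker L M s I"
  have ss: "small \<kappa> (s n ` I)" for n using I by (rule small_image)
  have sD: "small \<kappa> D" by (rule small_subset[OF B D(1)])
  have "d \<in> acl L M (\<Union>n\<in>UNIV. s n ` I)" using d by (simp add: aker_def)
  then obtain F where F: "finite F" "d \<in> acl L M (\<Union>n\<in>F. s n ` I)" by (rule acl_finite_many_terms)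
  obtain n where "\<And>j. j \<in> F \<Longrightarrow> j < n" using F(1) by (auto simp: finite_nat_set_iff_bounded)
  then have "(\<Union>n\<in>F. s n ` I) \<subseteq> (\<Union>j<n. s j ` I)" by auto
  then have dU: "d \<in> acl L M (\<Union>j<n. s j ` I)" using F(2) by (rule subsetD[OF acl_mono])
  have ind: "indiscernible L M s I {d}" using d by (simp add: aker_def)
  have sd: "small \<kappa> {d}" by (simp add: small_finite')
  have "strict_mono (\<lambda>j. n + j)" by (simp add: strict_mono_def)
  from indiscernible_shift[OF ind I sd this] obtain \<sigma> where
    \<sigma>: "\<sigma> \<in> stab {d}" "\<And>j i. i \<in> I \<Longrightarrow> \<sigma> (s j i) = s (n + j) i"
    by blast
  let ?V = "\<Union>j\<in>{n..<n + n}. s j ` I"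
  have "\<sigma> d \<in> \<sigma> ` acl L M (\<Union>j<n. s j ` I)" using dU by (rule imageI)
  then have "d \<in> acl L M (\<sigma> ` (\<Union>j<n. s j ` I))"
    using acl_automorphism[OF "structure" stab_automorphism[OF \<sigma>(1)]] stab_fix[OF \<sigma>(1), of d] by simp
  moreover have "\<sigma> ` (\<Union>j<n. s j ` I) \<subseteq> ?V"
  proof
    fix y assume "y \<in> \<sigma> ` (\<Union>j<n. s j ` I)"
    then obtain j i where "j < n" "i \<in> I" "y = \<sigma> (s j i)" by blast
    then have "y \<in> s (n + j) ` I" "n + j \<in> {n..<n + n}" using \<sigma>(2) by auto
    then show "y \<in> ?V" by blast
  qed
  ultimately have dV: "d \<in> acl L M ?V" by (rule subsetD[OF acl_mono, rotated])
  have sU: "small \<kappa> (\<Union>j<n. s j ` I)" and sV: "small \<kappa> ?V" by (intro small_UN' small_nat' ss)+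
  \<comment> \<open>The sequence has order type \<omega>; \<open>natLeq\<close> fits it to the lemma
    for arbitrary well-orders.\<close>
  have below: "underS natLeq k = {..<k}" for k by (auto simp: natLeq_underS_less)
  have "indep (\<Union>j\<in>underS natLeq n. s j ` I) D B"
    by (rule indep_sequence_smaller_base[OF natLeq_Well_order small_nat' ss B D(1) _ D(3)])
      (simp add: below s(2))
  then have "indep (\<Union>j<n. s j ` I) D B" by (simp add: below)
  then have "indep (\<Union>j<n. s j ` I) D (?V \<union> B)"
    using indep_initial_segments[of "\<lambda>j. s j ` I", OF s(2) ss B]
    by (rule indep_transitive_right[OF _ _ D(1) sU B sV])
  then have "indep (\<Union>j<n. s j ` I) D ?V"
    by (rule indep_mono[OF _ sU small_Un'[OF sV B] sD]) auto
  from indep_acl_Int[OF this sU sV sD] show "d \<in> D" using dU dV D(2) by blast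
qed

text \<open>Local character is used along the stretched sequence, and \<open>D\<close> is the part
  of \<open>B\<close> algebraic over a segment \<open>E\<close> of inserted terms. An algebraic
  dependence on \<open>E\<close> uses finitely many terms; collapsing these into \<open>s\<close>
  fixes \<open>B\<close>, so the element is algebraic over \<open>s\<close> as well.\<close>

lemma indep_over_acl_terms:
  fixes s :: "nat \<Rightarrow> 'i \<Rightarrow> 'm"
  assumes B: "small \<kappa> B" "acl L M B = B" and I: "small \<kappa> I"
    and s: "indiscernible L M s I B" "\<And>n. indep (\<Union>j<n. s j ` I) B (s n ` I)"
  obtains D where "D \<subseteq> acl L M (\<Union>n. s n ` I) \<inter> B" "acl L M D = D" "indep (s 0 ` I) D B"
proof -
  from long_sequence_local_character[OF B(1)] obtain r :: "'k set rel" where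
    r: "Well_order r" "small \<kappa> (Field r)"
      "\<And>C X. small \<kappa> C \<Longrightarrow> (\<And>\<beta>. small \<kappa> (X \<beta>)) \<Longrightarrow>
        \<exists>\<alpha>\<in>Field r. indep B (C \<union> (\<Union>\<beta>\<in>underS r \<alpha>. X \<beta>)) (X \<alpha>)"
    by metis
  from stretched_sequence[OF r(1,2) s(1) I B(1)] obtain X :: "'k set \<Rightarrow> 'i \<Rightarrow> 'm" where
    X: "\<And>\<alpha>. inserts B I s X (underS r \<alpha>) (X \<alpha>)" by blast
  have sX: "small \<kappa> (X \<alpha> ` I)" for \<alpha> using I by (rule small_image)
  have ss: "small \<kappa> (s n ` I)" for n using I by (rule small_image)
  have uF: "underS r \<alpha> \<subseteq> Field r" for \<alpha> unfolding underS_def Field_def by blast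
  obtain \<alpha> where "indep B ({} \<union> (\<Union>\<beta>\<in>underS r \<alpha>. X \<beta> ` I)) (X \<alpha> ` I)"
    using r(3)[OF small_finite'[OF finite.emptyI], of "\<lambda>\<beta>. X \<beta> ` I", OF sX] by (elim bexE)
  moreover define E where "E = (\<Union>\<beta>\<in>underS r \<alpha>. X \<beta> ` I)"
  ultimately have BE: "indep B E (X \<alpha> ` I)" by simp
  have sE: "small \<kappa> E" unfolding E_def by (rule small_UN'[OF small_subset[OF r(2) uF] sX])
  obtain \<tau> where \<tau>: "\<tau> \<in> stab B" "\<And>\<beta> i. \<beta> \<in> underS r \<alpha> \<Longrightarrow> i \<in> I \<Longrightarrow> \<tau> (X \<beta> i) = X \<beta> i"
    "\<And>i. i \<in> I \<Longrightarrow> \<tau> (X \<alpha> i) = s 0 i"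
    using X[of \<alpha>] unfolding inserts_def by blast
  have collapse: "\<exists>\<rho>\<in>stab B. \<exists>N. \<rho> ` (\<Union>\<beta>\<in>F. X \<beta> ` I) \<subseteq> (\<Union>j<N. s j ` I) \<and> (\<forall>i\<in>I. \<rho> (s 0 i) = s N i)"
    if F: "finite F" "F \<subseteq> underS r \<alpha>" for F
  proof -
    obtain \<rho> N where \<rho>: "\<rho> \<in> stab B" "\<And>\<beta>. \<beta> \<in> F \<Longrightarrow> \<exists>j<N. \<forall>i\<in>I. \<rho> (X \<beta> i) = s j i"
      "\<And>n i. i \<in> I \<Longrightarrow> \<rho> (s n i) = s (N + n) i"
      using collapse_stretched[OF r(1) F(1) order.trans[OF F(2) uF] X] by blast
    have "\<rho> ` (\<Union>\<beta>\<in>F. X \<beta> ` I) \<subseteq> (\<Union>j<N. s j ` I)"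
    proof
      fix y assume "y \<in> \<rho> ` (\<Union>\<beta>\<in>F. X \<beta> ` I)"
      then obtain \<beta> i where \<beta>: "\<beta> \<in> F" "i \<in> I" "y = \<rho> (X \<beta> i)" by blast
      then obtain j where "j < N" "y = s j i" using \<rho>(2) by blast
      then show "y \<in> (\<Union>j<N. s j ` I)" using \<beta>(2) by blast
    qed
    moreover have "\<forall>i\<in>I. \<rho> (s 0 i) = s N i" using \<rho>(3)[of _ 0] by simp
    ultimately show ?thesis using \<rho>(1) by blast
  qed
  \<comment> \<open>The Morley condition is known for \<open>s\<close> alone. \<open>\<tau>\<close>
    takes \<open>X \<alpha>\<close> to \<open>s 0\<close> without moving the earlier terms, and
    \<open>\<rho>\<close> then takes finitely many of these below \<open>N\<close> and
    \<open>s 0\<close> to \<open>s N\<close>, where the condition at \<open>N\<close>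
    applies.\<close>
  have "indep E B (X \<alpha> ` I)"
  proof (rule finite_character[OF sE sX B(1)])
    fix A0 assume A0: "A0 \<subseteq> E" "finite A0"
    have "\<forall>a. \<exists>\<beta>. a \<in> A0 \<longrightarrow> \<beta> \<in> underS r \<alpha> \<and> a \<in> X \<beta> ` I" using A0(1) unfolding E_def by blast
    from choice[OF this] obtain b where b: "\<And>a. a \<in> A0 \<Longrightarrow> b a \<in> underS r \<alpha> \<and> a \<in> X (b a) ` I" by blast
    have "finite (b ` A0)" "b ` A0 \<subseteq> underS r \<alpha>" using A0(2) b by auto
    from collapse[OF this] obtain \<rho> N where \<rho>: "\<rho> \<in> stab B"
      "\<rho> ` (\<Union>\<beta>\<in>b ` A0. X \<beta> ` I) \<subseteq> (\<Union>j<N. s j ` I)" "\<forall>i\<in>I. \<rho> (s 0 i) = s N i"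
      by (elim bexE exE conjE)
    let ?h = "inv (\<rho> \<circ> \<tau>)"
    have h: "\<rho> \<circ> \<tau> \<in> stab B" by (rule pointwise_stabilizer_comp[OF \<rho>(1) \<tau>(1)])
    have "(\<rho> \<circ> \<tau>) ` A0 \<subseteq> (\<Union>j<N. s j ` I)"
    proof
      fix y assume "y \<in> (\<rho> \<circ> \<tau>) ` A0"
      then obtain a where a: "a \<in> A0" "y = \<rho> (\<tau> a)" by auto
      then obtain i where "i \<in> I" "a = X (b a) i" using b by blast
      then have "\<tau> a = a" using \<tau>(2) b a(1) by metis
      moreover have "a \<in> (\<Union>\<beta>\<in>b ` A0. X \<beta> ` I)" using a(1) b by blast
      ultimately have "y \<in> \<rho> ` (\<Union>\<beta>\<in>b ` A0. X \<beta> ` I)" using a(2) by simp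
      then show "y \<in> (\<Union>j<N. s j ` I)" using \<rho>(2) by blast
    qed
    moreover have "(\<rho> \<circ> \<tau>) ` X \<alpha> ` I = s N ` I"
      using \<tau>(3) \<rho>(3) by (simp add: image_image)
    moreover have sU: "small \<kappa> (\<Union>j<N. s j ` I)" by (intro small_UN' small_nat' ss)
    ultimately have "indep ((\<rho> \<circ> \<tau>) ` A0) B ((\<rho> \<circ> \<tau>) ` X \<alpha> ` I)"
      using indep_mono[OF s(2)[of N] sU ss B(1)] by simp
    then have "indep (?h ` (\<rho> \<circ> \<tau>) ` A0) B (?h ` (\<rho> \<circ> \<tau>) ` X \<alpha> ` I)"
      by (rule indep_stab[OF _ pointwise_stabilizer_inv[OF h]])
        (use small_finite'[OF A0(2)] sX B small_image in blast)+
    then show "indep A0 B (X \<alpha> ` I)" unfolding stab_inv_image(1)[OF h] .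
  qed
  with BE have ind: "indep (X \<alpha> ` I) (acl L M E \<inter> B) B"
    by (rule indep_over_acl_Int[OF _ _ sE B(1) sX B(2)])
  \<comment> \<open>\<open>\<tau>\<close> fixes \<open>B\<close>, and with it the base, and turns
    the statement about \<open>X \<alpha>\<close> into one about a term of \<open>s\<close>.\<close>
  have "indep (\<tau> ` X \<alpha> ` I) (acl L M E \<inter> B) (\<tau> ` B)"
    by (rule indep_stab[OF ind _ sX B(1) small_subset[OF B(1) Int_lower2]])
      (use \<tau>(1) pointwise_stabilizer_mono[OF Int_lower2] in blast)
  moreover have "\<tau> ` X \<alpha> ` I = s 0 ` I" using \<tau>(3) by (simp add: image_image)
  ultimately have "indep (s 0 ` I) (acl L M E \<inter> B) B" using stab_image[OF \<tau>(1), of B] by simp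
  moreover have "acl L M E \<inter> B \<subseteq> acl L M (\<Union>n. s n ` I) \<inter> B"
  proof
    fix c assume c: "c \<in> acl L M E \<inter> B"
    then have "c \<in> acl L M (\<Union>\<beta>\<in>underS r \<alpha>. X \<beta> ` I)" by (simp add: E_def)
    then obtain F where F: "F \<subseteq> underS r \<alpha>" "finite F" "c \<in> acl L M (\<Union>\<beta>\<in>F. X \<beta> ` I)"
      by (rule acl_finite_many_terms)
    from collapse[OF F(2,1)] obtain \<rho> N where \<rho>: "\<rho> \<in> stab B"
      "\<rho> ` (\<Union>\<beta>\<in>F. X \<beta> ` I) \<subseteq> (\<Union>j<N. s j ` I)" by (elim bexE exE conjE)
    have "\<rho> c \<in> acl L M (\<rho> ` (\<Union>\<beta>\<in>F. X \<beta> ` I))"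
      using acl_automorphism[OF "structure" stab_automorphism[OF \<rho>(1)]] F(3) by blast
    then have "c \<in> acl L M (\<rho> ` (\<Union>\<beta>\<in>F. X \<beta> ` I))" using stab_fix[OF \<rho>(1), of c] c by simp
    moreover have "\<rho> ` (\<Union>\<beta>\<in>F. X \<beta> ` I) \<subseteq> (\<Union>n. s n ` I)" using \<rho>(2) by blast
    ultimately have "c \<in> acl L M (\<Union>n. s n ` I)" by (rule subsetD[OF acl_mono, rotated])
    then show "c \<in> acl L M (\<Union>n. s n ` I) \<inter> B" using c by simp
  qed
  ultimately show ?thesis using that acl_Int_closed[OF sE B(2)] by blast
qed

text \<open>A weak canonical base \<open>C\<close> already exists, so only its equality with the
  kernel is at stake. Terms of \<open>s\<close> are conjugate to the tuple over \<open>B\<close>,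
  hence bases pass between the two: \<open>C\<close> bounds the kernel from above, and minimality
  puts \<open>C\<close> inside the closure of \<open>s\<close>.\<close>

theorem weak_canonical_base_aker:
  assumes B: "small \<kappa> B" "acl L M B = B" and I: "small \<kappa> I"
    and s: "morley_sequence L M indep (tp L M a I B) I B s"
  shows "weak_canonical_base L M indep a I B (aker L M s I)"
proof -
  have s': "indiscernible L M s I B" "\<And>n. tp L M (s n) I B = tp L M a I B"
    "\<And>n. indep (\<Union>j<n. s j ` I) B (s n ` I)"
    using s unfolding morley_sequence_def by blast+
  have sa: "small \<kappa> (a ` I)" using I by (rule small_image)
  obtain C where C: "weak_canonical_base L M indep a I B C"
    using weak_canonical_base_exists[OF I B] by blast
  then have CB: "C \<subseteq> B" "acl L M C = C" "indep (a ` I) C B"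
    and least: "\<And>D. D \<subseteq> B \<Longrightarrow> acl L M D = D \<Longrightarrow> indep (a ` I) D B \<Longrightarrow> C \<subseteq> D"
    unfolding weak_canonical_base_def by simp_all
  have conj: "\<exists>g\<in>stab B. s n ` I = g ` a ` I" for n
  proof -
    obtain g where "g \<in> stab B" "\<And>i. i \<in> I \<Longrightarrow> g (a i) = s n i"
      using tp_eq_conjugate[OF s'(2)[of n, symmetric] I B(1)] by blast
    then show ?thesis by (intro bexI[of _ g]) (simp_all add: image_image)
  qed
  have "aker L M s I \<subseteq> C"
  proof (rule aker_subset[OF B(1) I s'(1,3) CB(1,2)])
    fix n
    obtain g where g: "g \<in> stab B" "s n ` I = g ` a ` I" using conj[of n] by (elim bexE)
    have "g \<in> stab C" using g(1) by (rule subsetD[OF pointwise_stabilizer_mono[OF CB(1)]])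
    then have "indep (g ` a ` I) C (g ` B)"
      by (rule indep_stab[OF CB(3) _ sa B(1) small_subset[OF B(1) CB(1)]])
    then show "indep (s n ` I) C B" using g(2) stab_image[OF g(1), of B] by simp
  qed
  moreover have "C \<subseteq> aker L M s I"
  proof
    fix c assume c: "c \<in> C"
    obtain D where D: "D \<subseteq> acl L M (\<Union>n. s n ` I) \<inter> B" "acl L M D = D" "indep (s 0 ` I) D B"
      by (rule indep_over_acl_terms[OF B I s'(1,3)])
    have DB: "D \<subseteq> B" using D(1) by blast
    obtain g where g: "g \<in> stab B" "s 0 ` I = g ` a ` I" using conj[of 0] by (elim bexE)
    have "indep (a ` I) D B"
      by (rule indep_stab_pull_back[OF _ g(1) DB sa B(1)]) (use D(3) g(2) in simp)
    then have "c \<in> D" using least[OF DB D(2)] c by blast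
    \<comment> \<open>Elements of \<open>B\<close> satisfy the indiscernibility clause of the kernel
      automatically, so algebraicity over the sequence is the remaining condition.\<close>
    then have "c \<in> acl L M (\<Union>n. s n ` I)" "{c} \<subseteq> B" using D(1) by auto
    then show "c \<in> aker L M s I"
      using indiscernible_subset[OF s'(1)] by (simp add: aker_def)
  qed
  ultimately show ?thesis using C by simp
qed

end

theorem theorem3p20:
  fixes L :: "('s, 'f, 'r) language"
    and T :: "('s, 'f, 'r) fm set"
    and M :: "('s, 'f, 'r, 'm) struct"
    and \<kappa> :: "'k rel"
    and indep :: "'m set \<Rightarrow> 'm set \<Rightarrow> 'm set \<Rightarrow> bool"
  assumes "big_saturated_model L T M \<kappa>"
  shows "(strict_independence_relation L M \<kappa> indep \<longrightarrow>
            (has_weak_canonical_bases L M \<kappa> indep \<longleftrightarrow> canonical_independence_relation L M \<kappa> indep)) \<and>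
         (canonical_independence_relation L M \<kappa> indep \<longrightarrow>
            (\<forall>B (I :: 'k set) a s. small \<kappa> B \<and> acl L M B = B \<and> small \<kappa> I \<and>
               morley_sequence L M indep (tp L M a I B) I B s \<longrightarrow>
                 weak_canonical_base L M indep a I B (aker L M s I)))"
proof -
  have strict: "model_with_strict_independence L T M \<kappa> indep"
    if "strict_independence_relation L M \<kappa> indep"
    using assms that unfolding model_with_strict_independence_def model_with_independence_def
      strict_independence_relation_def by blast
  have canonical: "model_with_canonical_independence L T M \<kappa> indep"
    if "canonical_independence_relation L M \<kappa> indep"
    using strict that unfolding model_with_canonical_independence_def
      canonical_independence_relation_def by blast
  show ?thesis
  proof (intro conjI impI allI iffI)
    assume "strict_independence_relation L M \<kappa> indep" "has_weak_canonical_bases L M \<kappa> indep"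
    then show "canonical_independence_relation L M \<kappa> indep"
      by (intro model_with_strict_independence.canonical_if_weak_canonical_bases[OF strict])
  next
    assume "canonical_independence_relation L M \<kappa> indep"
    from model_with_canonical_independence.weak_canonical_base_exists[OF canonical[OF this]]
    show "has_weak_canonical_bases L M \<kappa> indep"
      unfolding has_weak_canonical_bases_def by blast
  next
    fix B and I :: "'k set" and a s
    assume "canonical_independence_relation L M \<kappa> indep"
      and "small \<kappa> B \<and> acl L M B = B \<and> small \<kappa> I \<and> morley_sequence L M indep (tp L M a I B) I B s"
    then show "weak_canonical_base L M indep a I B (aker L M s I)"
      using model_with_canonical_independence.weak_canonical_base_aker[OF canonical] by blast
  qed
qed

end
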